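(* Let $X=\mathbb R^d$ and let $\kappa\colon\mathbb R^d\to(0,\infty)$ be bounded and continuous with $\sup_{x\in\mathbb R^d}\sup_{|y|\le1}\frac{\kappa(x)}{\kappa(x-y)}<\infty$. Let $(\phi_n)_{n\in\mathbb N}\subset C_c^\infty$ satisfy $0\le\phi_n\le1$ and $\phi_n(x)=1$ for all $n\in\mathbb N$ and $|x|\le n$. Let $(S(t))_{t\ge0}$ and $(T(t))_{t\ge0}$ be two convex monotone semigroups on $C_\kappa$ with generators $A$ and $B$, respectively. Assume that for every $f\in\mathcal L_T\cap\mathrm{Lip}_b$ with $f\ge0$ and every $\varepsilon>0$ there exist $\delta,t_0>0$ with $$T(t)(\tau_xf)\le\tau_xT(t)f+\frac{\varepsilon t}{\kappa}\quad\text{for all }t\in[0,t_0]\text{ and }|x|\le\delta,$$ and that $T(t)\colon\mathrm{Lip}_b\to\mathrm{Lip}_b$ for all $t\ge0$. Furthermore, let $C_c^\infty\subset D(A)\cap D(B)$ and let $(B(f\phi_n))_{n\in\mathbb N}$ be bounded above, i.e. $\sup_{n}\|(B(f\phi_n))^+\|_\kappa<\infty$, for all $f\in C_b^\infty\cap\mathcal L_T^+$ with $f\ge0$. Assume that $$Af\le Bf\quad\text{for all }f\in C_c^\infty.$$ Then $S(t)f\le T(t)f$ for all $t\ge0$ and $f\in C_\kappa$ with $f\ge0$.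
   Context: $\|f\|_\kappa:=\sup_{x}|f(x)|\kappa(x)$, $f^+=\max\{f,0\}$; functions are ordered pointwise. $C_\kappa$ is the space of continuous $f\colon\mathbb R^d\to\mathbb R$ with $\|f\|_\kappa<\infty$. Convergence $f_n\to f$ in $C_\kappa$ (mixed topology) means $\sup_n\|f_n\|_\kappa<\infty$ and $f_n\to f$ uniformly on every compact set; limits as $h\downarrow0$ are along all sequences $h_n>0$, $h_n\to0$. $\mathrm{Lip}_b$ is the space of bounded Lipschitz continuous functions $\mathbb R^d\to\mathbb R$; $C_b^\infty$ is the space of bounded infinitely differentiable functions with all partial derivatives bounded; $C_c^\infty$ the infinitely differentiable functions with compact support. Shift: $(\tau_xf)(y):=f(x+y)$. A convex monotone semigroup on $C_\kappa$ is a family of operators $S(t)\colon C_\kappa\to C_\kappa$, $t\ge0$, such that: (S1) each $S(t)$ is convex and monotone, and $S(t)f_n\downarrow0$ pointwise whenever $(f_n)\subset C_\kappa$ decreases pointwise to $0$; (S2) $S(0)f=f$ and $S(s+t)f=S(s)S(t)f$; (S3) $\sup_{t\in[0,T]}\|S(t)\frac r\kappa\|_\kappa<\infty$ for all $r,T\ge0$; (S4) for all $t\ge0$, $f\in C_\kappa$: $\limsup_n(S(s_n)f)(x_n)\le(S(t)f)(x)$ for all $x$ and all sequences $0\le s_n\to t$, $x_n\to x$. $\mathcal L_T$ (resp. $\mathcal L_T^+$) is the set of $f\in C_\kappa$ with $\limsup_{h\downarrow0}\|\frac{T(h)f-f}{h}\|_\kappa<\infty$ (resp. $\limsup_{h\downarrow0}\|\frac{(T(h)f-f)^+}{h}\|_\kappa<\infty$).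 The generator of $(S(t))$ is $Af:=\lim_{h\downarrow0}\frac{S(h)f-f}{h}\in C_\kappa$ (mixed topology), with domain $D(A)$ the set of $f\in C_\kappa$ for which this limit exists; $B$ is defined in the same way from $(T(t))$. *)

theory Defs
  imports "HOL-Analysis.Analysis"
begin

section \<open>The weighted space and its mixed topology\<close>

text \<open>Values in \<open>ereal\<close>, so that the supremum is \<open>\<infinity>\<close> for functions of infinite norm.\<close>
definition wnorm :: "('a \<Rightarrow> real) \<Rightarrow> ('a \<Rightarrow> real) \<Rightarrow> ereal" where
  "wnorm \<kappa> f = (SUP x. ereal (\<bar>f x\<bar> * \<kappa> x))"

definition pos_part :: "('a \<Rightarrow> real) \<Rightarrow> 'a \<Rightarrow> real" where
  "pos_part f x = max (f x) 0"

definition C_weighted :: "('a::topological_space \<Rightarrow> real) \<Rightarrow> ('a \<Rightarrow> real) set" where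
  "C_weighted \<kappa> = {f. continuous_on UNIV f \<and> wnorm \<kappa> f < \<infinity>}"

definition mixed_tendsto ::
  "('a::topological_space \<Rightarrow> real) \<Rightarrow> (nat \<Rightarrow> 'a \<Rightarrow> real) \<Rightarrow> ('a \<Rightarrow> real) \<Rightarrow> bool" where
  "mixed_tendsto \<kappa> F f \<longleftrightarrow>
     (SUP n. wnorm \<kappa> (F n)) < \<infinity> \<and> (\<forall>K. compact K \<longrightarrow> uniform_limit K F f sequentially)"


section \<open>Function spaces on Euclidean space\<close>

definition shift :: "'a::plus \<Rightarrow> ('a \<Rightarrow> real) \<Rightarrow> 'a \<Rightarrow> real" where
  "shift x f y = f (x + y)"

definition Lip_b :: "('a::metric_space \<Rightarrow> real) set" where
  "Lip_b = {f. bounded (range f) \<and> (\<exists>L. L-lipschitz_on UNIV f)}"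

definition partial_deriv :: "'n::finite \<Rightarrow> (real^'n \<Rightarrow> real) \<Rightarrow> real^'n \<Rightarrow> real" where
  "partial_deriv i f x = frechet_derivative f (at x) (axis i 1)"

text \<open>\<open>iter_partial [i\<^sub>1, \<dots>, i\<^sub>k] f\<close> is the partial derivative of order \<open>k\<close> in the coordinate
  directions \<open>i\<^sub>1, \<dots>, i\<^sub>k\<close>, and \<open>f\<close> itself for the empty list.\<close>
definition iter_partial :: "'n::finite list \<Rightarrow> (real^'n \<Rightarrow> real) \<Rightarrow> real^'n \<Rightarrow> real" where
  "iter_partial is f = foldr partial_deriv is f"

text \<open>Infinitely differentiable: partial derivatives of every order are (totally) differentiable
  everywhere. As differentiability gives continuity, these are the functions all of whose partial
  derivatives exist and are continuous.\<close>
definition C_inf :: "(real^'n::finite \<Rightarrow> real) set" where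
  "C_inf = {f. \<forall>is x. iter_partial is f differentiable (at x)}"

definition C_b_inf :: "(real^'n::finite \<Rightarrow> real) set" where
  "C_b_inf = {f \<in> C_inf. \<forall>is. bounded (range (iter_partial is f))}"

definition C_c_inf :: "(real^'n::finite \<Rightarrow> real) set" where
  "C_c_inf = {f \<in> C_inf. compact (closure {x. f x \<noteq> 0})}"


section \<open>Convex monotone semigroups\<close>

text \<open>The operators are total functions on \<open>'a \<Rightarrow> real\<close>, of which only the restrictions to
  \<^term>\<open>C_weighted \<kappa>\<close> and to times \<open>t \<ge> 0\<close> matter. The order on functions is the pointwise one of
  the library.\<close>
definition convex_monotone_semigroup ::
  "('a::topological_space \<Rightarrow> real) \<Rightarrow> (real \<Rightarrow> ('a \<Rightarrow> real) \<Rightarrow> ('a \<Rightarrow> real)) \<Rightarrow> bool" where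
  "convex_monotone_semigroup \<kappa> S \<longleftrightarrow>
     (\<forall>t\<ge>0. \<forall>f\<in>C_weighted \<kappa>. S t f \<in> C_weighted \<kappa>) \<and>
     \<comment> \<open>convexity, monotonicity and continuity from above at zero\<close>
     (\<forall>t\<ge>0. \<forall>f\<in>C_weighted \<kappa>. \<forall>g\<in>C_weighted \<kappa>. \<forall>c\<in>{0..1}.
        S t (\<lambda>x. c * f x + (1 - c) * g x) \<le> (\<lambda>x. c * S t f x + (1 - c) * S t g x)) \<and>
     (\<forall>t\<ge>0. mono_on (C_weighted \<kappa>) (S t)) \<and>
     (\<forall>t\<ge>0. \<forall>F. (\<forall>n. F n \<in> C_weighted \<kappa>) \<and> decseq F \<and> (\<forall>x. (\<lambda>n. F n x) \<longlonglongrightarrow> 0) \<longrightarrow>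
        decseq (\<lambda>n. S t (F n)) \<and> (\<forall>x. (\<lambda>n. S t (F n) x) \<longlonglongrightarrow> 0)) \<and>
     \<comment> \<open>semigroup property\<close>
     (\<forall>f\<in>C_weighted \<kappa>. S 0 f = f) \<and>
     (\<forall>s\<ge>0. \<forall>t\<ge>0. \<forall>f\<in>C_weighted \<kappa>. S (s + t) f = S s (S t f)) \<and>
     \<comment> \<open>local boundedness\<close>
     (\<forall>r\<ge>0. \<forall>T\<ge>0. (SUP t\<in>{0..T}. wnorm \<kappa> (S t (\<lambda>x. r / \<kappa> x))) < \<infinity>) \<and>
     \<comment> \<open>joint upper semicontinuity in time and space\<close>
     (\<forall>t\<ge>0. \<forall>f\<in>C_weighted \<kappa>. \<forall>x s y. (\<forall>n. 0 \<le> s n) \<and> s \<longlonglongrightarrow> t \<and> y \<longlonglongrightarrow> x \<longrightarrow>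
        limsup (\<lambda>n. ereal (S (s n) f (y n))) \<le> ereal (S t f x))"

definition diff_quot ::
  "(real \<Rightarrow> ('a \<Rightarrow> real) \<Rightarrow> ('a \<Rightarrow> real)) \<Rightarrow> real \<Rightarrow> ('a \<Rightarrow> real) \<Rightarrow> 'a \<Rightarrow> real" where
  "diff_quot S h f x = (S h f x - f x) / h"

text \<open>Limits as \<open>h \<down> 0\<close> are taken along all sequences of this kind.\<close>
definition pos_null_seq :: "(nat \<Rightarrow> real) \<Rightarrow> bool" where
  "pos_null_seq h \<longleftrightarrow> (\<forall>n. 0 < h n) \<and> h \<longlonglongrightarrow> 0"

definition Lip_set ::
  "('a::topological_space \<Rightarrow> real) \<Rightarrow> (real \<Rightarrow> ('a \<Rightarrow> real) \<Rightarrow> ('a \<Rightarrow> real)) \<Rightarrow> ('a \<Rightarrow> real) set" where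
  "Lip_set \<kappa> S = {f \<in> C_weighted \<kappa>. \<forall>h. pos_null_seq h \<longrightarrow>
     limsup (\<lambda>n. wnorm \<kappa> (diff_quot S (h n) f)) < \<infinity>}"

definition Lip_set_pos ::
  "('a::topological_space \<Rightarrow> real) \<Rightarrow> (real \<Rightarrow> ('a \<Rightarrow> real) \<Rightarrow> ('a \<Rightarrow> real)) \<Rightarrow> ('a \<Rightarrow> real) set" where
  "Lip_set_pos \<kappa> S = {f \<in> C_weighted \<kappa>. \<forall>h. pos_null_seq h \<longrightarrow>
     limsup (\<lambda>n. wnorm \<kappa> (pos_part (diff_quot S (h n) f))) < \<infinity>}"

definition has_generator_value ::
  "('a::topological_space \<Rightarrow> real) \<Rightarrow> (real \<Rightarrow> ('a \<Rightarrow> real) \<Rightarrow> ('a \<Rightarrow> real)) \<Rightarrow>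
    ('a \<Rightarrow> real) \<Rightarrow> ('a \<Rightarrow> real) \<Rightarrow> bool" where
  "has_generator_value \<kappa> S f g \<longleftrightarrow> g \<in> C_weighted \<kappa> \<and>
     (\<forall>h. pos_null_seq h \<longrightarrow> mixed_tendsto \<kappa> (\<lambda>n. diff_quot S (h n) f) g)"

definition gen_domain ::
  "('a::topological_space \<Rightarrow> real) \<Rightarrow> (real \<Rightarrow> ('a \<Rightarrow> real) \<Rightarrow> ('a \<Rightarrow> real)) \<Rightarrow> ('a \<Rightarrow> real) set" where
  "gen_domain \<kappa> S = {f \<in> C_weighted \<kappa>. \<exists>g. has_generator_value \<kappa> S f g}"

definition generator ::
  "('a::topological_space \<Rightarrow> real) \<Rightarrow> (real \<Rightarrow> ('a \<Rightarrow> real) \<Rightarrow> ('a \<Rightarrow> real)) \<Rightarrow>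
    ('a \<Rightarrow> real) \<Rightarrow> ('a \<Rightarrow> real)" where
  "generator \<kappa> S f = (THE g. has_generator_value \<kappa> S f g)"

text \<open>The limit is unique, so \<^term>\<open>generator \<kappa> S f\<close> is meaningful on \<^term>\<open>gen_domain \<kappa> S\<close>.\<close>
lemma generator_eqI:
  assumes "has_generator_value \<kappa> S f g"
  shows "generator \<kappa> S f = g"
proof -
  define h :: "nat \<Rightarrow> real" where "h = (\<lambda>n. inverse (real (Suc n)))"
  have h: "pos_null_seq h"
    using LIMSEQ_inverse_real_of_nat by (simp add: pos_null_seq_def h_def)
  have lim: "(\<lambda>n. diff_quot S (h n) f x) \<longlonglongrightarrow> g' x"
    if "has_generator_value \<kappa> S f g'" for g' x
  proof -
    have "\<forall>K. compact K \<longrightarrow> uniform_limit K (\<lambda>n. diff_quot S (h n) f) g' sequentially"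
      using that h by (simp add: has_generator_value_def mixed_tendsto_def)
    from this[rule_format, of "{x}"] show ?thesis by simp
  qed
  have "g' = g" if "has_generator_value \<kappa> S f g'" for g'
    using LIMSEQ_unique[OF lim[OF that] lim[OF assms]] by (rule ext)
  with assms show ?thesis
    unfolding generator_def by (rule the_equality)
qed

end

theory Submission
  imports Defs
begin

text \<open>
  Why \<open>S t f \<le> T t f\<close> holds. If \<open>V\<close> is a curve of functions with \<open>S h (V s) \<le> V (s + h) + o(h)\<close>,
  then \<open>s \<mapsto> S (t - s) (V s)\<close> is increasing, and \<open>s = 0, t\<close> give \<open>S t (V 0) \<le> V t\<close>
  (\<open>comparison_along_curve\<close>). The natural candidate is the orbit \<open>u s = T s f\<close>, but \<open>u s\<close> is not
  smooth, so the inequality of the generators says nothing about it. It is therefore averaged over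
  space and time. By Jensen's inequality, convexity and the approximate commutation of \<open>T\<close> with
  translations turn the averages \<open>V s\<close> into an approximate supersolution for \<open>T\<close>,
  \<open>T h (V s) \<le> V (s + h) + \<epsilon> h/\<kappa>\<close> (\<open>V_supersolution\<close>), which is smooth in space and differentiable in
  time with derivative \<open>V' s\<close>. Averaging in time is what provides a limit of the difference quotients:
  the orbit itself need not be differentiable.

  From \<open>T\<close> to \<open>S\<close>: the truncations \<open>V s * \<phi> n\<close> have compact support, and because \<open>V s \<ge> 0\<close> they lie
  below \<open>V s\<close> and agree with it on large balls. Hence \<open>A (V s * \<phi> n) \<le> B (V s * \<phi> n) \<le> V' s + \<epsilon>/\<kappa>\<close> on
  the ball of radius \<open>n\<close> (\<open>truncated_generator_le\<close>), while \<open>B (V s * \<phi> n)\<close> is bounded above by a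
  common multiple of \<open>1/\<kappa>\<close> elsewhere. Integrating the generator of \<open>S\<close> along short times and letting
  \<open>n \<rightarrow> \<infinity>\<close> yields \<open>S h (V s) \<le> V s + h (V' s + 2\<epsilon>/\<kappa>)\<close> up to an error that lives far away
  (\<open>truncated_generator_growth\<close>). Such errors are harmless by continuity from above, uniformly in time
  (\<open>far_small\<close>, \<open>absorb\<close>).

  The difficulty is uniformity. The range of translations and times in the commutation estimate for
  \<open>u s\<close> depends on \<open>s\<close> in an uncontrolled way, as do the Lipschitz constant and the supremum of \<open>u s\<close>,
  whereas averaging needs all of them to be the same for all \<open>s\<close>. The times at which a given bound \<open>N\<close>
  works form closed sets that exhaust \<open>[0, H]\<close> as \<open>N \<rightarrow> \<infinity>\<close>, so by continuity of Lebesgue measure only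
  little time is missed for large \<open>N\<close> (\<open>regular_times_closed\<close>, \<open>missed_tendsto_0\<close>). The orbit is sampled
  at the last regular time \<open>\<pi> r\<close> before \<open>r\<close>. The increments of \<open>\<pi>\<close> over a time \<open>h\<close> differ from \<open>h\<close>,
  but on average over \<open>r\<close> only by \<open>3 h\<close> times the missed measure
  (\<open>last_visit_increment_average\<close>), and an average is all that enters, since time is averaged with a
  kernel that is chosen before \<open>N\<close>.

  This gives the comparison for nonnegative smooth functions of compact support, and density in the
  mixed topology extends it to all nonnegative functions of the space.
\<close>


lemma le_by_small_errors:
  fixes a b :: real
  assumes "0 < \<delta>" "\<And>\<epsilon>. 0 < \<epsilon> \<Longrightarrow> \<epsilon> \<le> \<delta> \<Longrightarrow> a \<le> b + \<epsilon> * Y"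
  shows "a \<le> b"
proof (rule field_le_epsilon)
  fix e :: real assume e: "0 < e"
  define \<epsilon> where "\<epsilon> = min \<delta> (e / (\<bar>Y\<bar> + 1))"
  have \<epsilon>: "0 < \<epsilon>" "\<epsilon> \<le> \<delta>" "\<epsilon> \<le> e / (\<bar>Y\<bar> + 1)" using assms(1) e by (auto simp: \<epsilon>_def)
  have "\<epsilon> * Y \<le> e / (\<bar>Y\<bar> + 1) * (\<bar>Y\<bar> + 1)"
    using \<epsilon> by (intro order_trans[OF mult_left_mono[of Y "\<bar>Y\<bar> + 1" \<epsilon>] mult_right_mono]) auto
  then show "a \<le> b + e" using assms(2)[OF \<epsilon>(1,2)] by simp
qed

section \<open>The weighted space\<close>

locale weight =
  fixes \<kappa> :: "'a::euclidean_space \<Rightarrow> real"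
  assumes pos: "\<And>x. 0 < \<kappa> x"
    and cont: "continuous_on UNIV \<kappa>"
begin

text \<open>The norm as a pointwise bound: \<open>1/\<kappa>\<close> is itself an element of the space, so bounds of this kind
  can be handed to monotone operators.\<close>
definition wbound :: "real \<Rightarrow> ('a \<Rightarrow> real) \<Rightarrow> bool" where
  "wbound M f \<longleftrightarrow> (\<forall>x. \<bar>f x\<bar> \<le> M / \<kappa> x)"

lemma wboundD: "wbound M f \<Longrightarrow> \<bar>f x\<bar> \<le> M / \<kappa> x"
  by (simp add: wbound_def)

lemma wnorm_le_iff: "wnorm \<kappa> f \<le> ereal M \<longleftrightarrow> wbound M f"
  using pos by (auto simp: wnorm_def wbound_def SUP_le_iff field_simps)

lemma wnorm_finite_iff: "wnorm \<kappa> f < \<infinity> \<longleftrightarrow> (\<exists>M. wbound M f)"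
proof
  assume fin: "wnorm \<kappa> f < \<infinity>"
  have "ereal (\<bar>f undefined\<bar> * \<kappa> undefined) \<le> wnorm \<kappa> f"
    unfolding wnorm_def by (rule SUP_upper) simp
  with fin obtain M where "wnorm \<kappa> f = ereal M"
    by (cases "wnorm \<kappa> f") auto
  then have "wbound M f" by (simp flip: wnorm_le_iff)
  then show "\<exists>M. wbound M f" ..
next
  assume "\<exists>M. wbound M f"
  then obtain M where "wnorm \<kappa> f \<le> ereal M" by (auto simp: wnorm_le_iff)
  then show "wnorm \<kappa> f < \<infinity>" by (rule le_less_trans) simp
qed

lemma C_weighted_iff: "f \<in> C_weighted \<kappa> \<longleftrightarrow> continuous_on UNIV f \<and> (\<exists>M. wbound M f)"
  unfolding C_weighted_def mem_Collect_eq wnorm_finite_iff ..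

lemma wbound_mono: "wbound M f \<Longrightarrow> M \<le> N \<Longrightarrow> wbound N f"
  unfolding wbound_def using pos by (meson divide_right_mono less_imp_le order_trans)

lemma wbound_add: "wbound M f \<Longrightarrow> wbound N g \<Longrightarrow> wbound (M + N) (\<lambda>x. f x + g x)"
  unfolding wbound_def add_divide_distrib by (meson abs_triangle_ineq add_mono order_trans)

lemma wbound_diff: "wbound M f \<Longrightarrow> wbound N g \<Longrightarrow> wbound (M + N) (\<lambda>x. f x - g x)"
  unfolding wbound_def add_divide_distrib by (meson abs_triangle_ineq4 add_mono order_trans)

lemma wbound_uminus: "wbound M (\<lambda>x. - f x) \<longleftrightarrow> wbound M f"
  by (simp add: wbound_def)

lemma wbound_cmult: "wbound M f \<Longrightarrow> wbound (\<bar>c\<bar> * M) (\<lambda>x. c * f x)"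
  unfolding wbound_def by (simp add: abs_mult mult_left_mono flip: times_divide_eq_right)

lemma wbound_inverse: "wbound \<bar>M\<bar> (\<lambda>x. M / \<kappa> x)"
  unfolding wbound_def using pos by (simp add: less_imp_le)

lemma wbound_nonneg: assumes "wbound M f" shows "0 \<le> M"
proof -
  have "0 \<le> M / \<kappa> undefined" using assms unfolding wbound_def by (meson abs_ge_zero order_trans)
  then show ?thesis using pos[of undefined] by (auto simp: zero_le_divide_iff)
qed

lemma C_obtain:
  assumes "f \<in> C_weighted \<kappa>" obtains M where "0 < M" "wbound M f"
proof -
  from assms obtain M where "wbound M f" by (auto simp: C_weighted_iff)
  then have "wbound (max M 1) f" by (rule wbound_mono) simp
  then show ?thesis by (rule that[rotated]) simp
qed

lemma C_add: "f \<in> C_weighted \<kappa> \<Longrightarrow> g \<in> C_weighted \<kappa> \<Longrightarrow> (\<lambda>x. f x + g x) \<in> C_weighted \<kappa>"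
  unfolding C_weighted_iff by (blast intro: continuous_on_add wbound_add)

lemma C_diff: "f \<in> C_weighted \<kappa> \<Longrightarrow> g \<in> C_weighted \<kappa> \<Longrightarrow> (\<lambda>x. f x - g x) \<in> C_weighted \<kappa>"
  unfolding C_weighted_iff by (blast intro: continuous_on_diff wbound_diff)

lemma C_cmult: "f \<in> C_weighted \<kappa> \<Longrightarrow> (\<lambda>x. c * f x) \<in> C_weighted \<kappa>"
  unfolding C_weighted_iff by (blast intro: continuous_on_mult_left wbound_cmult)

lemma C_uminus: "f \<in> C_weighted \<kappa> \<Longrightarrow> (\<lambda>x. - f x) \<in> C_weighted \<kappa>"
  using C_cmult[of f "-1"] by simp

lemma cont_inverse: "continuous_on UNIV (\<lambda>x. M / \<kappa> x)"
  using pos by (auto intro!: continuous_intros cont simp: less_imp_neq[THEN not_sym])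

lemma C_inverse: "(\<lambda>x. M / \<kappa> x) \<in> C_weighted \<kappa>"
  unfolding C_weighted_iff using wbound_inverse cont_inverse by blast

lemma C_zero: "(\<lambda>x. 0) \<in> C_weighted \<kappa>"
  using C_inverse[of 0] by simp

text \<open>Cutoffs are continuous, so that \<open>far n/\<kappa>\<close> belongs to the space. Convergence in the mixed
  topology amounts to smallness of the form \<open>\<epsilon>/\<kappa> + C * far n/\<kappa>\<close> with a fixed \<open>C\<close>.\<close>
definition far :: "nat \<Rightarrow> 'a \<Rightarrow> real" where
  "far n x = min 1 (max 0 (norm x - real n))"

lemma far_range: "0 \<le> far n x" "far n x \<le> 1" "\<bar>far n x\<bar> \<le> 1"
  by (auto simp: far_def)

lemma far_zero: "norm x \<le> real n \<Longrightarrow> far n x = 0"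
  by (simp add: far_def)

lemma far_one: "real n + 1 \<le> norm x \<Longrightarrow> far n x = 1"
  by (simp add: far_def)

lemma far_antimono: "m \<le> n \<Longrightarrow> far n x \<le> far m x"
  by (simp add: far_def)

lemma far_wbound: "0 \<le> c \<Longrightarrow> wbound c (\<lambda>x. c * far n x / \<kappa> x)"
  unfolding wbound_def using pos far_range
  by (auto simp: abs_mult mult_left_le less_imp_le intro!: divide_right_mono)

lemma C_far: assumes "0 \<le> c" shows "(\<lambda>x. c * far n x / \<kappa> x) \<in> C_weighted \<kappa>"
proof -
  have "continuous_on UNIV (\<lambda>x. c * far n x / \<kappa> x)"
    unfolding far_def
    using pos by (intro continuous_intros cont) (auto simp: less_imp_neq[THEN not_sym])
  with far_wbound[OF assms] show ?thesis unfolding C_weighted_iff by blast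
qed

lemma C_cont: "f \<in> C_weighted \<kappa> \<Longrightarrow> continuous_on UNIV f"
  by (simp add: C_weighted_iff)

end


section \<open>Convex monotone semigroups\<close>

locale convex_semigroup = weight +
  fixes S :: "real \<Rightarrow> ('a \<Rightarrow> real) \<Rightarrow> 'a \<Rightarrow> real"
  assumes semigroup: "convex_monotone_semigroup \<kappa> S"
begin

lemma mem: "0 \<le> t \<Longrightarrow> f \<in> C_weighted \<kappa> \<Longrightarrow> S t f \<in> C_weighted \<kappa>"
  using semigroup[unfolded convex_monotone_semigroup_def, THEN conjunct1]
  by blast

lemma convex:
  "\<lbrakk>0 \<le> t; f \<in> C_weighted \<kappa>; g \<in> C_weighted \<kappa>; 0 \<le> c; c \<le> 1\<rbrakk> \<Longrightarrow>
    S t (\<lambda>x. c * f x + (1 - c) * g x) x \<le> c * S t f x + (1 - c) * S t g x"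
  using semigroup[unfolded convex_monotone_semigroup_def, THEN conjunct2, THEN conjunct1]
  unfolding le_fun_def by auto

lemma mono:
  "\<lbrakk>0 \<le> t; f \<in> C_weighted \<kappa>; g \<in> C_weighted \<kappa>; \<And>x. f x \<le> g x\<rbrakk> \<Longrightarrow> S t f x \<le> S t g x"
  using semigroup[unfolded convex_monotone_semigroup_def, THEN conjunct2, THEN conjunct2, THEN conjunct1]
  unfolding mono_on_def le_fun_def by auto

lemma continuous_at_zero:
  "\<lbrakk>0 \<le> t; \<And>n. F n \<in> C_weighted \<kappa>; decseq F; \<And>x. (\<lambda>n. F n x) \<longlonglongrightarrow> 0\<rbrakk> \<Longrightarrow>
    (\<lambda>n. S t (F n) x) \<longlonglongrightarrow> 0"
  using semigroup[unfolded convex_monotone_semigroup_def, THEN conjunct2, THEN conjunct2, THEN conjunct2, THEN conjunct1]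
  by blast

lemma zero_time: "f \<in> C_weighted \<kappa> \<Longrightarrow> S 0 f = f"
  using semigroup[unfolded convex_monotone_semigroup_def, THEN conjunct2, THEN conjunct2, THEN conjunct2, THEN conjunct2, THEN conjunct1]
  by blast

lemma add_time: "0 \<le> s \<Longrightarrow> 0 \<le> t \<Longrightarrow> f \<in> C_weighted \<kappa> \<Longrightarrow> S (s + t) f = S s (S t f)"
  using semigroup[unfolded convex_monotone_semigroup_def, THEN conjunct2, THEN conjunct2, THEN conjunct2, THEN conjunct2, THEN conjunct2, THEN conjunct1]
  by blast

lemma usc:
  assumes "0 \<le> t" "f \<in> C_weighted \<kappa>" "\<And>n. 0 \<le> s n" "s \<longlonglongrightarrow> t" "y \<longlonglongrightarrow> x"
  shows "limsup (\<lambda>n. ereal (S (s n) f (y n))) \<le> ereal (S t f x)"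
  using semigroup[unfolded convex_monotone_semigroup_def, THEN conjunct2, THEN conjunct2, THEN conjunct2, THEN conjunct2, THEN conjunct2, THEN conjunct2, THEN conjunct2] assms
  by blast

lemma usc_eventually:
  assumes "0 \<le> t" "f \<in> C_weighted \<kappa>" "\<And>n. 0 \<le> s n" "s \<longlonglongrightarrow> t" "y \<longlonglongrightarrow> x" "S t f x < c"
  shows "\<forall>\<^sub>F n in sequentially. S (s n) f (y n) < c"
proof -
  have "limsup (\<lambda>n. ereal (S (s n) f (y n))) < ereal c"
    using usc[OF assms(1-5)] assms(6) by (simp add: le_less_trans)
  then have "\<forall>\<^sub>F n in sequentially. ereal (S (s n) f (y n)) < ereal c"
    by (rule Limsup_lessD)
  then show ?thesis by simp
qed

lemma zero: assumes "0 \<le> t" shows "S t (\<lambda>x. 0) x = 0"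
proof -
  have "(\<lambda>n::nat. S t (\<lambda>x. 0) x) \<longlonglongrightarrow> 0"
    by (rule continuous_at_zero[of t "\<lambda>n x. 0"]) (use assms C_zero in \<open>auto simp: decseq_def\<close>)
  then show ?thesis by (simp add: LIMSEQ_const_iff)
qed

lemma nonneg: "0 \<le> t \<Longrightarrow> f \<in> C_weighted \<kappa> \<Longrightarrow> (\<And>x. 0 \<le> f x) \<Longrightarrow> 0 \<le> S t f x"
  using mono[of t "\<lambda>x. 0" f x] by (simp add: zero C_zero)

text \<open>Convexity between \<open>f\<close> and \<open>-f\<close>; it replaces oddness of a linear operator.\<close>
lemma neg_le: assumes "0 \<le> t" "f \<in> C_weighted \<kappa>" shows "- S t (\<lambda>x. - f x) x \<le> S t f x"
proof -
  have "S t (\<lambda>x. 1/2 * f x + (1 - 1/2) * (- f x)) x \<le> 1/2 * S t f x + (1 - 1/2) * S t (\<lambda>x. - f x) x"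
    using assms by (intro convex C_uminus) auto
  then show ?thesis using zero[OF assms(1), of x] by simp
qed

lemma local_bound:
  assumes "0 \<le> M" "0 \<le> T"
  obtains K where "0 < K" "\<And>t f. \<lbrakk>0 \<le> t; t \<le> T; f \<in> C_weighted \<kappa>; wbound M f\<rbrakk> \<Longrightarrow> wbound K (S t f)"
proof -
  have fin: "(SUP t\<in>{0..T}. wnorm \<kappa> (S t (\<lambda>x. M / \<kappa> x))) < \<infinity>" (is "?s < _")
    using semigroup[unfolded convex_monotone_semigroup_def, THEN conjunct2, THEN conjunct2, THEN conjunct2, THEN conjunct2, THEN conjunct2, THEN conjunct2, THEN conjunct1] assms
    by blast
  have "ereal 0 \<le> ereal (\<bar>S 0 (\<lambda>x. M / \<kappa> x) undefined\<bar> * \<kappa> undefined)" using pos[of undefined] by simp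
  also have "\<dots> \<le> wnorm \<kappa> (S 0 (\<lambda>x. M / \<kappa> x))" unfolding wnorm_def by (rule SUP_upper) simp
  also have "\<dots> \<le> ?s" by (rule SUP_upper) (use assms in auto)
  finally have "0 \<le> ?s" by (simp add: zero_ereal_def)
  with fin obtain K where K: "?s = ereal K" by (cases ?s) auto
  have le: "wbound K (S t (\<lambda>x. M / \<kappa> x))" if "0 \<le> t" "t \<le> T" for t
    unfolding wnorm_le_iff[symmetric] K[symmetric] by (rule SUP_upper) (use that in auto)
  have "wbound K (S t f)" if t: "0 \<le> t" "t \<le> T" and f: "f \<in> C_weighted \<kappa>" "wbound M f" for t f
    unfolding wbound_def
  proof
    fix x
    have up: "S t g x \<le> K / \<kappa> x" if "g \<in> C_weighted \<kappa>" "wbound M g" for g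
    proof -
      have "S t g x \<le> S t (\<lambda>x. M / \<kappa> x) x"
        by (rule mono) (use t that C_inverse in \<open>auto dest: wboundD abs_le_D1\<close>)
      also have "\<dots> \<le> K / \<kappa> x" using wboundD[OF le[OF t], of x] by simp
      finally show ?thesis .
    qed
    show "\<bar>S t f x\<bar> \<le> K / \<kappa> x"
      using up[of f] up[of "\<lambda>x. - f x"] neg_le[of t f x] f t C_uminus by (simp add: wbound_uminus)
  qed
  then have "wbound (max K 1) (S t f)" if "0 \<le> t" "t \<le> T" "f \<in> C_weighted \<kappa>" "wbound M f" for t f
    by (rule wbound_mono) (use that in auto)
  from that[OF _ this] show ?thesis by (simp add: less_max_iff_disj)
qed

definition lipschitz_bound :: "real \<Rightarrow> real \<Rightarrow> real \<Rightarrow> bool" where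
  "lipschitz_bound M T L \<longleftrightarrow> 0 < L \<and> (\<forall>t f g d x. 0 \<le> t \<and> t \<le> T \<and> f \<in> C_weighted \<kappa> \<and> g \<in> C_weighted \<kappa> \<and>
     wbound M f \<and> wbound M g \<and> 0 \<le> d \<and> (\<forall>x. f x \<le> g x + d / \<kappa> x) \<longrightarrow> S t f x \<le> S t g x + L * d / \<kappa> x)"

lemma lipschitz_bound_pos: "lipschitz_bound M T L \<Longrightarrow> 0 < L"
  by (simp add: lipschitz_bound_def)

lemma lipschitz_boundD:
  "\<lbrakk>lipschitz_bound M T L; 0 \<le> t; t \<le> T; f \<in> C_weighted \<kappa>; g \<in> C_weighted \<kappa>; wbound M f; wbound M g; 0 \<le> d;
    \<And>x. f x \<le> g x + d / \<kappa> x\<rbrakk> \<Longrightarrow> S t f x \<le> S t g x + L * d / \<kappa> x"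
  unfolding lipschitz_bound_def by auto

text \<open>Convexity and monotonicity make each operator locally Lipschitz continuous: with \<open>N \<ge> M\<close> and
  \<open>\<lambda> = d/N\<close>, the function \<open>g + d/\<kappa>\<close> is \<open>(1 - \<lambda>) g + \<lambda> (g + N/\<kappa>)\<close>.\<close>
lemma local_lipschitz:
  assumes "0 \<le> M" "0 \<le> T"
  obtains L where "lipschitz_bound M T L"
proof -
  define N where "N = max M 1"
  have N: "0 < N" "M \<le> N" "1 \<le> N" by (auto simp: N_def)
  obtain L where L: "0 < L"
    "\<And>t f. \<lbrakk>0 \<le> t; t \<le> T; f \<in> C_weighted \<kappa>; wbound (2 * N) f\<rbrakk> \<Longrightarrow> wbound L (S t f)"
    using local_bound[of "2 * N" T] N assms by auto
  have "S t f x \<le> S t g x + (2 * L) * d / \<kappa> x"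
    if t: "0 \<le> t" "t \<le> T" and f: "f \<in> C_weighted \<kappa>" "wbound M f" and g: "g \<in> C_weighted \<kappa>" "wbound M g"
      and d: "0 \<le> d" and le: "\<And>x. f x \<le> g x + d / \<kappa> x" for t f g d x
  proof (cases "d \<le> N")
    case True
    define h where "h = (\<lambda>x. g x + N / \<kappa> x)"
    define c where "c = d / N"
    have c: "0 \<le> c" "c \<le> 1" using True N d by (auto simp: c_def field_simps)
    have "d / N \<le> d / 1" using N d by (intro divide_left_mono) auto
    then have cd: "c \<le> d" by (simp add: c_def)
    have h: "h \<in> C_weighted \<kappa>" unfolding h_def by (intro C_add g C_inverse)
    have "wbound (M + \<bar>N\<bar>) h" unfolding h_def by (intro wbound_add g wbound_inverse)
    then have h2: "wbound (2 * N) h" by (rule wbound_mono) (use N in auto)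
    have g2: "wbound (2 * N) g" by (rule wbound_mono[OF g(2)]) (use N in auto)
    have "S t f x \<le> S t (\<lambda>x. c * h x + (1 - c) * g x) x"
    proof (rule mono)
      show "(\<lambda>x. c * h x + (1 - c) * g x) \<in> C_weighted \<kappa>" by (intro C_add C_cmult h g)
      show "f x \<le> c * h x + (1 - c) * g x" for x
        using le[of x] N by (simp add: h_def c_def algebra_simps)
    qed (use t f in auto)
    also have "\<dots> \<le> c * S t h x + (1 - c) * S t g x" by (intro convex t h g c)
    also have "\<dots> = S t g x + c * (S t h x - S t g x)" by (simp add: algebra_simps)
    also have "c * (S t h x - S t g x) \<le> c * (2 * L / \<kappa> x)"
      using wboundD[OF L(2)[OF t h h2], of x] wboundD[OF L(2)[OF t g(1) g2], of x] c
      by (intro mult_left_mono) auto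
    also have "c * (2 * L / \<kappa> x) \<le> d * (2 * L / \<kappa> x)"
      using cd L pos[of x] by (intro mult_right_mono) auto
    finally show ?thesis by (simp add: mult_ac)
  next
    case False
    have f2: "wbound (2 * N) f" by (rule wbound_mono[OF f(2)]) (use N in auto)
    have g2: "wbound (2 * N) g" by (rule wbound_mono[OF g(2)]) (use N in auto)
    have "S t f x - S t g x \<le> 2 * L / \<kappa> x"
      using wboundD[OF L(2)[OF t f(1) f2], of x] wboundD[OF L(2)[OF t g(1) g2], of x] by simp
    also have "\<dots> \<le> 2 * L * d / \<kappa> x"
      using False L pos[of x] N by (intro divide_right_mono) auto
    finally show ?thesis by simp
  qed
  then have "lipschitz_bound M T (2 * L)" unfolding lipschitz_bound_def using L(1) by auto
  then show ?thesis by (rule that)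
qed

text \<open>A Dini argument: continuity from above makes the values decrease to zero at each time, and
  upper semicontinuity in time makes this uniform on the compact interval.\<close>
lemma far_small:
  assumes "0 \<le> c" "0 \<le> T" "0 < \<epsilon>"
  obtains R where "\<And>t. 0 \<le> t \<Longrightarrow> t \<le> T \<Longrightarrow> S t (\<lambda>x. c * far R x / \<kappa> x) x \<le> \<epsilon>"
proof (rule ccontr)
  let ?F = "\<lambda>n x. c * far n x / \<kappa> x"
  assume "\<not> thesis"
  then have "\<forall>R. \<exists>t. 0 \<le> t \<and> t \<le> T \<and> \<epsilon> < S t (?F R) x"
    using that by (metis not_le)
  then obtain s where s: "\<And>R. 0 \<le> s R" "\<And>R. s R \<le> T" "\<And>R. \<epsilon> < S (s R) (?F R) x"
    by metis
  have "\<forall>n. s n \<in> {0..T}" using s by auto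
  then obtain l r where l: "l \<in> {0..T}" and r: "strict_mono r" and lim: "(s \<circ> r) \<longlonglongrightarrow> l"
    using compact_Icc[of 0 T, unfolded compact_def] by blast
  have F: "?F n \<in> C_weighted \<kappa>" for n by (rule C_far[OF assms(1)])
  have dec: "?F n y \<le> ?F m y" if "m \<le> n" for m n y
    using pos[of y] assms far_antimono[OF that, of y]
    by (intro divide_right_mono mult_left_mono) auto
  have "\<epsilon> \<le> S l (?F R) x" for R
  proof (rule ccontr)
    assume "\<not> \<epsilon> \<le> S l (?F R) x"
    then have "\<forall>\<^sub>F n in sequentially. S ((s \<circ> r) n) (?F R) ((\<lambda>n. x) n) < \<epsilon>"
      by (intro usc_eventually[OF _ F _ lim]) (use l s in auto)
    moreover have "\<forall>\<^sub>F n in sequentially. R \<le> n" by (rule eventually_ge_at_top)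
    ultimately have "\<forall>\<^sub>F n in sequentially. False"
    proof eventually_elim
      case (elim n)
      have "R \<le> r n" using elim(2) r by (meson seq_suble order_trans)
      then have "S (s (r n)) (?F (r n)) x \<le> S (s (r n)) (?F R) x"
        by (intro mono F dec s)
      then show False using elim(1) s(3)[of "r n"] by simp
    qed
    then show False by simp
  qed
  moreover have "(\<lambda>n. S l (?F n) x) \<longlonglongrightarrow> 0"
  proof (rule continuous_at_zero)
    show "decseq ?F" by (intro decseq_def[THEN iffD2] allI impI le_funI dec)
    show "(\<lambda>n. ?F n y) \<longlonglongrightarrow> 0" for y
    proof (rule tendsto_eventually)
      obtain m :: nat where "norm y \<le> real m" using real_arch_simple by blast
      then show "\<forall>\<^sub>F n in sequentially. ?F n y = 0"
        by (intro eventually_sequentiallyI[of m]) (simp add: far_zero)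
    qed
  qed (use l F in auto)
  ultimately have "\<epsilon> \<le> 0" by (meson LIMSEQ_le_const)
  then show False using assms by simp
qed

text \<open>The values of \<open>S t\<close> at \<open>x\<close> do not feel, up to an error of order \<open>h * \<epsilon>\<close>, a perturbation that is
  \<open>h * \<epsilon>/\<kappa>\<close> near the origin and \<open>h * C/\<kappa>\<close> outside the ball of radius \<open>R\<close>.\<close>
definition absorbs :: "real \<Rightarrow> real \<Rightarrow> real \<Rightarrow> real \<Rightarrow> real \<Rightarrow> nat \<Rightarrow> 'a \<Rightarrow> bool" where
  "absorbs M T K C \<epsilon> R x \<longleftrightarrow> (\<forall>t g h f. 0 \<le> t \<and> t \<le> T \<and> g \<in> C_weighted \<kappa> \<and> wbound M g \<and>
     f \<in> C_weighted \<kappa> \<and> 0 \<le> h \<and> h \<le> 1 \<and> (\<forall>y. f y \<le> g y + h * (\<epsilon> / \<kappa> y + C * far R y / \<kappa> y)) \<longrightarrow>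
     S t f x \<le> S t g x + h * \<epsilon> * K * (1 + 1 / \<kappa> x))"

lemma absorbsD:
  "\<lbrakk>absorbs M T K C \<epsilon> R x; 0 \<le> t; t \<le> T; g \<in> C_weighted \<kappa>; wbound M g; f \<in> C_weighted \<kappa>; 0 \<le> h; h \<le> 1;
    \<And>y. f y \<le> g y + h * (\<epsilon> / \<kappa> y + C * far R y / \<kappa> y)\<rbrakk> \<Longrightarrow>
   S t f x \<le> S t g x + h * \<epsilon> * K * (1 + 1 / \<kappa> x)"
  unfolding absorbs_def by auto

text \<open>The point is that \<open>K\<close> depends neither on the bound \<open>C\<close> at infinity nor on \<open>\<epsilon>\<close>. Splitting off the perturbation with weight \<open>h * \<epsilon> / 2\<close> makes the estimate uniform in
  time, although \<open>S t g\<close> is known to be semicontinuous in time from one side only.\<close>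
lemma absorb:
  assumes "0 \<le> M" "0 \<le> T"
  obtains K where "0 < K" "\<And>C \<epsilon> x. \<lbrakk>0 \<le> C; 0 < \<epsilon>; \<epsilon> \<le> 1\<rbrakk> \<Longrightarrow> \<exists>R. absorbs M T K C \<epsilon> R x"
proof -
  define N where "N = 2 * M + 2"
  have N: "0 \<le> N" using assms by (simp add: N_def)
  obtain L where L: "lipschitz_bound N T L" by (rule local_lipschitz[OF N assms(2)])
  note L_pos = lipschitz_bound_pos[OF L]
  obtain B where B: "0 < B" "\<And>t f. \<lbrakk>0 \<le> t; t \<le> T; f \<in> C_weighted \<kappa>; wbound N f\<rbrakk> \<Longrightarrow> wbound B (S t f)"
    using local_bound[of N T] assms by (auto simp: N_def)
  define K where "K = L * N + B + 1"
  have K: "0 < K" using L_pos B assms by (simp add: K_def N_def add_pos_nonneg)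
  have "\<exists>R. absorbs M T K C \<epsilon> R x"
    if C: "0 \<le> C" and \<epsilon>: "0 < \<epsilon>" "\<epsilon> \<le> 1" for C \<epsilon> x
  proof -
    obtain R where R: "\<And>t. 0 \<le> t \<Longrightarrow> t \<le> T \<Longrightarrow> S t (\<lambda>x. (2 * C / \<epsilon>) * far R x / \<kappa> x) x \<le> 1"
      using far_small[of "2 * C / \<epsilon>" T 1 x] C \<epsilon> assms by auto
    have "S t f x \<le> S t g x + h * \<epsilon> * K * (1 + 1 / \<kappa> x)"
      if t: "0 \<le> t" "t \<le> T" and g: "g \<in> C_weighted \<kappa>" "wbound M g"
        and f: "f \<in> C_weighted \<kappa>" and h: "0 \<le> h" "h \<le> 1"
        and le: "\<And>x. f x \<le> g x + h * (\<epsilon> / \<kappa> x + C * far R x / \<kappa> x)" for t g h f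
    proof -
      \<comment> \<open>weight of the far part in the convex combination: of first order in \<open>h\<close>, and at most \<open>1/2\<close>\<close>
      define c where "c = h * \<epsilon> / 2"
      have he: "0 \<le> h * \<epsilon>" "h * \<epsilon> \<le> 1" using h \<epsilon> by (auto intro: mult_le_one)
      have c: "0 \<le> c" "c \<le> 1/2" using he by (auto simp: c_def)
      define g' where "g' = (\<lambda>x. 1 / (1 - c) * (g x + h * \<epsilon> / \<kappa> x))"
      define k where "k = (\<lambda>x. (2 * C / \<epsilon>) * far R x / \<kappa> x)"
      have k: "k \<in> C_weighted \<kappa>" unfolding k_def by (rule C_far) (use C \<epsilon> in auto)
      have g': "g' \<in> C_weighted \<kappa>"
        unfolding g'_def by (intro C_cmult C_add g C_inverse)
      have "wbound (\<bar>1 / (1 - c)\<bar> * (M + \<bar>h * \<epsilon>\<bar>)) g'"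
        unfolding g'_def by (intro wbound_cmult wbound_add g wbound_inverse)
      moreover have "\<bar>1 / (1 - c)\<bar> * (M + \<bar>h * \<epsilon>\<bar>) \<le> 2 * (M + 1)"
        using c he assms by (intro mult_mono) (auto simp: field_simps)
      ultimately have g'N: "wbound N g'" by (rule wbound_mono[THEN wbound_mono]) (simp add: N_def)
      have gN: "wbound N g" by (rule wbound_mono[OF g(2)]) (use assms in \<open>simp add: N_def\<close>)
      have g'_le: "g' y \<le> g y + (h * \<epsilon> * N) / \<kappa> y" for y
      proof -
        have "g' y - g y = (c * g y + h * \<epsilon> / \<kappa> y) / (1 - c)"
          using c by (simp add: g'_def field_simps)
        also have "\<dots> \<le> (c * (M / \<kappa> y) + h * \<epsilon> / \<kappa> y) / (1 - c)"
          using c wboundD[OF g(2), of y]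
          by (intro divide_right_mono add_right_mono mult_left_mono) auto
        also have "\<dots> \<le> (c * (M / \<kappa> y) + h * \<epsilon> / \<kappa> y) / (1/2)"
        proof (rule divide_left_mono)
          have "0 \<le> c * (M / \<kappa> y)" "0 \<le> h * \<epsilon> / \<kappa> y" using c(1) he(1) assms(1) pos[of y] by simp_all
          then show "0 \<le> c * (M / \<kappa> y) + h * \<epsilon> / \<kappa> y" by simp
        qed (use c in auto)
        also have "\<dots> = (h * \<epsilon> * (M + 2)) / \<kappa> y" by (simp add: c_def add_divide_distrib algebra_simps)
        also have "\<dots> \<le> (h * \<epsilon> * N) / \<kappa> y"
          using he(1) assms(1) pos[of y]
          by (intro divide_right_mono mult_left_mono) (simp_all add: N_def)
        finally show ?thesis by simp
      qed
      have Sg': "S t g' x \<le> S t g x + L * (h * \<epsilon> * N) / \<kappa> x"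
        by (rule lipschitz_boundD[OF L]) (use t g' g g'N gN g'_le he assms in \<open>auto simp: N_def\<close>)
      have "S t f x \<le> S t (\<lambda>x. c * k x + (1 - c) * g' x) x"
      proof (rule mono)
        show "(\<lambda>x. c * k x + (1 - c) * g' x) \<in> C_weighted \<kappa>" by (intro C_add C_cmult k g')
        fix y
        have "c * k y = h * (C * far R y / \<kappa> y)" using \<epsilon> by (simp add: c_def k_def)
        moreover have "(1 - c) * g' y = g y + h * (\<epsilon> / \<kappa> y)" using c by (simp add: g'_def)
        ultimately show "f y \<le> c * k y + (1 - c) * g' y" using le[of y] by (simp add: algebra_simps)
      qed (use t f in auto)
      also have "\<dots> \<le> c * S t k x + (1 - c) * S t g' x" by (intro convex t k g' c) (use c in simp)
      also have "\<dots> = S t g' x + c * S t k x - c * S t g' x" by (simp add: algebra_simps)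
      also have "\<dots> \<le> (S t g x + L * (h * \<epsilon> * N) / \<kappa> x) + c * 1 + c * (B / \<kappa> x)"
      proof -
        have "c * S t k x \<le> c * 1" using R[OF t] c by (intro mult_left_mono) (auto simp: k_def)
        moreover have "- (c * S t g' x) \<le> c * (B / \<kappa> x)"
          using mult_left_mono[of "- S t g' x" "B / \<kappa> x" c] wboundD[OF B(2)[OF t g' g'N], of x] c
          by auto
        ultimately show ?thesis using Sg' by linarith
      qed
      also have "\<dots> \<le> S t g x + h * \<epsilon> * K * (1 + 1 / \<kappa> x)"
      proof -
        have "L * (h * \<epsilon> * N) / \<kappa> x = h * \<epsilon> * ((L * N) / \<kappa> x)" by simp
        moreover have "c * 1 + c * (B / \<kappa> x) \<le> h * \<epsilon> * (1 + B / \<kappa> x)"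
        proof -
          have "0 \<le> B / \<kappa> x" using B(1) pos[of x] by simp
          then have "c * (1 + B / \<kappa> x) \<le> h * \<epsilon> * (1 + B / \<kappa> x)"
            using he(1) by (intro mult_right_mono) (simp_all add: c_def mult.commute)
          then show ?thesis by (simp add: distrib_left)
        qed
        moreover have "h * \<epsilon> * ((L * N) / \<kappa> x) + h * \<epsilon> * (1 + B / \<kappa> x) \<le> h * \<epsilon> * (K * (1 + 1 / \<kappa> x))"
          unfolding distrib_left[symmetric]
        proof (rule mult_left_mono[OF _ he(1)])
          have "L * N / \<kappa> x + (1 + B / \<kappa> x) = 1 + (L * N + B) / \<kappa> x" by (simp add: add_divide_distrib)
          also have "\<dots> \<le> K + K / \<kappa> x"
          proof (rule add_mono)
            have LN: "0 \<le> L * N" using L_pos assms(1) by (simp add: N_def)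
            then show "1 \<le> K" using B(1) by (simp add: K_def)
            show "(L * N + B) / \<kappa> x \<le> K / \<kappa> x"
              using pos[of x] by (intro divide_right_mono) (simp_all add: K_def)
          qed
          finally show "L * N / \<kappa> x + (1 + B / \<kappa> x) \<le> K * (1 + 1 / \<kappa> x)" by (simp add: algebra_simps)
        qed
        ultimately show ?thesis by linarith
      qed
      finally show ?thesis .
    qed
    then have "absorbs M T K C \<epsilon> R x" unfolding absorbs_def by blast
    then show ?thesis ..
  qed
  then show ?thesis using that K by blast
qed

end


section \<open>The generator bounds the growth of the semigroup\<close>

context weight
begin

lemma kappa_bounded_on_ball:
  obtains B where "0 < B" "\<And>x. norm x \<le> r \<Longrightarrow> \<kappa> x \<le> B"
proof -
  have "compact (\<kappa> ` cball 0 r)"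
    by (intro compact_continuous_image compact_cball continuous_on_subset[OF cont]) auto
  then have "bounded (\<kappa> ` cball 0 r)" by (rule compact_imp_bounded)
  then obtain B where "\<And>x. norm x \<le> r \<Longrightarrow> \<bar>\<kappa> x\<bar> \<le> B" unfolding bounded_iff
    by fastforce
  then have "\<kappa> x \<le> max B 1" if "norm x \<le> r" for x using that by (meson abs_le_D1 max.coboundedI1)
  moreover have "0 < max B 1" by simp
  ultimately show ?thesis using that by blast
qed

lemma SUP_wnorm_finite:
  assumes fin: "(SUP n. wnorm \<kappa> (F n)) < \<infinity>"
  shows "\<exists>N. \<forall>n. wbound N (F n)"
proof -
  show ?thesis
  proof (cases "SUP n. wnorm \<kappa> (F n)")
    case (real N)
    then have "\<And>n. wnorm \<kappa> (F n) \<le> ereal N" by (metis SUP_upper UNIV_I)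
    then show ?thesis unfolding wnorm_le_iff by blast
  next
    case PInf
    then show ?thesis using fin by simp
  next
    case MInf
    then have "\<And>n. wnorm \<kappa> (F n) \<le> ereal 0" by (metis SUP_upper UNIV_I ereal_less_eq(2) order_trans)
    then show ?thesis unfolding wnorm_le_iff by blast
  qed
qed

lemma mixed_tendsto_wbound: "mixed_tendsto \<kappa> F f \<Longrightarrow> \<exists>N. \<forall>n. wbound N (F n)"
  by (rule SUP_wnorm_finite) (simp add: mixed_tendsto_def)

text \<open>Uniform convergence on a ball gives the part \<open>\<epsilon>/\<kappa>\<close>, the common bound the part far away.\<close>
lemma mixed_tendsto_far:
  assumes lim: "mixed_tendsto \<kappa> F f" and f: "f \<in> C_weighted \<kappa>"
  shows "\<exists>C\<ge>0. \<forall>\<epsilon>>0. \<forall>R. \<forall>\<^sub>F n in sequentially. \<forall>x. \<bar>F n x - f x\<bar> \<le> \<epsilon> / \<kappa> x + C * far R x / \<kappa> x"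
proof -
  obtain M where M: "0 < M" "wbound M f" using f by (rule C_obtain)
  have "\<exists>N. \<forall>n. wbound N (F n)" by (rule mixed_tendsto_wbound[OF lim])
  then obtain N where N: "\<And>n. wbound N (F n)" by blast
  have diff: "\<bar>F n x - f x\<bar> \<le> (M + N) / \<kappa> x" for n x
    using wboundD[OF wbound_diff[OF N M(2)], of n x] by (simp add: add.commute)
  show ?thesis
  proof (intro exI[of _ "M + N"] conjI allI impI)
    show "0 \<le> M + N" using M wbound_nonneg[OF N] by simp
    fix \<epsilon> :: real and R
    assume \<epsilon>: "0 < \<epsilon>"
    obtain B where B: "0 < B" "\<And>x. norm x \<le> real R + 1 \<Longrightarrow> \<kappa> x \<le> B" using kappa_bounded_on_ball by blast
    have "uniform_limit (cball 0 (real R + 1)) F f sequentially"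
      using lim by (simp add: mixed_tendsto_def)
    then have "\<forall>\<^sub>F n in sequentially. \<forall>x\<in>cball 0 (real R + 1). dist (F n x) (f x) < \<epsilon> / B"
      using B \<epsilon> by (auto simp: uniform_limit_iff)
    then show "\<forall>\<^sub>F n in sequentially. \<forall>x. \<bar>F n x - f x\<bar> \<le> \<epsilon> / \<kappa> x + (M + N) * far R x / \<kappa> x"
    proof eventually_elim
      case (elim n)
      show ?case
      proof
        fix x
        have nn: "0 \<le> \<epsilon> / \<kappa> x" "0 \<le> (M + N) * far R x / \<kappa> x"
          using \<epsilon> pos[of x] M wbound_nonneg[OF N] far_range(1)[of R x] by (simp_all add: less_imp_le)
        show "\<bar>F n x - f x\<bar> \<le> \<epsilon> / \<kappa> x + (M + N) * far R x / \<kappa> x"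
        proof (cases "norm x \<le> real R + 1")
          case True
          then have "\<bar>F n x - f x\<bar> < \<epsilon> / B" using elim by (auto simp: dist_real_def)
          also have "\<epsilon> / B \<le> \<epsilon> / \<kappa> x" using True B \<epsilon> pos[of x] by (intro divide_left_mono) auto
          finally show ?thesis using nn by linarith
        next
          case False
          then show ?thesis using diff[of n x] nn far_one[of R x] by simp
        qed
      qed
    qed
  qed
qed

end

context convex_semigroup
begin

text \<open>Joint upper semicontinuity at time \<open>0\<close>, made uniform on \<open>K\<close> by compactness.\<close>
lemma small_time_upper:
  assumes f: "f \<in> C_weighted \<kappa>" and K: "compact K" and \<epsilon>: "0 < \<epsilon>"
  obtains h0 where "0 < h0" "\<And>r x. 0 \<le> r \<Longrightarrow> r \<le> h0 \<Longrightarrow> x \<in> K \<Longrightarrow> S r f x \<le> f x + \<epsilon>"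
proof (rule ccontr)
  assume no: "\<not> thesis"
  have "\<exists>r x. 0 \<le> r \<and> r \<le> inverse (real (Suc n)) \<and> x \<in> K \<and> f x + \<epsilon> < S r f x" for n
  proof (rule ccontr)
    assume "\<not> ?thesis"
    then have "\<And>r x. 0 \<le> r \<Longrightarrow> r \<le> inverse (real (Suc n)) \<Longrightarrow> x \<in> K \<Longrightarrow> S r f x \<le> f x + \<epsilon>"
      by (meson not_le)
    then show False using no that[of "inverse (real (Suc n))"] by auto
  qed
  then obtain r x where rx: "\<And>n. 0 \<le> r n" "\<And>n. r n \<le> inverse (real (Suc n))" "\<And>n. x n \<in> K"
    "\<And>n. f (x n) + \<epsilon> < S (r n) f (x n)"
    by metis
  obtain l q where l: "l \<in> K" and q: "strict_mono q" and lim: "(x \<circ> q) \<longlonglongrightarrow> l"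
    using K rx(3) unfolding compact_def by blast
  have r0: "r \<longlonglongrightarrow> 0"
    using LIMSEQ_inverse_real_of_nat rx(1,2)
    by (rule_tac tendsto_sandwich[of "\<lambda>_. 0"]) auto
  have rq: "(r \<circ> q) \<longlonglongrightarrow> 0" by (rule LIMSEQ_subseq_LIMSEQ[OF r0 q])
  have "S 0 f l < f l + \<epsilon> / 2" using zero_time[OF f] \<epsilon> by simp
  then have "\<forall>\<^sub>F n in sequentially. S ((r \<circ> q) n) f ((x \<circ> q) n) < f l + \<epsilon> / 2"
    by (intro usc_eventually[OF _ f _ rq lim]) (use rx in auto)
  moreover have "((\<lambda>n. f ((x \<circ> q) n)) \<longlonglongrightarrow> f l)"
    by (rule continuous_on_tendsto_compose[OF C_cont[OF f] lim]) auto
  then have "\<forall>\<^sub>F n in sequentially. f l - \<epsilon> / 2 < f ((x \<circ> q) n)"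
    by (rule order_tendstoD) (use \<epsilon> in simp)
  ultimately have "\<forall>\<^sub>F n in sequentially. False"
  proof eventually_elim
    case (elim n)
    then show ?case using rx(4)[of "q n"] by simp
  qed
  then show False by simp
qed

text \<open>Telescoping over \<open>k\<close> steps: \<open>S \<delta> v\<close> is the convex combination of \<open>v\<close> and \<open>v + diff_quot S \<delta> v\<close> with
  weight \<open>\<delta>\<close> on the latter.\<close>
lemma generator_iterate:
  assumes v: "v \<in> C_weighted \<kappa>" and \<delta>: "0 < \<delta>" "\<delta> \<le> 1"
    and le: "\<And>r. 0 \<le> r \<Longrightarrow> r \<le> real k * \<delta> \<Longrightarrow> S r (\<lambda>x. v x + diff_quot S \<delta> v x) x - S r v x \<le> m"
  shows "S (real k * \<delta>) v x \<le> v x + real k * \<delta> * m"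
  using le
proof (induction k)
  case 0
  then show ?case by (simp add: zero_time[OF v])
next
  case (Suc k)
  define q where "q = diff_quot S \<delta> v"
  have q: "q \<in> C_weighted \<kappa>"
    using C_cmult[OF C_diff[OF mem[of \<delta>, OF _ v] v], of "1 / \<delta>"] \<delta> by (simp add: q_def diff_quot_def[abs_def])
  have Sq: "S \<delta> v = (\<lambda>x. \<delta> * (v x + q x) + (1 - \<delta>) * v x)"
    using \<delta> by (auto simp: q_def diff_quot_def field_simps)
  have k: "0 \<le> real k * \<delta>" "real k * \<delta> \<le> real (Suc k) * \<delta>" using \<delta> by auto
  have "S (real (Suc k) * \<delta>) v x = S (real k * \<delta> + \<delta>) v x" by (simp add: algebra_simps)
  also have "\<dots> = S (real k * \<delta>) (S \<delta> v) x" using add_time[OF k(1) _ v, of \<delta>] \<delta> by simp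
  also have "\<dots> \<le> \<delta> * S (real k * \<delta>) (\<lambda>x. v x + q x) x + (1 - \<delta>) * S (real k * \<delta>) v x"
    unfolding Sq by (intro convex k C_add v q) (use \<delta> in auto)
  also have "\<dots> = S (real k * \<delta>) v x + \<delta> * (S (real k * \<delta>) (\<lambda>x. v x + q x) x - S (real k * \<delta>) v x)"
    by (simp add: algebra_simps)
  also have "\<dots> \<le> (v x + real k * \<delta> * m) + \<delta> * m"
  proof (intro add_mono mult_left_mono)
    show "S (real k * \<delta>) v x \<le> v x + real k * \<delta> * m"
      by (rule Suc.IH) (use Suc.prems k in auto)
    show "S (real k * \<delta>) (\<lambda>x. v x + q x) x - S (real k * \<delta>) v x \<le> m"
      unfolding q_def by (rule Suc.prems[OF k])
  qed (use \<delta> in simp)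
  finally show ?case by (simp add: algebra_simps)
qed

text \<open>An upper form of the linear identity \<open>S h v - v = \<integral> S r (A v)\<close> over \<open>0 \<le> r \<le> h\<close>: by convexity, \<open>S r (v + w) - S r v\<close>
  dominates the derivative of \<open>r \<mapsto> S r v\<close> as soon as \<open>w\<close> dominates the generator.\<close>
lemma generator_growth:
  assumes gen: "has_generator_value \<kappa> S v a" and v: "v \<in> C_weighted \<kappa>" and w: "w \<in> C_weighted \<kappa>"
    and aw: "\<And>x. a x \<le> w x" and h: "0 < h"
    and le: "\<And>r. 0 \<le> r \<Longrightarrow> r \<le> h \<Longrightarrow> S r (\<lambda>x. v x + w x) x - S r v x \<le> m"
  shows "S h v x \<le> v x + h * m"
proof -
  define \<delta> where "\<delta> = (\<lambda>k. h / real (Suc k))"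
  have \<delta>0: "\<delta> \<longlonglongrightarrow> 0"
    using tendsto_mult_right_zero[OF LIMSEQ_inverse_real_of_nat, of h] by (simp add: \<delta>_def divide_inverse)
  have null: "pos_null_seq \<delta>" using h \<delta>0 by (simp add: pos_null_seq_def \<delta>_def)
  have a: "a \<in> C_weighted \<kappa>" using gen by (simp add: has_generator_value_def)
  have lim: "mixed_tendsto \<kappa> (\<lambda>k. diff_quot S (\<delta> k) v) a"
    using gen null by (simp add: has_generator_value_def)
  obtain C where C: "0 \<le> C" and C2: "\<forall>\<epsilon>>0. \<forall>R. \<forall>\<^sub>F k in sequentially.
      \<forall>x. \<bar>diff_quot S (\<delta> k) v x - a x\<bar> \<le> \<epsilon> / \<kappa> x + C * far R x / \<kappa> x"
    using mixed_tendsto_far[OF lim a] by (elim exE conjE)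
  obtain M where M: "0 < M" "wbound M (\<lambda>x. v x + w x)" using C_add[OF v w] by (rule C_obtain)
  obtain K where K: "0 < K" "\<And>C \<epsilon> x. \<lbrakk>0 \<le> C; 0 < \<epsilon>; \<epsilon> \<le> 1\<rbrakk> \<Longrightarrow> \<exists>R. absorbs M h K C \<epsilon> R x"
    by (rule absorb[OF less_imp_le[OF M(1)] less_imp_le[OF h]]) (rule that)
  have bound: "S h v x \<le> v x + h * (m + \<epsilon> * K * (1 + 1 / \<kappa> x))" if \<epsilon>: "0 < \<epsilon>" "\<epsilon> \<le> 1" for \<epsilon>
  proof -
    obtain R where R: "absorbs M h K C \<epsilon> R x" using K(2)[OF C \<epsilon>] by blast
    have "\<forall>\<^sub>F k in sequentially. \<delta> k < 1" by (rule order_tendstoD[OF \<delta>0]) simp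
    with C2[rule_format, OF \<epsilon>(1), of R] have "\<forall>\<^sub>F k in sequentially. \<delta> k < 1 \<and>
      (\<forall>x. \<bar>diff_quot S (\<delta> k) v x - a x\<bar> \<le> \<epsilon> / \<kappa> x + C * far R x / \<kappa> x)"
      by eventually_elim auto
    then obtain k where k: "\<delta> k < 1"
      "\<And>x. \<bar>diff_quot S (\<delta> k) v x - a x\<bar> \<le> \<epsilon> / \<kappa> x + C * far R x / \<kappa> x"
      by (auto simp: eventually_sequentially)
    have \<delta>k: "0 < \<delta> k" using h by (simp add: \<delta>_def)
    have q: "diff_quot S (\<delta> k) v \<in> C_weighted \<kappa>"
      using C_cmult[OF C_diff[OF mem[of "\<delta> k", OF _ v] v], of "1 / \<delta> k"] \<delta>k by (simp add: diff_quot_def[abs_def])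
    have hk: "real (Suc k) * \<delta> k = h" by (simp add: \<delta>_def)
    have "S (real (Suc k) * \<delta> k) v x \<le> v x + real (Suc k) * \<delta> k * (m + \<epsilon> * K * (1 + 1 / \<kappa> x))"
    proof (rule generator_iterate[OF v \<delta>k less_imp_le[OF k(1)]])
      fix r assume r: "0 \<le> r" "r \<le> real (Suc k) * \<delta> k"
      have "S r (\<lambda>x. v x + diff_quot S (\<delta> k) v x) x \<le> S r (\<lambda>x. v x + w x) x + 1 * \<epsilon> * K * (1 + 1 / \<kappa> x)"
      proof (rule absorbsD[OF R])
        fix y
        have "diff_quot S (\<delta> k) v y \<le> a y + (\<epsilon> / \<kappa> y + C * far R y / \<kappa> y)" using k(2)[of y] by linarith
        then show "v y + diff_quot S (\<delta> k) v y \<le> v y + w y + 1 * (\<epsilon> / \<kappa> y + C * far R y / \<kappa> y)"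
          using aw[of y] by simp
      qed (use r hk M C_add v w q in auto)
      then show "S r (\<lambda>x. v x + diff_quot S (\<delta> k) v x) x - S r v x \<le> m + \<epsilon> * K * (1 + 1 / \<kappa> x)"
        using le[of r] r hk by simp
    qed
    then show ?thesis unfolding hk .
  qed
  show ?thesis
    by (rule le_by_small_errors[of 1 _ _ "h * (K * (1 + 1 / \<kappa> x))"]) (use bound in \<open>auto simp: algebra_simps\<close>)
qed

text \<open>Were there no common bound on any interval of times, the offending times would form a null
  sequence along which the difference quotients are unbounded.\<close>
lemma domain_lipschitz:
  assumes gen: "has_generator_value \<kappa> S f a" and f: "f \<in> C_weighted \<kappa>"
  obtains L h0 where "0 < L" "0 < h0" "\<And>h x. 0 \<le> h \<Longrightarrow> h \<le> h0 \<Longrightarrow> \<bar>S h f x - f x\<bar> \<le> L * h / \<kappa> x"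
proof (rule ccontr)
  assume no: "\<not> thesis"
  have "\<exists>h x. 0 \<le> h \<and> h \<le> inverse (real (Suc n)) \<and> real (Suc n) * h / \<kappa> x < \<bar>S h f x - f x\<bar>" for n
  proof (rule ccontr)
    assume "\<not> ?thesis"
    then have "\<And>h x. 0 \<le> h \<Longrightarrow> h \<le> inverse (real (Suc n)) \<Longrightarrow>
        \<bar>S h f x - f x\<bar> \<le> real (Suc n) * h / \<kappa> x"
      by (meson not_le)
    then show False using no that[of "real (Suc n)" "inverse (real (Suc n))"] by auto
  qed
  then obtain h x where hx: "\<And>n. 0 \<le> h n" "\<And>n. h n \<le> inverse (real (Suc n))"
    "\<And>n. real (Suc n) * h n / \<kappa> (x n) < \<bar>S (h n) f (x n) - f (x n)\<bar>"
    by metis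
  have hpos: "0 < h n" for n
  proof (rule ccontr)
    assume "\<not> 0 < h n"
    then have "h n = 0" using hx(1)[of n] by simp
    then show False using hx(3)[of n] zero_time[OF f] by simp
  qed
  have "h \<longlonglongrightarrow> 0"
    using LIMSEQ_inverse_real_of_nat hx(1,2) by (rule_tac tendsto_sandwich[of "\<lambda>_. 0"]) auto
  then have "pos_null_seq h" using hpos by (simp add: pos_null_seq_def)
  then have "mixed_tendsto \<kappa> (\<lambda>n. diff_quot S (h n) f) a" "a \<in> C_weighted \<kappa>"
    using gen by (auto simp: has_generator_value_def)
  then obtain C where C: "\<And>n. wbound C (diff_quot S (h n) f)" using mixed_tendsto_wbound by blast
  obtain n :: nat where n: "C \<le> real n" using real_arch_simple by blast
  have "real (Suc n) / \<kappa> (x n) < \<bar>diff_quot S (h n) f (x n)\<bar>"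
    using hx(3)[of n] hpos[of n] by (simp add: diff_quot_def field_simps)
  also have "\<dots> \<le> C / \<kappa> (x n)" by (rule wboundD[OF C])
  also have "\<dots> \<le> real (Suc n) / \<kappa> (x n)" using n pos[of "x n"] by (intro divide_right_mono) auto
  finally show False by simp
qed

end


section \<open>Comparison along a curve\<close>

context convex_semigroup
begin

text \<open>Continuity from below along truncations: what is cut off is far away and is absorbed.\<close>
lemma cutoff_limit:
  assumes g: "g \<in> C_weighted \<kappa>" and v: "\<And>n. v n \<in> C_weighted \<kappa>" and t: "0 \<le> t"
    and range: "\<And>n x. 0 \<le> v n x" "\<And>n x. v n x \<le> g x"
    and eq: "\<And>n x. norm x \<le> real n \<Longrightarrow> v n x = g x"
    and le: "\<forall>\<^sub>F n in sequentially. S t (v n) x \<le> c"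
  shows "S t g x \<le> c"
proof -
  obtain M where M: "0 < M" "wbound M g" using g by (rule C_obtain)
  have vM: "wbound M (v n)" for n
    unfolding wbound_def using M(2) range unfolding wbound_def
    by (metis abs_of_nonneg order_trans)
  obtain K where K: "0 < K" "\<And>C \<epsilon> x. \<lbrakk>0 \<le> C; 0 < \<epsilon>; \<epsilon> \<le> 1\<rbrakk> \<Longrightarrow> \<exists>R. absorbs M t K C \<epsilon> R x"
    by (rule absorb[OF less_imp_le[OF M(1)] t]) (rule that)
  have bound: "S t g x \<le> c + \<epsilon> * K * (1 + 1 / \<kappa> x)" if \<epsilon>: "0 < \<epsilon>" "\<epsilon> \<le> 1" for \<epsilon>
  proof -
    obtain R where R: "absorbs M t K M \<epsilon> R x" using K(2)[OF less_imp_le[OF M(1)] \<epsilon>] by blast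
    have "\<forall>\<^sub>F n in sequentially. S t (v n) x \<le> c \<and> R + 1 \<le> n"
      using le eventually_ge_at_top[of "R + 1"] by eventually_elim auto
    then obtain n where n: "S t (v n) x \<le> c" "R + 1 \<le> n" by (auto simp: eventually_sequentially)
    have "S t g x \<le> S t (v n) x + 1 * \<epsilon> * K * (1 + 1 / \<kappa> x)"
    proof (rule absorbsD[OF R])
      fix y
      show "g y \<le> v n y + 1 * (\<epsilon> / \<kappa> y + M * far R y / \<kappa> y)"
      proof (cases "norm y \<le> real n")
        case True
        then show ?thesis using eq[OF True] \<epsilon> M(1) far_range(1)[of R y] pos[of y] by (simp add: less_imp_le)
      next
        case False
        then have "far R y = 1" using n(2) by (intro far_one) linarith
        moreover have "0 \<le> \<epsilon> / \<kappa> y" using \<epsilon> pos[of y] by simp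
        ultimately show ?thesis using wboundD[OF M(2), of y] range(1)[of n y] by simp
      qed
    qed (use t v vM g in auto)
    then show ?thesis using n(1) by simp
  qed
  show ?thesis
    by (rule le_by_small_errors[of 1 _ _ "K * (1 + 1 / \<kappa> x)"]) (use bound in \<open>auto simp: mult.assoc\<close>)
qed

text \<open>The nonnegative function \<open>V\<close> need not belong to the domain, but its truncations do. Their
  generators are bounded by \<open>D\<close>, up to \<open>\<epsilon>\<close>, where the truncation is not felt, and by a common
  multiple of \<open>1/\<kappa>\<close> elsewhere. As the constant \<open>C\<close> below does not depend on \<open>R\<close>, the growth of
  \<open>S h V\<close> for small \<open>h\<close> is governed by \<open>D\<close>.\<close>
lemma truncated_generator_growth:
  assumes V: "V \<in> C_weighted \<kappa>" "\<And>x. 0 \<le> V x"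
    and \<phi>: "\<And>n x. 0 \<le> \<phi> n x" "\<And>n x. \<phi> n x \<le> 1" "\<And>n x. norm x \<le> real n \<Longrightarrow> \<phi> n x = (1::real)"
      "\<And>n. \<exists>m::nat. \<forall>x. real m < norm x \<longrightarrow> \<phi> n x = 0"
    and dom: "\<And>n. (\<lambda>x. V x * \<phi> n x) \<in> C_weighted \<kappa>"
    and gen: "\<And>n. has_generator_value \<kappa> S (\<lambda>x. V x * \<phi> n x) (a n)"
    and D: "D \<in> C_weighted \<kappa>" and \<epsilon>: "0 < \<epsilon>"
    and aD: "\<And>n x. norm x \<le> real n \<Longrightarrow> a n x \<le> D x + \<epsilon> / \<kappa> x"
    and aC: "\<And>n x. a n x \<le> A / \<kappa> x"
  shows "\<exists>C\<ge>0. \<forall>R. \<exists>h0>0. \<forall>h x. 0 < h \<and> h \<le> h0 \<longrightarrow>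
    S h V x \<le> V x + h * (D x + 2 * \<epsilon> / \<kappa> x + C * far R x / \<kappa> x)"
proof -
  define v where "v = (\<lambda>n x. V x * \<phi> n x)"
  obtain MV where MV: "0 < MV" "wbound MV V" using V(1) by (rule C_obtain)
  obtain MD where MD: "0 < MD" "wbound MD D" using D by (rule C_obtain)
  have v_C: "v n \<in> C_weighted \<kappa>" for n using dom by (simp add: v_def)
  have v_gen: "has_generator_value \<kappa> S (v n) (a n)" for n using gen by (simp add: v_def)
  have v_range: "0 \<le> v n x" "v n x \<le> V x" for n x
    using V(2)[of x] \<phi>(1,2)[of n x] by (simp_all add: v_def mult_left_le)
  have v_eq: "v n x = V x" if "norm x \<le> real n" for n x using \<phi>(3)[OF that] by (simp add: v_def)
  have v_M: "wbound MV (v n)" for n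
    unfolding wbound_def using MV(2) v_range unfolding wbound_def by (metis abs_of_nonneg order_trans)
  \<comment> \<open>the cutoffs need not increase, but once \<open>n\<close> exceeds the radius of the support of \<open>\<phi> m\<close> they are ordered\<close>
  have v_mono: "\<exists>n0. \<forall>n\<ge>n0. \<forall>x. v m x \<le> v n x" for m
  proof -
    obtain n0 :: nat where n0: "\<And>x. real n0 < norm x \<Longrightarrow> \<phi> m x = 0" using \<phi>(4)[of m] by auto
    have "v m x \<le> v n x" if "n0 \<le> n" for n x
    proof (cases "norm x \<le> real n")
      case True
      then show ?thesis using v_range(2)[of m x] v_eq[OF True] by simp
    next
      case False
      then have "v m x = 0" using n0[of x] that by (simp add: v_def)
      then show ?thesis using v_range(1)[of n x] by simp
    qed
    then show ?thesis by blast
  qed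
  define A' where "A' = \<bar>A\<bar> + MD"
  \<comment> \<open>a continuous common majorant of the generators, tight on the ball of radius \<open>R\<close>\<close>
  define w where "w = (\<lambda>R x. D x + \<epsilon> / \<kappa> x + A' * far R x / \<kappa> x)"
  define Mw where "Mw = MD + \<bar>\<epsilon>\<bar> + A'"
  have A': "0 \<le> A'" using MD by (simp add: A'_def)
  have w_C: "w R \<in> C_weighted \<kappa>" for R
    unfolding w_def by (intro C_add D C_inverse C_far A')
  have w_M: "wbound Mw (w R)" for R
    unfolding w_def Mw_def by (intro wbound_add MD wbound_inverse far_wbound A')
  have Mw: "0 \<le> Mw" using wbound_nonneg[OF w_M] .
  have a_w: "a n x \<le> w R x" if "R + 1 \<le> n" for n R x
  proof (cases "norm x \<le> real n")
    case True
    moreover have "0 \<le> A' * far R x / \<kappa> x" using A' far_range(1)[of R x] pos[of x] by (simp add: less_imp_le)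
    ultimately show ?thesis using aD[OF True] by (simp add: w_def)
  next
    case False
    then have 1: "far R x = 1" using that by (intro far_one) linarith
    have "A / \<kappa> x \<le> \<bar>A\<bar> / \<kappa> x" using pos[of x] by (intro divide_right_mono) auto
    moreover have "0 \<le> \<epsilon> / \<kappa> x" using \<epsilon> pos[of x] by simp
    moreover have "- (MD / \<kappa> x) \<le> D x" using wboundD[OF MD(2), of x] by simp
    ultimately show ?thesis using aC[of n x] 1 by (simp add: w_def A'_def add_divide_distrib)
  qed
  obtain L where L: "lipschitz_bound (MV + Mw) 1 L" using local_lipschitz[of "MV + Mw" 1] MV Mw by auto
  note L_pos = lipschitz_bound_pos[OF L]
  have crude: "S h V x \<le> V x + h * (L * Mw / \<kappa> x)" if h: "0 < h" "h \<le> 1" for h x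
  proof (rule cutoff_limit[OF V(1) v_C _ v_range v_eq])
    show "\<forall>\<^sub>F n in sequentially. S h (v n) x \<le> V x + h * (L * Mw / \<kappa> x)"
    proof (rule eventually_sequentiallyI[of 1])
      fix n :: nat assume n: "1 \<le> n"
      have "S h (v n) x \<le> v n x + h * (L * Mw / \<kappa> x)"
      proof (rule generator_growth[OF v_gen v_C w_C[of 0] a_w h(1)])
        fix r assume r: "0 \<le> r" "r \<le> h"
        have "S r (\<lambda>x. v n x + w 0 x) x \<le> S r (v n) x + L * Mw / \<kappa> x"
        proof (rule lipschitz_boundD[OF L])
          show "wbound (MV + Mw) (\<lambda>x. v n x + w 0 x)" by (intro wbound_add v_M w_M)
          show "wbound (MV + Mw) (v n)" by (rule wbound_mono[OF v_M]) (use Mw in simp)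
          show "v n y + w 0 y \<le> v n y + Mw / \<kappa> y" for y using wboundD[OF w_M[of 0], of y] by simp
        qed (use r h Mw v_C C_add[OF v_C w_C] in auto)
        then show "S r (\<lambda>x. v n x + w 0 x) x - S r (v n) x \<le> L * Mw / \<kappa> x" by simp
      qed (use n in simp)
      then show "S h (v n) x \<le> V x + h * (L * Mw / \<kappa> x)" using v_range(2)[of n x] by simp
    qed
  qed (use h in auto)
  define C where "C = L * Mw + MD"
  have C: "0 \<le> C" using L_pos Mw MD by (simp add: C_def)
  have "\<exists>h0>0. \<forall>h x. 0 < h \<and> h \<le> h0 \<longrightarrow> S h V x \<le> V x + h * (D x + 2 * \<epsilon> / \<kappa> x + C * far R x / \<kappa> x)" for R
  proof -
    define m where "m = R + 1"
    obtain B where B: "0 < B" "\<And>x. norm x \<le> real m \<Longrightarrow> \<kappa> x \<le> B" using kappa_bounded_on_ball by blast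
    define e where "e = \<epsilon> / (2 * B)"
    have e: "0 < e" using \<epsilon> B by (simp add: e_def)
    have e2: "2 * e \<le> \<epsilon> / \<kappa> x" if "norm x \<le> real m" for x
      using B(2)[OF that] B(1) pos[of x] \<epsilon> by (auto simp: e_def intro!: divide_left_mono)
    obtain h1 where h1: "0 < h1" "\<And>r x. 0 \<le> r \<Longrightarrow> r \<le> h1 \<Longrightarrow> x \<in> cball 0 (real m) \<Longrightarrow>
        S r (\<lambda>x. V x + w m x) x \<le> V x + w m x + e"
      by (rule small_time_upper[OF C_add[OF V(1) w_C[of m]] compact_cball[of 0 "real m"] e]) (rule that)
    obtain Lm h2 where Lm: "0 < Lm" "0 < h2" "\<And>h x. 0 \<le> h \<Longrightarrow> h \<le> h2 \<Longrightarrow> \<bar>S h (v m) x - v m x\<bar> \<le> Lm * h / \<kappa> x"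
      by (rule domain_lipschitz[OF v_gen[of m] v_C[of m]]) (rule that)
    have "\<exists>k>0. \<forall>x. norm x \<le> real m \<longrightarrow> k \<le> \<kappa> x"
    proof -
      have "cball 0 (real m) \<noteq> ({} :: 'a set)" by simp
      then obtain y where "\<And>x. x \<in> cball 0 (real m) \<Longrightarrow> \<kappa> y \<le> \<kappa> x"
        using continuous_attains_inf[OF compact_cball _ continuous_on_subset[OF cont]] by (metis subset_UNIV)
      then show ?thesis using pos[of y] by auto
    qed
    then obtain k where k: "0 < k" "\<And>x. norm x \<le> real m \<Longrightarrow> k \<le> \<kappa> x" by blast
    define h0 where "h0 = min (min h1 h2) (min 1 (e * k / Lm))"
    have h0: "0 < h0" "h0 \<le> h1" "h0 \<le> h2" "h0 \<le> 1" "h0 \<le> e * k / Lm"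
      using h1(1) Lm(1,2) e k(1) by (auto simp: h0_def)
    have "S h V x \<le> V x + h * (D x + 2 * \<epsilon> / \<kappa> x + C * far R x / \<kappa> x)" if h: "0 < h" "h \<le> h0" for h x
    proof (cases "norm x \<le> real m")
      case True
      obtain n0 where n0: "\<And>n x. n0 \<le> n \<Longrightarrow> v m x \<le> v n x" using v_mono[of m] by blast
      have "S h V x \<le> V x + h * (w m x + 2 * e)"
      proof (rule cutoff_limit[OF V(1) v_C _ v_range v_eq])
        show "\<forall>\<^sub>F n in sequentially. S h (v n) x \<le> V x + h * (w m x + 2 * e)"
        proof (rule eventually_sequentiallyI[of "max n0 (m + 1)"])
          fix n assume n: "max n0 (m + 1) \<le> n"
          have "S h (v n) x \<le> v n x + h * (w m x + 2 * e)"
          proof (rule generator_growth[OF v_gen v_C w_C a_w h(1)])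
            fix r assume r: "0 \<le> r" "r \<le> h"
            have "S r (\<lambda>x. v n x + w m x) x \<le> S r (\<lambda>x. V x + w m x) x"
              by (rule mono) (use r v_range C_add v_C w_C V in auto)
            also have "\<dots> \<le> V x + w m x + e" using r h h0 True by (intro h1) auto
            finally have up: "S r (\<lambda>x. v n x + w m x) x \<le> V x + w m x + e" .
            have "Lm * r \<le> Lm * (e * k / Lm)" using r h h0 Lm(1) by (intro mult_left_mono) auto
            also have "\<dots> \<le> e * \<kappa> x" using k(2)[OF True] e Lm(1) by simp
            finally have "Lm * r / \<kappa> x \<le> e" using pos[of x] by (simp add: field_simps)
            moreover have "\<bar>S r (v m) x - v m x\<bar> \<le> Lm * r / \<kappa> x" using r h h0 by (intro Lm) auto
            moreover have "S r (v m) x \<le> S r (v n) x" by (rule mono) (use r v_C n0 n in auto)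
            ultimately have "V x - e \<le> S r (v n) x" using v_eq[OF True] by simp
            with up show "S r (\<lambda>x. v n x + w m x) x - S r (v n) x \<le> w m x + 2 * e" by simp
          qed (use n in simp)
          then show "S h (v n) x \<le> V x + h * (w m x + 2 * e)" using v_range(2)[of n x] by simp
        qed
      qed (use h in auto)
      also have "\<dots> \<le> V x + h * (D x + 2 * \<epsilon> / \<kappa> x + C * far R x / \<kappa> x)"
      proof -
        have "w m x = D x + \<epsilon> / \<kappa> x" using far_zero[OF True] by (simp add: w_def)
        moreover have "0 \<le> C * far R x / \<kappa> x" using C far_range(1)[of R x] pos[of x] by (simp add: less_imp_le)
        ultimately have "w m x + 2 * e \<le> D x + 2 * \<epsilon> / \<kappa> x + C * far R x / \<kappa> x"
          using e2[OF True] by simp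
        then show ?thesis using h by (intro add_left_mono mult_left_mono) auto
      qed
      finally show ?thesis .
    next
      case False
      then have 1: "far R x = 1" by (intro far_one) (simp add: m_def)
      have "S h V x \<le> V x + h * (L * Mw / \<kappa> x)" using h h0 by (intro crude) auto
      also have "\<dots> \<le> V x + h * (D x + 2 * \<epsilon> / \<kappa> x + C * far R x / \<kappa> x)"
      proof -
        have "- (MD / \<kappa> x) \<le> D x" using wboundD[OF MD(2), of x] by simp
        moreover have "0 \<le> 2 * \<epsilon> / \<kappa> x" using \<epsilon> pos[of x] by simp
        ultimately have "L * Mw / \<kappa> x \<le> D x + 2 * \<epsilon> / \<kappa> x + C * far R x / \<kappa> x"
          unfolding 1 C_def by (simp add: add_divide_distrib)
        then show ?thesis using h by (intro add_left_mono mult_left_mono) auto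
      qed
      finally show ?thesis .
    qed
    then show ?thesis using h0(1) by blast
  qed
  then show ?thesis using C by blast
qed

end

text \<open>Continuation argument: semicontinuity from the left carries the bound over to the supremum of the
  times up to which it has been reached, and the increments to the right carry it beyond.\<close>
lemma right_increment_bound:
  fixes F :: "real \<Rightarrow> real"
  assumes "0 \<le> t"
    and left: "\<And>s \<sigma>. \<lbrakk>0 \<le> s; s \<le> t; \<And>n::nat. 0 \<le> \<sigma> n; \<And>n. \<sigma> n \<le> s; \<sigma> \<longlonglongrightarrow> s; \<And>n. F 0 - c * \<sigma> n \<le> F (\<sigma> n)\<rbrakk> \<Longrightarrow>
      F 0 - c * s \<le> F s"
    and right: "\<And>s. \<lbrakk>0 \<le> s; s < t\<rbrakk> \<Longrightarrow> \<exists>h>0. s + h \<le> t \<and> F s - c * h \<le> F (s + h)"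
  shows "F 0 - c * t \<le> F t"
proof -
  define X where "X = {s \<in> {0..t}. F 0 - c * s \<le> F s}"
  have X0: "0 \<in> X" using assms(1) by (simp add: X_def)
  have bdd: "bdd_above X" by (rule bdd_aboveI[of _ t]) (simp add: X_def)
  define s where "s = Sup X"
  have upper: "r \<le> s" if "r \<in> X" for r unfolding s_def by (rule cSup_upper[OF that bdd])
  have "s \<le> t" unfolding s_def by (rule cSup_least) (use X0 in \<open>auto simp: X_def\<close>)
  with upper[OF X0] have s: "0 \<le> s" "s \<le> t" by auto
  have "s \<in> closure X" unfolding s_def by (rule closure_contains_Sup[OF _ bdd]) (use X0 in blast)
  then have "\<exists>\<sigma>. (\<forall>n::nat. \<sigma> n \<in> X) \<and> \<sigma> \<longlonglongrightarrow> s"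
    unfolding closure_sequential .
  then obtain \<sigma> where \<sigma>: "\<And>n. \<sigma> n \<in> X" "\<sigma> \<longlonglongrightarrow> s" by blast
  have "F 0 - c * s \<le> F s"
  proof (rule left[OF s _ _ \<sigma>(2)])
    show "0 \<le> \<sigma> n" "F 0 - c * \<sigma> n \<le> F (\<sigma> n)" for n using \<sigma>(1)[of n] by (simp_all add: X_def)
    show "\<sigma> n \<le> s" for n by (rule upper[OF \<sigma>(1)])
  qed
  moreover have "s = t"
  proof (rule ccontr)
    assume "s \<noteq> t"
    then obtain h where h: "0 < h" "s + h \<le> t" "F s - c * h \<le> F (s + h)" using right[of s] s by auto
    then have "s + h \<in> X" using \<open>F 0 - c * s \<le> F s\<close> s by (auto simp: X_def algebra_simps)
    then show False using upper[of "s + h"] h(1) by simp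
  qed
  ultimately show ?thesis by simp
qed

context convex_semigroup
begin

definition first_order_supersolution :: "real \<Rightarrow> real \<Rightarrow> (real \<Rightarrow> 'a \<Rightarrow> real) \<Rightarrow> bool" where
  "first_order_supersolution t \<epsilon> V \<longleftrightarrow> (\<forall>s\<in>{0..<t}. \<exists>C\<ge>0. \<forall>R. \<exists>h0>0. \<forall>h x. 0 < h \<and> h \<le> h0 \<and> s + h \<le> t \<longrightarrow>
     S h (V s) x \<le> V (s + h) x + h * (\<epsilon> / \<kappa> x + C * far R x / \<kappa> x))"

text \<open>Along a first order supersolution \<open>V\<close> for \<open>S\<close> the function \<open>s \<mapsto> S (t - s) (V s) x\<close> is
  almost increasing. As the claim is reduced to increments at single times \<open>s\<close>, the constant \<open>C\<close> at
  infinity may depend on \<open>s\<close> without any uniformity.\<close>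
lemma comparison_along_curve:
  assumes M: "0 \<le> M" and t: "0 \<le> t"
    and K: "\<And>C \<epsilon> x. \<lbrakk>0 \<le> C; 0 < \<epsilon>; \<epsilon> \<le> 1\<rbrakk> \<Longrightarrow> \<exists>R. absorbs M t K C \<epsilon> R x"
    and V: "\<And>s. 0 \<le> s \<Longrightarrow> s \<le> t \<Longrightarrow> V s \<in> C_weighted \<kappa>" "\<And>s. 0 \<le> s \<Longrightarrow> s \<le> t \<Longrightarrow> wbound M (V s)"
    and lip: "\<And>r s x. \<lbrakk>0 \<le> r; r \<le> t; 0 \<le> s; s \<le> t\<rbrakk> \<Longrightarrow> V r x \<le> V s x + L * \<bar>r - s\<bar> / \<kappa> x" and L: "0 \<le> L"
    and \<epsilon>: "0 < \<epsilon>" "\<epsilon> \<le> 1"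
    and step: "first_order_supersolution t \<epsilon> V"
  shows "S t (V 0) x \<le> V t x + t * \<epsilon> * K * (1 + 1 / \<kappa> x)"
proof -
  obtain N where N: "lipschitz_bound M t N" by (rule local_lipschitz[OF M t])
  define F where "F = (\<lambda>s. S (t - s) (V s) x)"
  define c where "c = \<epsilon> * K * (1 + 1 / \<kappa> x)"
  have "F 0 - c * t \<le> F t"
  proof (rule right_increment_bound[OF t])
    fix s \<sigma>
    assume s: "0 \<le> s" "s \<le> t" and \<sigma>: "\<And>n::nat. 0 \<le> \<sigma> n" "\<And>n. \<sigma> n \<le> s" "\<sigma> \<longlonglongrightarrow> s"
      and F: "\<And>n. F 0 - c * \<sigma> n \<le> F (\<sigma> n)"
    show "F 0 - c * s \<le> F s"
    proof (rule field_le_epsilon)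
      fix e :: real assume e: "0 < e"
      have \<sigma>t: "\<sigma> n \<le> t" for n using \<sigma>(2)[of n] s by simp
      have "\<forall>\<^sub>F n in sequentially. S (t - \<sigma> n) (V s) x < F s + e / 2"
        by (rule usc_eventually[where t = "t - s" and y = "\<lambda>_. x"])
          (use s e V \<sigma> \<sigma>t in \<open>auto simp: F_def intro!: tendsto_intros\<close>)
      moreover have "(\<lambda>n. N * (L * \<bar>\<sigma> n - s\<bar>) / \<kappa> x + c * (\<sigma> n - s)) \<longlonglongrightarrow> N * (L * \<bar>s - s\<bar>) / \<kappa> x + c * (s - s)"
        by (intro tendsto_intros \<sigma>(3)) (use pos[of x] in simp)
      then have "\<forall>\<^sub>F n in sequentially. N * (L * \<bar>\<sigma> n - s\<bar>) / \<kappa> x + c * (\<sigma> n - s) < e / 2"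
        by (rule order_tendstoD) (use e in simp)
      ultimately have "\<forall>\<^sub>F n in sequentially. F 0 - c * s \<le> F s + e"
      proof eventually_elim
        case (elim n)
        have "F (\<sigma> n) \<le> S (t - \<sigma> n) (V s) x + N * (L * \<bar>\<sigma> n - s\<bar>) / \<kappa> x"
          unfolding F_def
          by (rule lipschitz_boundD[OF N]) (use \<sigma> \<sigma>t s V L lip[of "\<sigma> n" s] in auto)
        moreover have "c * (\<sigma> n - s) = c * \<sigma> n - c * s" by (simp add: algebra_simps)
        ultimately show ?case using elim F[of n] by linarith
      qed
      then show "F 0 - c * s \<le> F s + e" by simp
    qed
  next
    fix s assume s: "0 \<le> s" "s < t"
    obtain C where C: "0 \<le> C" and C2: "\<forall>R. \<exists>h0>0. \<forall>h x. 0 < h \<and> h \<le> h0 \<and> s + h \<le> t \<longrightarrow>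
       S h (V s) x \<le> V (s + h) x + h * (\<epsilon> / \<kappa> x + C * far R x / \<kappa> x)"
      using step s unfolding first_order_supersolution_def by (metis atLeastLessThan_iff)
    obtain R where R: "absorbs M t K C \<epsilon> R x" using K[OF C \<epsilon>] by blast
    obtain h0 where h0: "0 < h0" "\<And>h x. 0 < h \<Longrightarrow> h \<le> h0 \<Longrightarrow> s + h \<le> t \<Longrightarrow>
       S h (V s) x \<le> V (s + h) x + h * (\<epsilon> / \<kappa> x + C * far R x / \<kappa> x)"
      using C2 by blast
    define h where "h = min (min h0 1) (t - s)"
    have h: "0 < h" "h \<le> h0" "h \<le> 1" "s + h \<le> t" using h0(1) s by (auto simp: h_def)
    have "F s = S (t - s - h + h) (V s) x" by (simp add: F_def)
    also have "\<dots> = S (t - s - h) (S h (V s)) x" using add_time[of "t - s - h" h "V s"] h s V by simp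
    also have "\<dots> \<le> S (t - s - h) (V (s + h)) x + h * \<epsilon> * K * (1 + 1 / \<kappa> x)"
      by (rule absorbsD[OF R]) (use h s V h0(2) mem in auto)
    also have "\<dots> = F (s + h) + c * h" by (simp add: F_def c_def algebra_simps)
    finally show "\<exists>h>0. s + h \<le> t \<and> F s - c * h \<le> F (s + h)" using h by (intro exI[of _ h]) auto
  qed
  moreover have "F t = V t x" using zero_time[OF V(1), of t] t by (simp add: F_def)
  ultimately show ?thesis by (simp add: F_def c_def algebra_simps)
qed

end


section \<open>Smooth functions\<close>

lemma iter_partial_simps [simp]:
  "iter_partial [] f = f"
  "iter_partial (i # is) f = partial_deriv i (iter_partial is f)"
  by (simp_all add: iter_partial_def fun_eq_iff)

lemma iter_partial_snoc: "iter_partial (is @ [i]) f = iter_partial is (partial_deriv i f)"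
  by (simp add: iter_partial_def fun_eq_iff)

lemma C_inf_differentiable: assumes "f \<in> C_inf" shows "f differentiable (at x)"
proof -
  have "iter_partial [] f differentiable (at x)" using assms unfolding C_inf_def by blast
  then show ?thesis by simp
qed

lemma C_inf_partial: "f \<in> C_inf \<Longrightarrow> partial_deriv i f \<in> C_inf"
  unfolding C_inf_def by (simp flip: iter_partial_snoc)

lemma C_inf_iter_partial: "f \<in> C_inf \<Longrightarrow> iter_partial is f \<in> C_inf"
  by (induction "is") (auto intro: C_inf_partial)

lemma C_inf_continuous: "f \<in> C_inf \<Longrightarrow> continuous_on UNIV f"
  by (meson C_inf_differentiable continuous_at_imp_continuous_on differentiable_imp_continuous_within)

lemma partial_deriv_eq: "(f has_derivative f') (at x) \<Longrightarrow> partial_deriv i f x = f' (axis i 1)"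
  unfolding partial_deriv_def using frechet_derivative_at by metis

lemma linear_axis_sum:
  fixes F :: "real^'n \<Rightarrow> real"
  assumes "linear F" shows "F h = (\<Sum>i\<in>UNIV. h $ i * F (axis i 1))"
proof -
  have "F h = F (\<Sum>i\<in>UNIV. (h $ i) *\<^sub>R axis i 1)"
    using basis_expansion[of h] by (simp add: scalar_mult_eq_scaleR)
  also have "\<dots> = (\<Sum>i\<in>UNIV. (h $ i) *\<^sub>R F (axis i 1))"
    using assms by (simp add: linear_sum linear_cmul)
  finally show ?thesis by simp
qed

lemma has_derivative_partials:
  assumes "f differentiable (at x)"
  shows "(f has_derivative (\<lambda>h. \<Sum>i\<in>UNIV. h $ i * partial_deriv i f x)) (at x)"
proof -
  have d: "(f has_derivative frechet_derivative f (at x)) (at x)"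
    using assms by (simp add: frechet_derivative_works)
  have "frechet_derivative f (at x) = (\<lambda>h. \<Sum>i\<in>UNIV. h $ i * partial_deriv i f x)"
    unfolding partial_deriv_def using linear_axis_sum[OF has_derivative_linear[OF d]] by blast
  with d show ?thesis by simp
qed

text \<open>Sums of products of smooth functions are stable under partial derivatives, hence smooth.\<close>
lemma C_inf_mult:
  fixes f g :: "real^'n \<Rightarrow> real"
  assumes "f \<in> C_inf" "g \<in> C_inf"
  shows "(\<lambda>x. f x * g x) \<in> C_inf"
proof -
  define P where "P = {\<lambda>x::real^'n. sum_list (map (\<lambda>(f, g). f x * g x) ps) | ps :: ((real^'n \<Rightarrow> real) \<times> (real^'n \<Rightarrow> real)) list.
     set ps \<subseteq> C_inf \<times> C_inf}"
  have deriv: "((\<lambda>x. sum_list (map (\<lambda>(f, g). f x * g x) ps)) has_derivative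
      (\<lambda>h. sum_list (map (\<lambda>(f, g). f x * (\<Sum>i\<in>UNIV. h $ i * partial_deriv i g x) +
        (\<Sum>i\<in>UNIV. h $ i * partial_deriv i f x) * g x) ps))) (at x)"
    if "set ps \<subseteq> C_inf \<times> C_inf" for ps :: "((real^'n \<Rightarrow> real) \<times> (real^'n \<Rightarrow> real)) list" and x
    using that
  proof (induction ps)
    case Nil
    then show ?case by simp
  next
    case (Cons p ps)
    obtain f g where p: "p = (f, g)" by (cases p)
    have fg: "f \<in> C_inf" "g \<in> C_inf" using Cons.prems p by auto
    show ?case using Cons.IH Cons.prems unfolding p
      by (auto intro!: has_derivative_add has_derivative_mult has_derivative_partials C_inf_differentiable fg)
  qed
  have stable: "partial_deriv i h \<in> P" if h: "h \<in> P" for h i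
  proof -
    obtain ps where ps: "set ps \<subseteq> C_inf \<times> C_inf" and h_eq: "h = (\<lambda>x. sum_list (map (\<lambda>(f, g). f x * g x) ps))"
      using h by (auto simp: P_def)
    define qs where "qs = concat (map (\<lambda>(f, g). [(f, partial_deriv i g), (partial_deriv i f, g)]) ps)"
    have ax: "(\<Sum>j\<in>UNIV. (axis i (1::real)) $ j * c j) = c i" for c :: "'n \<Rightarrow> real"
      by (simp add: axis_def if_distrib[of "\<lambda>a. a * _"] cong: if_cong)
    have "partial_deriv i h x = sum_list (map (\<lambda>(f, g). f x * g x) qs)" for x
    proof -
      have "partial_deriv i h x = sum_list (map (\<lambda>(f, g). f x * partial_deriv i g x + partial_deriv i f x * g x) ps)"
        unfolding h_eq partial_deriv_eq[OF deriv[OF ps, of x]] ax ..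
      also have "\<dots> = sum_list (map (\<lambda>(f, g). f x * g x) qs)"
        unfolding qs_def by (induction ps) auto
      finally show ?thesis .
    qed
    moreover have "set qs \<subseteq> C_inf \<times> C_inf" using ps by (auto simp: qs_def intro: C_inf_partial)
    ultimately show ?thesis unfolding P_def by blast
  qed
  have "(\<lambda>x. f x * g x) \<in> P"
    unfolding P_def using assms by (intro CollectI exI[of _ "[(f, g)]"]) auto
  then have "iter_partial is (\<lambda>x. f x * g x) \<in> P" for "is"
    by (induction "is") (auto intro: stable)
  moreover have "h differentiable (at x)" if "h \<in> P" for h x
    using that deriv unfolding P_def differentiable_def by blast
  ultimately show ?thesis by (simp add: C_inf_def)
qed

lemma C_inf_rescale:
  fixes f :: "real^'n \<Rightarrow> real"
  assumes "f \<in> C_inf" shows "(\<lambda>x. a * f (c *\<^sub>R x)) \<in> C_inf"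
proof -
  have deriv: "((\<lambda>x. a * g (c *\<^sub>R x)) has_derivative (\<lambda>h. a * (\<Sum>i\<in>UNIV. (c *\<^sub>R h) $ i * partial_deriv i g (c *\<^sub>R x)))) (at x)"
    if "g \<in> C_inf" for g a and x :: "real^'n"
  proof -
    have "((\<lambda>x. c *\<^sub>R x) has_derivative (\<lambda>h. c *\<^sub>R h)) (at x)"
      by (intro bounded_linear_imp_has_derivative bounded_linear_scaleR_right)
    from has_derivative_compose[OF this has_derivative_partials[OF C_inf_differentiable[OF that]]]
    show ?thesis by (rule has_derivative_mult_right)
  qed
  have "\<exists>b. iter_partial is (\<lambda>x. a * f (c *\<^sub>R x)) = (\<lambda>x. b * iter_partial is f (c *\<^sub>R x))" for "is"
  proof (induction "is")
    case Nil
    then show ?case by auto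
  next
    case (Cons i "is")
    then obtain b where b: "iter_partial is (\<lambda>x. a * f (c *\<^sub>R x)) = (\<lambda>x. b * iter_partial is f (c *\<^sub>R x))" ..
    have "partial_deriv i (\<lambda>x. b * iter_partial is f (c *\<^sub>R x)) x = (b * c) * partial_deriv i (iter_partial is f) (c *\<^sub>R x)" for x
      unfolding partial_deriv_eq[OF deriv[OF C_inf_iter_partial[OF assms]]]
      by (simp add: axis_def if_distrib[of "\<lambda>a. a * _"] if_distrib[of "\<lambda>a. c * a"] cong: if_cong)
    then show ?case by (auto simp: b)
  qed
  note iter = this
  have "iter_partial is (\<lambda>x. a * f (c *\<^sub>R x)) differentiable (at x)" for "is" x
  proof -
    obtain b where "iter_partial is (\<lambda>x. a * f (c *\<^sub>R x)) = (\<lambda>x. b * iter_partial is f (c *\<^sub>R x))"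
      using iter ..
    then show ?thesis unfolding differentiable_def using deriv[OF C_inf_iter_partial[OF assms]] by auto
  qed
  then show ?thesis by (simp add: C_inf_def)
qed


section \<open>Smooth functions of compact support\<close>

lemma C_c_inf_iff: "f \<in> C_c_inf \<longleftrightarrow> f \<in> C_inf \<and> (\<exists>r. \<forall>x. r < norm x \<longrightarrow> f x = 0)"
proof -
  have "compact (closure {x. f x \<noteq> 0}) \<longleftrightarrow> (\<exists>r. \<forall>x. r < norm x \<longrightarrow> f x = 0)"
    unfolding compact_closure bounded_iff by (auto simp: not_le[symmetric])
  then show ?thesis by (auto simp: C_c_inf_def)
qed

lemma C_c_inf_partial: assumes "f \<in> C_c_inf" shows "partial_deriv i f \<in> C_c_inf"
proof -
  obtain r where r: "\<And>x. r < norm x \<Longrightarrow> f x = 0" using assms by (auto simp: C_c_inf_iff)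
  have "partial_deriv i f x = 0" if "r < norm x" for x
  proof -
    have op: "open {x. r < norm (x::real^'a)}" by (intro open_Collect_less continuous_intros)
    have z: "((\<lambda>x. 0::real) has_derivative (\<lambda>h. 0)) (at x within UNIV)" by simp
    have "(f has_derivative (\<lambda>h. 0)) (at x within UNIV)"
      by (rule has_derivative_transform_within_open[OF z op]) (use that r in auto)
    then show ?thesis by (simp add: partial_deriv_eq)
  qed
  then show ?thesis using assms by (auto simp: C_c_inf_iff intro: C_inf_partial)
qed

lemma C_c_inf_bounded: assumes "f \<in> C_c_inf" shows "\<exists>B\<ge>0. \<forall>x. \<bar>f x\<bar> \<le> B"
proof -
  obtain r where r: "\<And>x. r < norm x \<Longrightarrow> f x = 0" using assms by (auto simp: C_c_inf_iff)
  have "compact (f ` cball 0 r)"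
    using assms by (intro compact_continuous_image compact_cball continuous_on_subset[OF C_inf_continuous])
      (auto simp: C_c_inf_iff)
  then have "bounded (f ` cball 0 r)" by (rule compact_imp_bounded)
  then obtain B where B: "\<And>x. norm x \<le> r \<Longrightarrow> \<bar>f x\<bar> \<le> B" unfolding bounded_iff by fastforce
  have "\<bar>f x\<bar> \<le> max B 0" for x
    using B[of x] r[of x] by (cases "r < norm x") auto
  then show ?thesis by (intro exI[of _ "max B 0"]) auto
qed

lemma abs_sum_components_le:
  fixes h :: "real^'n"
  assumes "\<And>i. \<bar>c i\<bar> \<le> B"
  shows "\<bar>\<Sum>i\<in>UNIV. h $ i * c i\<bar> \<le> real CARD('n) * B * norm h"
proof -
  have "\<bar>\<Sum>i\<in>UNIV. h $ i * c i\<bar> \<le> (\<Sum>i\<in>UNIV. \<bar>h $ i * c i\<bar>)" by (rule sum_abs)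
  also have "\<dots> \<le> (\<Sum>i\<in>(UNIV::'n set). norm h * B)"
    by (rule sum_mono) (auto simp: abs_mult intro!: mult_mono component_le_norm_cart assms)
  finally show ?thesis by (simp add: mult_ac)
qed

lemma C_c_inf_lipschitz:
  fixes f :: "real^'n \<Rightarrow> real"
  assumes "f \<in> C_c_inf" shows "\<exists>L\<ge>0. \<forall>x y. \<bar>f x - f y\<bar> \<le> L * norm (x - y)"
proof -
  have "\<forall>i. \<exists>B\<ge>0. \<forall>x. \<bar>partial_deriv i f x\<bar> \<le> B" using assms C_c_inf_partial C_c_inf_bounded by blast
  then obtain B where B: "\<And>i. 0 \<le> B i" "\<And>i x. \<bar>partial_deriv i f x\<bar> \<le> B i" by metis
  define M where "M = (\<Sum>i\<in>UNIV. B i)"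
  have M: "B i \<le> M" for i unfolding M_def by (rule member_le_sum) (use B in auto)
  have M0: "0 \<le> M" unfolding M_def by (rule sum_nonneg) (use B in auto)
  have "norm (f x - f y) \<le> (real CARD('n) * M) * norm (x - y)" for x y
  proof (rule differentiable_bound[OF convex_UNIV])
    fix x
    show "(f has_derivative (\<lambda>h. \<Sum>i\<in>UNIV. h $ i * partial_deriv i f x)) (at x within UNIV)"
      using assms by (intro has_derivative_partials C_inf_differentiable) (simp add: C_c_inf_iff)
    show "onorm (\<lambda>h. \<Sum>i\<in>UNIV. h $ i * partial_deriv i f x) \<le> real CARD('n) * M"
      unfolding real_norm_def[symmetric]
    proof (rule onorm_le)
      have "\<bar>partial_deriv i f x\<bar> \<le> M" for i using B(2)[of i x] M[of i] by linarith
      from abs_sum_components_le[of "\<lambda>i. partial_deriv i f x", OF this]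
      show "norm (\<Sum>i\<in>UNIV. h $ i * partial_deriv i f x) \<le> real CARD('n) * M * norm h" for h
        by simp
    qed
  qed auto
  then show ?thesis using M0 by (intro exI[of _ "real CARD('n) * M"]) auto
qed

text \<open>The remainder is uniform in \<open>x\<close> because the partial derivatives are Lipschitz continuous.\<close>
lemma C_c_inf_taylor:
  fixes f :: "real^'n \<Rightarrow> real"
  assumes "f \<in> C_c_inf"
  shows "\<exists>C\<ge>0. \<forall>x h. \<bar>f (x + h) - f x - (\<Sum>i\<in>UNIV. h $ i * partial_deriv i f x)\<bar> \<le> C * (norm h)\<^sup>2"
proof -
  have "\<forall>i. \<exists>L\<ge>0. \<forall>x y. \<bar>partial_deriv i f x - partial_deriv i f y\<bar> \<le> L * norm (x - y)"
    using assms C_c_inf_partial C_c_inf_lipschitz by blast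
  then obtain L where L: "\<And>i. 0 \<le> L i"
    "\<And>i x y. \<bar>partial_deriv i f x - partial_deriv i f y\<bar> \<le> L i * norm (x - y)" by metis
  define M where "M = (\<Sum>i\<in>UNIV. L i)"
  have M: "L i \<le> M" for i unfolding M_def by (rule member_le_sum) (use L in auto)
  have M0: "0 \<le> M" unfolding M_def by (rule sum_nonneg) (use L in auto)
  define N where "N = real CARD('n) * M"
  have "\<bar>f (x + h) - f x - (\<Sum>i\<in>UNIV. h $ i * partial_deriv i f x)\<bar> \<le> N * (norm h)\<^sup>2" for x h
  proof -
    define g where "g = (\<lambda>y. f y - (\<Sum>i\<in>UNIV. y $ i * partial_deriv i f x))"
    have "norm (g (x + h) - g x) \<le> (N * norm h) * norm (x + h - x)"
    proof (rule differentiable_bound[OF convex_cball[of x "norm h"]])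
      fix y assume y: "y \<in> cball x (norm h)"
      have "(g has_derivative (\<lambda>k. (\<Sum>i\<in>UNIV. k $ i * partial_deriv i f y) - (\<Sum>i\<in>UNIV. k $ i * partial_deriv i f x))) (at y)"
        unfolding g_def using assms
        by (intro has_derivative_diff has_derivative_partials C_inf_differentiable has_derivative_sum
            has_derivative_mult_left bounded_linear_imp_has_derivative bounded_linear_vec_nth) (simp add: C_c_inf_iff)
      moreover have "(\<lambda>k. (\<Sum>i\<in>UNIV. k $ i * partial_deriv i f y) - (\<Sum>i\<in>UNIV. k $ i * partial_deriv i f x)) =
          (\<lambda>k. \<Sum>i\<in>UNIV. k $ i * (partial_deriv i f y - partial_deriv i f x))"
        by (simp add: right_diff_distrib sum_subtractf)
      ultimately show "(g has_derivative (\<lambda>k. \<Sum>i\<in>UNIV. k $ i * (partial_deriv i f y - partial_deriv i f x))) (at y within cball x (norm h))"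
        by (simp add: has_derivative_at_withinI)
      have "\<bar>partial_deriv i f y - partial_deriv i f x\<bar> \<le> M * norm h" for i
      proof -
        have "norm (y - x) \<le> norm h" using y by (simp add: dist_norm norm_minus_commute)
        then have "L i * norm (y - x) \<le> M * norm h" using M[of i] L(1)[of i] M0 by (intro mult_mono) auto
        then show ?thesis using L(2)[of i y x] by simp
      qed
      then have "\<bar>\<Sum>i\<in>UNIV. k $ i * (partial_deriv i f y - partial_deriv i f x)\<bar> \<le> real CARD('n) * (M * norm h) * norm k" for k :: "real^'n"
        by (rule abs_sum_components_le)
      then show "onorm (\<lambda>k. \<Sum>i\<in>UNIV. k $ i * (partial_deriv i f y - partial_deriv i f x)) \<le> N * norm h"
        by (intro onorm_le) (simp add: N_def mult_ac)
    qed (auto simp: dist_norm)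
    moreover have "g (x + h) - g x = f (x + h) - f x - (\<Sum>i\<in>UNIV. h $ i * partial_deriv i f x)"
      by (simp add: g_def algebra_simps sum.distrib)
    ultimately show ?thesis by (simp add: power2_eq_square mult_ac)
  qed
  then show ?thesis using M0 by (intro exI[of _ N]) (auto simp: N_def)
qed

lemma C_c_inf_Lip_b: assumes "f \<in> C_c_inf" shows "f \<in> Lip_b"
proof -
  obtain B where "\<And>x. \<bar>f x\<bar> \<le> B" using C_c_inf_bounded[OF assms] by blast
  moreover obtain L where "0 \<le> L" "\<And>x y. \<bar>f x - f y\<bar> \<le> L * norm (x - y)" using C_c_inf_lipschitz[OF assms] by blast
  ultimately show ?thesis unfolding Lip_b_def bounded_iff
    by (auto intro!: lipschitz_onI exI simp: dist_norm)
qed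


section \<open>Convolution\<close>

definition convolution :: "(real^'n \<Rightarrow> real) \<Rightarrow> (real^'n \<Rightarrow> real) \<Rightarrow> real^'n \<Rightarrow> real" where
  "convolution W \<sigma> x = (\<integral>z. W z * \<sigma> (x - z) \<partial>lborel)"

lemma integrable_compact_support:
  fixes g W :: "'a::euclidean_space \<Rightarrow> real"
  assumes [measurable]: "W \<in> borel_measurable borel" "g \<in> borel_measurable borel"
    and W: "\<And>z. \<bar>W z\<bar> \<le> B" and g: "\<And>z. \<bar>g z\<bar> \<le> C" and supp: "\<And>z. z \<notin> cball c r \<Longrightarrow> g z = 0"
  shows "integrable lborel (\<lambda>z. W z * g z)"
proof (rule integrableI_bounded_set[of "cball c r"])
  have "0 \<le> B" using W[of undefined] by linarith
  then show "AE z in lborel. z \<in> cball c r \<longrightarrow> norm (W z * g z) \<le> B * C"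
    using W g by (auto simp: abs_mult intro!: mult_mono)
  show "emeasure lborel (cball c r) < \<infinity>" using emeasure_lborel_cball_finite by blast
qed (use supp in auto)

lemma measure_cball_translate: "measure lborel (cball (x::'a::euclidean_space) r) = measure lborel (cball (0::'a) r)"
  by (cases "0 \<le> r") (simp_all add: content_cball)

lemma integral_compact_support_bound:
  fixes g W :: "'a::euclidean_space \<Rightarrow> real"
  assumes [measurable]: "W \<in> borel_measurable borel" "g \<in> borel_measurable borel"
    and W: "\<And>z. \<bar>W z\<bar> \<le> B" and g: "\<And>z. \<bar>g z\<bar> \<le> C" and supp: "\<And>z. z \<notin> cball c r \<Longrightarrow> g z = 0"
  shows "\<bar>\<integral>z. W z * g z \<partial>lborel\<bar> \<le> B * C * measure lborel (cball (0::'a) r)"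
proof -
  have B: "0 \<le> B" using W[of undefined] by linarith
  have C: "0 \<le> C" using g[of undefined] by linarith
  have fin: "emeasure lborel (cball c r) < \<infinity>" using emeasure_lborel_cball_finite by blast
  have "\<bar>\<integral>z. W z * g z \<partial>lborel\<bar> \<le> (\<integral>z. \<bar>W z * g z\<bar> \<partial>lborel)" by (rule integral_abs_bound)
  also have "\<dots> \<le> (\<integral>z. B * C * indicator (cball c r) z \<partial>lborel)"
  proof (rule integral_mono)
    show "integrable lborel (\<lambda>z. \<bar>W z * g z\<bar>)"
      by (intro integrable_abs integrable_compact_support[OF assms])
    show "integrable lborel (\<lambda>z. B * C * indicator (cball c r) z :: real)"
      by (intro integrable_mult_right integrable_real_indicator fin) auto
    show "\<bar>W z * g z\<bar> \<le> B * C * indicator (cball c r) z" for z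
      using supp[of z] B C W[of z] g[of z] by (cases "z \<in> cball c r") (auto simp: abs_mult intro!: mult_mono)
  qed
  also have "\<dots> = B * C * measure lborel (cball c r)" by simp
  finally show ?thesis unfolding measure_cball_translate[of c r] .
qed

lemma reflect_translate_integral:
  fixes g :: "'a::euclidean_space \<Rightarrow> real"
  assumes [measurable]: "g \<in> borel_measurable borel"
  shows "(\<integral>z. g (x - z) \<partial>lborel) = (\<integral>y. g y \<partial>lborel)"
proof -
  have "lborel = distr lborel borel (\<lambda>z::'a. x - z)"
    using lborel_affine[of "-1" x] by (simp add: density_1)
  then have "(\<integral>y. g y \<partial>lborel) = (\<integral>y. g y \<partial>(distr lborel borel (\<lambda>z::'a. x - z)))" by simp
  also have "\<dots> = (\<integral>z. g (x - z) \<partial>lborel)" by (rule integral_distr) auto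
  finally show ?thesis ..
qed

lemma C_c_inf_measurable: "f \<in> C_c_inf \<Longrightarrow> f \<in> borel_measurable borel"
  by (simp add: C_c_inf_iff C_inf_continuous borel_measurable_continuous_onI)

lemma convolution_integrable:
  assumes W: "W \<in> borel_measurable borel" "\<And>z. \<bar>W z\<bar> \<le> B" and \<sigma>: "\<sigma> \<in> C_c_inf"
  shows "integrable lborel (\<lambda>z. W z * \<sigma> (x - z))"
proof -
  obtain C where C: "\<And>x. \<bar>\<sigma> x\<bar> \<le> C" using C_c_inf_bounded[OF \<sigma>] by blast
  obtain r where r: "\<And>x. r < norm x \<Longrightarrow> \<sigma> x = 0" using \<sigma> by (auto simp: C_c_inf_iff)
  note [measurable] = C_c_inf_measurable[OF \<sigma>]
  show ?thesis
    by (rule integrable_compact_support[where c = x and r = r and B = B and C = C])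
      (use W C r in \<open>auto simp: dist_norm\<close>)
qed

text \<open>As an average of translates, the convolution is amenable to Jensen's inequality; the definition
  puts the variable \<open>x\<close> into the smooth factor instead, which is the form to differentiate.\<close>
lemma convolution_translates:
  assumes [measurable]: "W \<in> borel_measurable borel" and \<sigma>: "\<sigma> \<in> C_c_inf"
  shows "convolution W \<sigma> x = (\<integral>y. W (x - y) * \<sigma> y \<partial>lborel)"
proof -
  note [measurable] = C_c_inf_measurable[OF \<sigma>]
  show ?thesis
    unfolding convolution_def
    using reflect_translate_integral[of "\<lambda>z. W (x - z) * \<sigma> z" x] by simp
qed

text \<open>The quadratic Taylor remainder of \<open>\<sigma>\<close>, integrated over its bounded support, is a quadratic
  remainder for the convolution.\<close>
lemma convolution_has_derivative:
  fixes W \<sigma> :: "real^'n \<Rightarrow> real"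
  assumes W: "W \<in> borel_measurable borel" "\<And>z. \<bar>W z\<bar> \<le> B" and \<sigma>: "\<sigma> \<in> C_c_inf"
  shows "(convolution W \<sigma> has_derivative
     (\<lambda>h. \<Sum>i\<in>UNIV. h $ i * convolution W (partial_deriv i \<sigma>) x)) (at x)"
proof -
  obtain C where C: "0 \<le> C"
    "\<And>x h. \<bar>\<sigma> (x + h) - \<sigma> x - (\<Sum>i\<in>UNIV. h $ i * partial_deriv i \<sigma> x)\<bar> \<le> C * (norm h)\<^sup>2"
    using C_c_inf_taylor[OF \<sigma>] by blast
  obtain r where r: "\<And>x. r < norm x \<Longrightarrow> \<sigma> x = 0" using \<sigma> by (auto simp: C_c_inf_iff)
  have "\<forall>i. \<exists>r. \<forall>x. r < norm x \<longrightarrow> partial_deriv i \<sigma> x = 0"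
    using C_c_inf_partial[OF \<sigma>] by (auto simp: C_c_inf_iff)
  then obtain q where q: "\<And>i x. q i < norm x \<Longrightarrow> partial_deriv i \<sigma> x = 0" by metis
  \<comment> \<open>the additional \<open>1\<close> leaves room for increments \<open>h\<close> of norm at most one\<close>
  define \<rho> where "\<rho> = \<bar>r\<bar> + (\<Sum>i\<in>UNIV. \<bar>q i\<bar>) + 1"
  have q_le: "\<bar>q i\<bar> \<le> (\<Sum>i\<in>UNIV. \<bar>q i\<bar>)" for i by (rule member_le_sum) auto
  define V where "V = measure lborel (cball (0::real^'n) \<rho>)"
  define D where "D = (\<lambda>h. \<Sum>i\<in>UNIV. h $ i * convolution W (partial_deriv i \<sigma>) x)"
  note [measurable] = W(1) C_c_inf_measurable[OF \<sigma>] C_c_inf_measurable[OF C_c_inf_partial[OF \<sigma>]]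
  have quad: "\<bar>convolution W \<sigma> (x + h) - convolution W \<sigma> x - D h\<bar> \<le> (B * C * V) * (norm h)\<^sup>2" if h: "norm h \<le> 1" for h
  proof -
    let ?E = "\<lambda>z. \<sigma> (x - z + h) - \<sigma> (x - z) - (\<Sum>i\<in>UNIV. h $ i * partial_deriv i \<sigma> (x - z))"
    have int: "integrable lborel (\<lambda>z. W z * \<sigma> (y - z))" "integrable lborel (\<lambda>z. W z * partial_deriv i \<sigma> (y - z))" for y i
      by (intro convolution_integrable[OF W] \<sigma> C_c_inf_partial)+
    have "D h = (\<integral>z. (\<Sum>i\<in>UNIV. h $ i * (W z * partial_deriv i \<sigma> (x - z))) \<partial>lborel)"
      unfolding D_def convolution_def
      by (subst Bochner_Integration.integral_sum) (auto intro!: integrable_mult_right int)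
    then have "convolution W \<sigma> (x + h) - convolution W \<sigma> x - D h =
        (\<integral>z. W z * \<sigma> (x + h - z) - W z * \<sigma> (x - z) - (\<Sum>i\<in>UNIV. h $ i * (W z * partial_deriv i \<sigma> (x - z))) \<partial>lborel)"
      unfolding convolution_def
      by (subst Bochner_Integration.integral_diff Bochner_Integration.integral_diff;
          auto intro!: Bochner_Integration.integrable_diff integrable_sum integrable_mult_right int)+
    also have "\<dots> = (\<integral>z. W z * ?E z \<partial>lborel)"
      by (rule Bochner_Integration.integral_cong) (auto simp: algebra_simps sum_distrib_left)
    finally have eq: "convolution W \<sigma> (x + h) - convolution W \<sigma> x - D h = (\<integral>z. W z * ?E z \<partial>lborel)" .
    have "\<bar>\<integral>z. W z * ?E z \<partial>lborel\<bar> \<le> B * (C * (norm h)\<^sup>2) * V"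
      unfolding V_def
    proof (rule integral_compact_support_bound[OF _ _ W(2)])
      show "\<bar>?E z\<bar> \<le> C * (norm h)\<^sup>2" for z using C(2)[of "x - z" h] by simp
      show "?E z = 0" if "z \<notin> cball x \<rho>" for z
      proof -
        have big: "\<rho> < norm (x - z)" using that by (simp add: dist_norm)
        have s0: "0 \<le> (\<Sum>i\<in>UNIV. \<bar>q i\<bar>)" by (rule sum_nonneg) simp
        have "r < norm (x - z)" using big s0 unfolding \<rho>_def by linarith
        then have "\<sigma> (x - z) = 0" by (rule r)
        moreover have "r < norm (x - z + h)"
          using big h norm_triangle_ineq4[of "x - z + h" h, unfolded add_diff_cancel] s0 unfolding \<rho>_def by linarith
        moreover have "partial_deriv i \<sigma> (x - z) = 0" for i
          using q[of i "x - z"] big q_le[of i] by (simp add: \<rho>_def)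
        ultimately show ?thesis using r by simp
      qed
    qed measurable
    then show ?thesis unfolding eq by (simp add: mult_ac)
  qed
  have "bounded_linear D"
    unfolding D_def by (intro bounded_linear_sum bounded_linear_mult_left bounded_linear_vec_nth
        bounded_linear_mult_const)
  moreover have "(\<lambda>h. norm (convolution W \<sigma> (x + h) - convolution W \<sigma> x - D h) / norm h) \<midarrow>0\<rightarrow> 0"
  proof (rule tendsto_sandwich)
    show "\<forall>\<^sub>F h in at 0. 0 \<le> norm (convolution W \<sigma> (x + h) - convolution W \<sigma> x - D h) / norm h" by simp
    have "\<forall>\<^sub>F h in at (0::real^'n). norm h < 1 \<and> h \<noteq> 0"
      unfolding eventually_at by (intro exI[of _ 1]) auto
    then show "\<forall>\<^sub>F h in at 0. norm (convolution W \<sigma> (x + h) - convolution W \<sigma> x - D h) / norm h \<le> (B * C * V) * norm h"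
    proof eventually_elim
      case (elim h)
      then show ?case using quad[of h] by (simp add: field_simps power2_eq_square)
    qed
    show "(\<lambda>h::real^'n. (B * C * V) * norm h) \<midarrow>0\<rightarrow> 0" by (rule tendsto_eq_intros refl | simp)+
  qed simp
  ultimately show ?thesis unfolding has_derivative_at D_def by blast
qed

lemma convolution_partial:
  assumes "W \<in> borel_measurable borel" "\<And>z. \<bar>W z\<bar> \<le> B" "\<sigma> \<in> C_c_inf"
  shows "partial_deriv i (convolution W \<sigma>) = convolution W (partial_deriv i \<sigma>)"
proof
  fix x
  show "partial_deriv i (convolution W \<sigma>) x = convolution W (partial_deriv i \<sigma>) x"
    unfolding partial_deriv_eq[OF convolution_has_derivative[OF assms, of x]]
    by (simp add: axis_def if_distrib[of "\<lambda>a. a * _"] cong: if_cong)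
qed

lemma convolution_C_b_inf:
  assumes W: "W \<in> borel_measurable borel" "\<And>z. \<bar>W z\<bar> \<le> B" and \<sigma>: "\<sigma> \<in> C_c_inf"
  shows "convolution W \<sigma> \<in> C_b_inf"
proof -
  have iter: "iter_partial is (convolution W \<sigma>) = convolution W (iter_partial is \<sigma>) \<and> iter_partial is \<sigma> \<in> C_c_inf" for "is"
    by (induction "is") (auto intro: C_c_inf_partial \<sigma> simp: convolution_partial[OF W])
  have "bounded (range (convolution W \<tau>))" if \<tau>: "\<tau> \<in> C_c_inf" for \<tau>
  proof -
    obtain C where C: "\<And>x. \<bar>\<tau> x\<bar> \<le> C" using C_c_inf_bounded[OF \<tau>] by blast
    obtain r where r: "\<And>x. r < norm x \<Longrightarrow> \<tau> x = 0" using \<tau> by (auto simp: C_c_inf_iff)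
    note [measurable] = C_c_inf_measurable[OF \<tau>]
    have "\<bar>convolution W \<tau> x\<bar> \<le> B * C * measure lborel (cball (0::real^'a) r)" for x
      unfolding convolution_def
      by (rule integral_compact_support_bound[OF _ _ W(2), where c = x])
        (use W C r in \<open>auto simp: dist_norm\<close>)
    then show ?thesis unfolding bounded_iff by auto
  qed
  moreover have "convolution W \<tau> differentiable (at x)" if "\<tau> \<in> C_c_inf" for \<tau> x
    using convolution_has_derivative[OF W that] unfolding differentiable_def by blast
  ultimately show ?thesis unfolding C_b_inf_def C_inf_def using iter by auto
qed

lemma C_b_inf_mult_C_c_inf: "f \<in> C_b_inf \<Longrightarrow> \<phi> \<in> C_c_inf \<Longrightarrow> (\<lambda>x. f x * \<phi> x) \<in> C_c_inf"
  by (auto simp: C_c_inf_iff C_b_inf_def intro!: C_inf_mult)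

lemma convolution_C_c_inf:
  fixes W :: "real^'n \<Rightarrow> real"
  assumes W: "W \<in> borel_measurable borel" "\<And>z. \<bar>W z\<bar> \<le> B" "\<And>z. r < norm z \<Longrightarrow> W z = 0" and \<sigma>: "\<sigma> \<in> C_c_inf"
  shows "convolution W \<sigma> \<in> C_c_inf"
proof -
  obtain q where q: "\<And>x. q < norm x \<Longrightarrow> \<sigma> x = 0" using \<sigma> by (auto simp: C_c_inf_iff)
  have "convolution W \<sigma> x = 0" if "r + q < norm x" for x
  proof -
    have "W z * \<sigma> (x - z) = 0" for z
    proof (cases "r < norm z")
      case False
      have "norm x \<le> norm (x - z) + norm z" using norm_triangle_ineq[of "x - z" z] by simp
      with False that have "q < norm (x - z)" by linarith
      then show ?thesis using q by simp
    qed (simp add: W(3))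
    then have "(\<lambda>z. W z * \<sigma> (x - z)) = (\<lambda>z. 0)" by (rule ext)
    then show ?thesis by (simp add: convolution_def)
  qed
  moreover have "convolution W \<sigma> \<in> C_inf" using convolution_C_b_inf[OF W(1,2) \<sigma>] by (simp add: C_b_inf_def)
  ultimately show ?thesis unfolding C_c_inf_iff by blast
qed

text \<open>Any nonnegative bump function provides mollifiers after rescaling and normalization.\<close>
lemma mollifier_exists:
  fixes \<phi> :: "real^'n \<Rightarrow> real"
  assumes \<phi>: "\<phi> \<in> C_c_inf" "\<And>x. 0 \<le> \<phi> x" "0 < \<phi> 0" and \<eta>: "0 < \<eta>"
  obtains \<rho> :: "real^'n \<Rightarrow> real" where "\<rho> \<in> C_c_inf" "\<And>x. 0 \<le> \<rho> x" "\<And>x. \<eta> < norm x \<Longrightarrow> \<rho> x = 0"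
    "integrable lborel \<rho>" "(\<integral>x. \<rho> x \<partial>lborel) = 1"
proof -
  obtain r0 where r0: "\<And>x. r0 < norm x \<Longrightarrow> \<phi> x = 0" using \<phi> by (auto simp: C_c_inf_iff)
  define r where "r = max r0 1"
  have r: "0 < r" "\<And>x. r < norm x \<Longrightarrow> \<phi> x = 0" using r0 by (auto simp: r_def less_max_iff_disj)
  define g where "g = (\<lambda>x. 1 * \<phi> ((r / \<eta>) *\<^sub>R x))"
  have g0: "g x = 0" if "\<eta> < norm x" for x
  proof -
    have "r / \<eta> * \<eta> < r / \<eta> * norm x" using that r \<eta> by (intro mult_strict_left_mono) auto
    then have "r < norm ((r / \<eta>) *\<^sub>R x)" using r \<eta> by simp
    then show ?thesis using r(2) by (simp add: g_def)
  qed
  have "g \<in> C_inf" unfolding g_def using \<phi>(1) by (intro C_inf_rescale) (simp add: C_c_inf_iff)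
  then have g: "g \<in> C_c_inf" unfolding C_c_inf_iff using g0 by blast
  have int: "integrable lborel g"
  proof -
    obtain B where B: "\<And>x. \<bar>g x\<bar> \<le> B" using C_c_inf_bounded[OF g] by blast
    have "integrable lborel (\<lambda>z. 1 * g z)"
      by (rule integrable_compact_support[where B = 1 and c = 0 and r = \<eta>, OF _ C_c_inf_measurable[OF g] _ B])
        (use g0 in auto)
    then show ?thesis by simp
  qed
  have gpos: "0 \<le> g x" for x using \<phi>(2) by (simp add: g_def)
  have "0 < (\<integral>x. g x \<partial>lborel)"
  proof -
    have "continuous (at 0) g"
      using C_inf_continuous[of g] g by (simp add: C_c_inf_iff continuous_on_eq_continuous_at)
    moreover have g00: "0 < g 0" using \<phi>(3) by (simp add: g_def)
    ultimately obtain d where d: "0 < d" "\<And>y. dist y 0 < d \<Longrightarrow> dist (g y) (g 0) < g 0 / 2"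
      unfolding continuous_at_eps_delta by (metis half_gt_zero)
    have "0 < g 0 / 2 * measure lborel (ball (0::real^'n) d)"
      using g00 content_ball_pos[OF d(1)] by (intro mult_pos_pos) auto
    also have "\<dots> = (\<integral>x. g 0 / 2 * indicator (ball (0::real^'n) d) x \<partial>lborel)" by simp
    also have "\<dots> \<le> (\<integral>x. g x \<partial>lborel)"
    proof (rule integral_mono[OF _ int])
      show "integrable lborel (\<lambda>x. g 0 / 2 * indicator (ball (0::real^'n) d) x)"
        by (intro integrable_mult_right integrable_real_indicator) (use emeasure_lborel_ball_finite in \<open>auto simp: less_top\<close>)
      show "g 0 / 2 * indicator (ball 0 d) x \<le> g x" for x
        using d(2)[of x] gpos[of x] by (cases "x \<in> ball 0 d") (auto simp: dist_real_def abs_if split: if_splits)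
    qed
    finally show ?thesis .
  qed
  note I = this
  define \<rho> where "\<rho> = (\<lambda>x. 1 / (\<integral>x. g x \<partial>lborel) * g (1 *\<^sub>R x))"
  show ?thesis
  proof (rule that[of \<rho>])
    have "\<rho> \<in> C_inf" unfolding \<rho>_def using g by (intro C_inf_rescale) (simp add: C_c_inf_iff)
    then show "\<rho> \<in> C_c_inf" unfolding C_c_inf_iff using g0 by (auto simp: \<rho>_def)
  qed (use gpos I g0 int in \<open>auto simp: \<rho>_def\<close>)
qed


section \<open>Jensen's inequality\<close>

context convex_semigroup
begin

lemma C_sum: "finite I \<Longrightarrow> (\<And>i. i \<in> I \<Longrightarrow> g i \<in> C_weighted \<kappa>) \<Longrightarrow> (\<lambda>x. \<Sum>i\<in>I. w i * g i x) \<in> C_weighted \<kappa>"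
  by (induction I rule: finite_induct) (auto intro!: C_zero C_add C_cmult)

text \<open>As \<open>S t 0 = 0\<close>, weights of total mass below one are admissible; this is the form that the
  induction on the index set asks for.\<close>
lemma jensen_finite:
  assumes "finite I" "0 \<le> t" "\<And>i. i \<in> I \<Longrightarrow> g i \<in> C_weighted \<kappa>" "\<And>i. i \<in> I \<Longrightarrow> 0 \<le> w i" "sum w I \<le> 1"
  shows "S t (\<lambda>x. \<Sum>i\<in>I. w i * g i x) x \<le> (\<Sum>i\<in>I. w i * S t (g i) x)"
  using assms
proof (induction I arbitrary: w rule: finite_induct)
  case empty
  then show ?case by (simp add: zero)
next
  case (insert i I)
  have wI: "0 \<le> sum w I" by (rule sum_nonneg) (use insert.prems in auto)
  have wi: "0 \<le> w i" "w i \<le> 1" using insert.prems insert.hyps wI by auto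
  show ?case
  proof (cases "w i = 1")
    case True
    then have "sum w I = 0" using insert.prems insert.hyps wI by simp
    then have "w j = 0" if "j \<in> I" for j
      using sum_nonneg_eq_0_iff[of I w] insert.prems insert.hyps that by auto
    then show ?thesis using insert.hyps True by simp
  next
    case False
    define v where "v = (\<lambda>j. w j / (1 - w i))"
    have eq: "(1 - w i) * (v j * a) = w j * a" for j a using False by (simp add: v_def)
    have "sum v I = sum w I / (1 - w i)" by (simp add: v_def sum_divide_distrib)
    also have "\<dots> \<le> 1" using insert.prems insert.hyps wi False by (simp add: field_simps)
    finally have v: "sum v I \<le> 1" .
    have v0: "0 \<le> v j" if "j \<in> I" for j using insert.prems that wi by (simp add: v_def)
    have g: "(\<lambda>x. \<Sum>j\<in>I. v j * g j x) \<in> C_weighted \<kappa>" by (intro C_sum) (use insert in auto)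
    have "S t (\<lambda>x. \<Sum>j\<in>insert i I. w j * g j x) x =
        S t (\<lambda>x. w i * g i x + (1 - w i) * (\<Sum>j\<in>I. v j * g j x)) x"
      using insert.hyps by (simp add: sum_distrib_left eq)
    also have "\<dots> \<le> w i * S t (g i) x + (1 - w i) * S t (\<lambda>x. \<Sum>j\<in>I. v j * g j x) x"
      by (intro convex g) (use insert.prems wi in auto)
    also have "\<dots> \<le> w i * S t (g i) x + (1 - w i) * (\<Sum>j\<in>I. v j * S t (g j) x)"
      by (intro add_left_mono mult_left_mono insert.IH) (use insert.prems v v0 wi in auto)
    also have "\<dots> = (\<Sum>j\<in>insert i I. w j * S t (g j) x)"
      using insert.hyps by (simp add: sum_distrib_left eq)
    finally show ?thesis .
  qed
qed

text \<open>Jensen's inequality for a family \<open>g\<close> that is Lipschitz continuous in a parameter ranging over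
  a compact set: a partition into small pieces reduces it to finite convex combinations.\<close>
lemma jensen_integral:
  fixes \<theta> :: "'m \<Rightarrow> 'b::{metric_space,second_countable_topology}"
  assumes M: "finite_measure M" "measure M (space M) = 1" and \<theta>[measurable]: "\<theta> \<in> borel_measurable M" and t: "0 \<le> t"
    and K: "compact K" and AE_K: "AE z in M. \<theta> z \<in> K"
    and g: "\<And>p. p \<in> K \<Longrightarrow> g p \<in> C_weighted \<kappa>" "\<And>p. p \<in> K \<Longrightarrow> wbound A (g p)"
    and lip: "\<And>p q x. p \<in> K \<Longrightarrow> q \<in> K \<Longrightarrow> g p x \<le> g q x + L * dist p q / \<kappa> x" and L: "0 \<le> L"
    and int_g: "\<And>x. integrable M (\<lambda>z. g (\<theta> z) x)"
    and G: "(\<lambda>x. \<integral>z. g (\<theta> z) x \<partial>M) \<in> C_weighted \<kappa>" "wbound A (\<lambda>x. \<integral>z. g (\<theta> z) x \<partial>M)"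
    and b: "integrable M b" "AE z in M. S t (g (\<theta> z)) x \<le> b z"
  shows "S t (\<lambda>x. \<integral>z. g (\<theta> z) x \<partial>M) x \<le> (\<integral>z. b z \<partial>M)"
proof -
  interpret finite_measure M by (rule M)
  have A: "0 \<le> A" using G(2) by (rule wbound_nonneg)
  obtain N where N: "lipschitz_bound A t N" by (rule local_lipschitz[OF A t])
  have main: "S t (\<lambda>x. \<integral>z. g (\<theta> z) x \<partial>M) x \<le> (\<integral>z. b z \<partial>M) + \<delta> * (2 * N * L / \<kappa> x)" if \<delta>: "0 < \<delta>" for \<delta>
  proof -
    obtain F where F: "finite F" "F \<subseteq> K" "K \<subseteq> (\<Union>p\<in>F. ball p \<delta>)"
      using seq_compact_imp_totally_bounded[OF compact_imp_seq_compact[OF K], rule_format, OF \<delta>] by blast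
    obtain p where p: "bij_betw p {0..<card F} F" using ex_bij_betw_nat_finite[OF F(1)] by blast
    define n where "n = card F"
    have pK: "p i \<in> K" if "i < n" for i using p F(2) that by (auto simp: n_def bij_betw_def)
    have cover: "\<exists>i<n. dist (p i) q < \<delta>" if q: "q \<in> K" for q
    proof -
      obtain a where "a \<in> F" "dist a q < \<delta>" using F(3) q by auto
      moreover have "F = p ` {0..<n}" using p by (simp add: n_def bij_betw_def)
      ultimately show ?thesis by auto
    qed
    define P where "P = (\<lambda>i. {z \<in> space M. dist (p i) (\<theta> z) < \<delta> \<and> (\<forall>j<i. \<not> dist (p j) (\<theta> z) < \<delta>)})"
    have P[measurable]: "P i \<in> sets M" for i unfolding P_def by measurable
    have P_fin: "emeasure M (P i) < \<infinity>" for i by (simp add: less_top[symmetric])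
    define w where "w = (\<lambda>i. measure M (P i))"
    have sum_ind: "(\<Sum>i<n. indicator (P i) z * c i) = (c j :: real)" if "z \<in> P j" "j < n" for z j c
    proof -
      have "indicator (P i) z = (if i = j then 1 else (0::real))" for i
        using that(1) by (auto simp: P_def indicator_def) (metis linorder_neqE_nat)+
      then have "(\<Sum>i<n. indicator (P i) z * c i) = (\<Sum>i<n. if i = j then c i else 0)"
        by (intro sum.cong) simp_all
      also have "\<dots> = c j" using that(2) by simp
      finally show ?thesis .
    qed
    have AE_P: "AE z in M. \<theta> z \<in> K \<and> (\<exists>j<n. z \<in> P j)"
      using AE_K AE_space
    proof eventually_elim
      case (elim z)
      define j where "j = (LEAST i. dist (p i) (\<theta> z) < \<delta>)"
      obtain i where i: "i < n" "dist (p i) (\<theta> z) < \<delta>" using cover[OF elim(1)] by blast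
      have "dist (p j) (\<theta> z) < \<delta>" unfolding j_def by (rule LeastI[of _ i]) (rule i)
      moreover have "\<not> dist (p k) (\<theta> z) < \<delta>" if "k < j" for k using not_less_Least that unfolding j_def by blast
      moreover have "j \<le> i" unfolding j_def by (rule Least_le) (rule i)
      ultimately have "j < n" "z \<in> P j" using elim i(1) by (auto simp: P_def)
      then show ?case using elim(1) by blast
    qed
    have int_ind: "integrable M (\<lambda>z. \<Sum>i<n. indicator (P i) z * c i)" for c :: "nat \<Rightarrow> real"
      by (intro Bochner_Integration.integrable_sum integrable_mult_left integrable_real_indicator P_fin) auto
    have int_eq: "(\<integral>z. (\<Sum>i<n. indicator (P i) z * c i) \<partial>M) = (\<Sum>i<n. w i * c i)" for c :: "nat \<Rightarrow> real"
      by (subst Bochner_Integration.integral_sum)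
        (auto intro!: integrable_mult_left integrable_real_indicator P_fin[simplified] simp: w_def)
    have w1: "sum w {..<n} = 1"
    proof -
      have "sum w {..<n} = (\<integral>z. (\<Sum>i<n. indicator (P i) z * 1) \<partial>M)" unfolding int_eq by simp
      also have "\<dots> = (\<integral>z. 1 \<partial>M)"
      proof (rule integral_cong_AE)
        show "AE z in M. (\<Sum>i<n. indicator (P i) z * 1) = (1::real)"
          using AE_P
        proof eventually_elim
          case (elim z)
          then obtain j where "j < n" "z \<in> P j" by blast
          then show ?case using sum_ind[of z j "\<lambda>_. 1"] by simp
        qed
      qed measurable
      also have "\<dots> = 1" by (simp add: M(2))
      finally show ?thesis .
    qed
    define s where "s = (\<lambda>x. \<Sum>i<n. w i * g (p i) x)"
    have w0: "0 \<le> w i" for i by (simp add: w_def)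
    have s_C: "s \<in> C_weighted \<kappa>" unfolding s_def by (rule C_sum) (use g pK in auto)
    have s_A: "wbound A s" unfolding wbound_def
    proof
      fix x
      have "\<bar>s x\<bar> \<le> (\<Sum>i<n. \<bar>w i * g (p i) x\<bar>)" unfolding s_def by (rule sum_abs)
      also have "\<dots> \<le> (\<Sum>i<n. w i * (A / \<kappa> x))"
      proof (rule sum_mono)
        fix i assume "i \<in> {..<n}"
        then have "\<bar>g (p i) x\<bar> \<le> A / \<kappa> x" by (intro wboundD g pK) simp
        from mult_left_mono[OF this w0[of i]] show "\<bar>w i * g (p i) x\<bar> \<le> w i * (A / \<kappa> x)"
          by (simp only: abs_mult abs_of_nonneg[OF w0])
      qed
      also have "\<dots> = A / \<kappa> x" unfolding sum_distrib_right[symmetric] w1 by simp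
      finally show "\<bar>s x\<bar> \<le> A / \<kappa> x" .
    qed
    have "(\<integral>z. g (\<theta> z) y \<partial>M) \<le> s y + (L * \<delta>) / \<kappa> y" for y
    proof -
      have "(\<integral>z. g (\<theta> z) y \<partial>M) \<le> (\<integral>z. (\<Sum>i<n. indicator (P i) z * (g (p i) y + L * \<delta> / \<kappa> y)) \<partial>M)"
      proof (rule integral_mono_AE[OF int_g int_ind])
        show "AE z in M. g (\<theta> z) y \<le> (\<Sum>i<n. indicator (P i) z * (g (p i) y + L * \<delta> / \<kappa> y))"
          using AE_P
        proof eventually_elim
          case (elim z)
          then obtain j where j: "j < n" "z \<in> P j" by blast
          have "g (\<theta> z) y \<le> g (p j) y + L * dist (\<theta> z) (p j) / \<kappa> y" using elim pK[OF j(1)] by (intro lip) auto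
          also have "\<dots> \<le> g (p j) y + L * \<delta> / \<kappa> y"
            using j(2) L pos[of y] by (intro add_left_mono divide_right_mono mult_left_mono) (auto simp: P_def dist_commute)
          finally show ?case unfolding sum_ind[OF j(2,1)] .
        qed
      qed
      also have "\<dots> = s y + (\<Sum>i<n. w i) * (L * \<delta> / \<kappa> y)"
        unfolding int_eq s_def by (simp only: distrib_left sum.distrib sum_distrib_right)
      finally show ?thesis using w1 by simp
    qed
    then have "S t (\<lambda>x. \<integral>z. g (\<theta> z) x \<partial>M) x \<le> S t s x + N * (L * \<delta>) / \<kappa> x"
      by (intro lipschitz_boundD[OF N]) (use t G s_C s_A L \<delta> in auto)
    also have "S t s x \<le> (\<Sum>i<n. w i * S t (g (p i)) x)"
      unfolding s_def by (rule jensen_finite) (use t g pK w0 w1 in auto)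
    also have "\<dots> = (\<integral>z. (\<Sum>i<n. indicator (P i) z * S t (g (p i)) x) \<partial>M)" unfolding int_eq ..
    also have "\<dots> \<le> (\<integral>z. b z + N * (L * \<delta>) / \<kappa> x \<partial>M)"
    proof (rule integral_mono_AE[OF int_ind])
      show "AE z in M. (\<Sum>i<n. indicator (P i) z * S t (g (p i)) x) \<le> b z + N * (L * \<delta>) / \<kappa> x"
        using AE_P b(2)
      proof eventually_elim
        case (elim z)
        then obtain j where j: "j < n" "z \<in> P j" by blast
        have \<theta>z: "\<theta> z \<in> K" using elim by blast
        have "S t (g (p j)) x \<le> S t (g (\<theta> z)) x + N * (L * \<delta>) / \<kappa> x"
        proof (rule lipschitz_boundD[OF N])
          fix y
          have "g (p j) y \<le> g (\<theta> z) y + L * dist (p j) (\<theta> z) / \<kappa> y" by (intro lip pK j \<theta>z)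
          also have "\<dots> \<le> g (\<theta> z) y + L * \<delta> / \<kappa> y"
            using j(2) L pos[of y] by (intro add_left_mono divide_right_mono mult_left_mono) (auto simp: P_def)
          finally show "g (p j) y \<le> g (\<theta> z) y + L * \<delta> / \<kappa> y" .
        qed (use t g pK[OF j(1)] \<theta>z L \<delta> in auto)
        then show ?case unfolding sum_ind[OF j(2,1)] using elim by simp
      qed
    qed (use b(1) in auto)
    also have "\<dots> = (\<integral>z. b z \<partial>M) + N * (L * \<delta>) / \<kappa> x"
      using b(1) by (simp add: M(2))
    finally show ?thesis by (simp add: algebra_simps)
  qed
  show ?thesis
    by (rule le_by_small_errors[OF zero_less_one]) (rule main)
qed

end


section \<open>Averaging in time\<close>

text \<open>The density is proportional to \<open>r\<^sup>2 (\<zeta> - r)\<^sup>2\<close> on \<open>[0, \<zeta>]\<close>. Its quadratic Taylor remainder makes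
  averages over time differentiable, however rough the averaged curve is.\<close>
lemma time_kernel_exists:
  fixes \<zeta> :: real
  assumes \<zeta>: "0 < \<zeta>"
  obtains \<psi> \<psi>' :: "real \<Rightarrow> real" and C where
    "0 < C" "\<And>r. 0 \<le> \<psi> r" "\<And>r. \<psi> r \<le> C" "\<And>r. \<bar>\<psi>' r\<bar> \<le> C"
    "\<And>r. r \<notin> {0..\<zeta>} \<Longrightarrow> \<psi> r = 0" "\<And>r. r \<notin> {0..\<zeta>} \<Longrightarrow> \<psi>' r = 0"
    "continuous_on UNIV \<psi>" "continuous_on UNIV \<psi>'" "integrable lborel \<psi>" "(\<integral>r. \<psi> r \<partial>lborel) = 1"
    "\<And>r k. \<bar>\<psi> (r + k) - \<psi> r - k * \<psi>' r\<bar> \<le> C * k\<^sup>2"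
proof -
  define p where "p = (\<lambda>r. max 0 (r * (\<zeta> - r)))"
  have p_in: "p r = r * (\<zeta> - r)" if "r \<in> {0..\<zeta>}" for r using that by (simp add: p_def)
  have p_out: "p r = 0" if "r \<notin> {0..\<zeta>}" for r
  proof -
    have "r * (\<zeta> - r) \<le> 0" using that \<zeta> by (auto simp: mult_le_0_iff)
    then show ?thesis by (simp add: p_def)
  qed
  have p0: "0 \<le> p r" for r by (simp add: p_def)
  have p_le: "p r \<le> \<zeta> * \<zeta>" for r
  proof (cases "r \<in> {0..\<zeta>}")
    case True
    then have "r * (\<zeta> - r) \<le> \<zeta> * \<zeta>" using \<zeta> by (intro mult_mono) auto
    then show ?thesis using p_in[OF True] by simp
  qed (use p_out \<zeta> in auto)
  have p_dist: "p r \<le> \<zeta> * \<bar>k\<bar>" if "r + k \<notin> {0..\<zeta>}" for r k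
  proof (cases "r \<in> {0..\<zeta>}")
    case True
    then have "r \<le> \<bar>k\<bar> \<or> \<zeta> - r \<le> \<bar>k\<bar>" using that by auto
    then have "r * (\<zeta> - r) \<le> \<zeta> * \<bar>k\<bar>"
    proof
      assume "r \<le> \<bar>k\<bar>"
      then have "r * (\<zeta> - r) \<le> \<bar>k\<bar> * \<zeta>" using True by (intro mult_mono) auto
      then show ?thesis by (simp add: mult.commute)
    next
      assume "\<zeta> - r \<le> \<bar>k\<bar>"
      then show ?thesis using True by (intro mult_mono) auto
    qed
    then show ?thesis using p_in[OF True] by simp
  qed (use p_out \<zeta> in auto)
  define q where "q = (\<lambda>r. (p r)\<^sup>2)"
  define q' where "q' = (\<lambda>r. 2 * p r * (\<zeta> - 2 * r))"
  have taylor: "\<bar>q (r + k) - q r - k * q' r\<bar> \<le> 3 * \<zeta>\<^sup>2 * k\<^sup>2" for r k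
  proof (cases "r \<in> {0..\<zeta>}")
    case r: True
    show ?thesis
    proof (cases "r + k \<in> {0..\<zeta>}")
      case True
      have "q (r + k) - q r - k * q' r = k\<^sup>2 * ((\<zeta> - r - (r + k))\<^sup>2 - 2 * p r)"
        unfolding q_def q'_def p_in[OF True] p_in[OF r] by (simp add: algebra_simps power2_eq_square)
      moreover have "\<bar>(\<zeta> - r - (r + k))\<^sup>2 - 2 * p r\<bar> \<le> 3 * \<zeta>\<^sup>2"
      proof -
        have "\<bar>\<zeta> - r - (r + k)\<bar> \<le> \<bar>\<zeta>\<bar>" using r True by auto
        then have "(\<zeta> - r - (r + k))\<^sup>2 \<le> \<zeta>\<^sup>2" by (simp only: abs_le_square_iff)
        then show ?thesis using p_le[of r] p0[of r] zero_le_power2[of "\<zeta> - r - (r + k)"]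
          unfolding power2_eq_square[of \<zeta>] by linarith
      qed
      ultimately show ?thesis by (simp add: abs_mult mult.commute mult_left_mono)
    next
      case False
      have pk: "p r \<le> \<zeta> * \<bar>k\<bar>" by (rule p_dist[OF False])
      have "q r \<le> (\<zeta> * \<bar>k\<bar>)\<^sup>2" unfolding q_def by (rule power_mono[OF pk p0])
      then have 1: "\<bar>q r\<bar> \<le> \<zeta>\<^sup>2 * k\<^sup>2" by (simp add: power_mult_distrib q_def)
      have "\<bar>q' r\<bar> \<le> 2 * (\<zeta> * \<bar>k\<bar>) * \<zeta>"
        unfolding q'_def abs_mult using pk p0[of r] r by (intro mult_mono) auto
      then have "\<bar>k * q' r\<bar> \<le> \<bar>k\<bar> * (2 * (\<zeta> * \<bar>k\<bar>) * \<zeta>)" unfolding abs_mult by (intro mult_left_mono) auto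
      also have "\<dots> = 2 * \<zeta>\<^sup>2 * k\<^sup>2" by (simp add: power2_eq_square algebra_simps flip: abs_mult)
      finally have 2: "\<bar>k * q' r\<bar> \<le> 2 * \<zeta>\<^sup>2 * k\<^sup>2" .
      have "q (r + k) = 0" using p_out[OF False] by (simp add: q_def)
      then show ?thesis using 1 2 by linarith
    qed
  next
    case False
    then have pk: "p (r + k) \<le> \<zeta> * \<bar>k\<bar>" using p_dist[of "r + k" "- k"] by simp
    have "q (r + k) \<le> (\<zeta> * \<bar>k\<bar>)\<^sup>2" unfolding q_def by (rule power_mono[OF pk p0])
    also have "\<dots> = \<zeta>\<^sup>2 * k\<^sup>2" by (simp add: power_mult_distrib)
    finally have "\<bar>q (r + k)\<bar> \<le> \<zeta>\<^sup>2 * k\<^sup>2" by (simp add: q_def)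
    moreover have "q r = 0" "q' r = 0" using p_out[OF False] by (simp_all add: q_def q'_def)
    ultimately show ?thesis by simp
  qed
  have cont_q: "continuous_on UNIV q" and cont_q': "continuous_on UNIV q'"
    unfolding q_def q'_def p_def by (intro continuous_intros)+
  have q_le: "q r \<le> (\<zeta> * \<zeta>)\<^sup>2" for r unfolding q_def by (rule power_mono[OF p_le p0])
  have q'_le: "\<bar>q' r\<bar> \<le> 2 * (\<zeta> * \<zeta>) * \<zeta>" for r
  proof (cases "r \<in> {0..\<zeta>}")
    case True
    then show ?thesis unfolding q'_def abs_mult using p_le[of r] p0[of r] by (intro mult_mono) auto
  qed (use p_out \<zeta> in \<open>auto simp: q'_def\<close>)
  have q0: "0 \<le> q r" for r by (simp add: q_def)
  have q_out: "q r = 0" "q' r = 0" if "r \<notin> {0..\<zeta>}" for r using p_out[OF that] by (simp_all add: q_def q'_def)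
  have int: "integrable lborel q"
  proof (rule integrableI_bounded_set[of "{0..\<zeta>}" _ _ "(\<zeta> * \<zeta>)\<^sup>2"])
    show "q \<in> borel_measurable lborel" using borel_measurable_continuous_onI[OF cont_q] by simp
  qed (use q_le q0 q_out in \<open>auto simp: emeasure_lborel_Icc_eq\<close>)
  define I where "I = (\<integral>r. q r \<partial>lborel)"
  have I: "0 < I"
  proof -
    have "0 < ((\<zeta> / 4) * (\<zeta> / 2))\<^sup>2 * (\<zeta> / 4)" using \<zeta> by simp
    also have "\<dots> = (\<integral>r. ((\<zeta> / 4) * (\<zeta> / 2))\<^sup>2 * indicator {\<zeta>/4..\<zeta>/2} r \<partial>lborel)" using \<zeta> by simp
    also have "\<dots> \<le> I" unfolding I_def
    proof (rule integral_mono[OF _ int])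
      show "((\<zeta> / 4) * (\<zeta> / 2))\<^sup>2 * indicator {\<zeta>/4..\<zeta>/2} r \<le> q r" for r
      proof (cases "r \<in> {\<zeta>/4..\<zeta>/2}")
        case True
        then have "(\<zeta> / 4) * (\<zeta> / 2) \<le> r * (\<zeta> - r)" using \<zeta> by (intro mult_mono) auto
        also have "\<dots> = p r" using True \<zeta> by (intro p_in[symmetric]) auto
        finally show ?thesis unfolding q_def using True \<zeta> by (auto intro!: power_mono)
      qed (use q0 in auto)
    qed (auto intro!: integrable_mult_right integrable_real_indicator simp: emeasure_lborel_Icc_eq)
    finally show ?thesis .
  qed
  define C where "C = ((\<zeta> * \<zeta>)\<^sup>2 + 2 * (\<zeta> * \<zeta>) * \<zeta> + 3 * \<zeta>\<^sup>2) / I"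
  have parts: "0 < \<zeta> * \<zeta>" "0 < (\<zeta> * \<zeta>)\<^sup>2" "0 < 2 * (\<zeta> * \<zeta>) * \<zeta>" "0 < 3 * \<zeta>\<^sup>2" using \<zeta> by auto
  show ?thesis
  proof (rule that[of C "\<lambda>r. q r / I" "\<lambda>r. q' r / I"])
    show "0 < C" unfolding C_def using parts I by (intro divide_pos_pos add_pos_pos)
    show "q r / I \<le> C" for r
      unfolding C_def using I q_le[of r] parts by (intro divide_right_mono) linarith+
    show "\<bar>q' r / I\<bar> \<le> C" for r
      unfolding C_def abs_divide using I q'_le[of r] parts by (simp only: abs_of_pos) (intro divide_right_mono, linarith+)
    show "\<bar>q (r + k) / I - q r / I - k * (q' r / I)\<bar> \<le> C * k\<^sup>2" for r k
    proof -
      have "q (r + k) / I - q r / I - k * (q' r / I) = (q (r + k) - q r - k * q' r) / I"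
        by (simp add: diff_divide_distrib)
      also have "\<bar>\<dots>\<bar> \<le> (3 * \<zeta>\<^sup>2 * k\<^sup>2) / I" unfolding abs_divide using I taylor[of r k] by (simp add: divide_right_mono)
      also have "\<dots> = (3 * \<zeta>\<^sup>2 / I) * k\<^sup>2" by simp
      also have "\<dots> \<le> C * k\<^sup>2"
        unfolding C_def using I parts by (intro mult_right_mono divide_right_mono) auto
      finally show ?thesis .
    qed
    show "continuous_on UNIV (\<lambda>r. q r / I)" "continuous_on UNIV (\<lambda>r. q' r / I)"
      using I by (auto intro!: continuous_intros cont_q cont_q')
    show "(\<integral>r. q r / I \<partial>lborel) = 1" using I by (simp add: I_def[symmetric])
  qed (use q0 I q_out int in auto)
qed

text \<open>Negative times are treated like time \<open>0\<close>, which makes \<open>last_visit E\<close> a monotone function on the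
  whole line, with values in \<open>E\<close> whenever \<open>0 \<in> E\<close> and \<open>E\<close> is closed.\<close>
definition last_visit :: "real set \<Rightarrow> real \<Rightarrow> real" where
  "last_visit E r = Sup {s \<in> E. s \<le> max r 0}"

definition missed :: "real set \<Rightarrow> real \<Rightarrow> real" where
  "missed E r = measure lborel ({0..r} - E)"

lemma
  assumes E: "closed E" "E \<subseteq> {0..}" "0 \<in> E"
  shows last_visit_mem: "last_visit E r \<in> E"
    and last_visit_le: "0 \<le> r \<Longrightarrow> last_visit E r \<le> r"
    and last_visit_upper: "s \<in> E \<Longrightarrow> s \<le> r \<Longrightarrow> s \<le> last_visit E r"
    and mono_last_visit: "mono (last_visit E)"
proof -
  have ne: "0 \<in> {s \<in> E. s \<le> max r 0}" for r using E by auto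
  have bdd: "bdd_above {s \<in> E. s \<le> max r 0}" for r by (rule bdd_aboveI[of _ "max r 0"]) auto
  have cl: "closed {s \<in> E. s \<le> max r 0}" for r
    using closed_Int[OF E(1) closed_atMost[of "max r 0"]] by (simp add: Int_def)
  have mem: "last_visit E r \<in> {s \<in> E. s \<le> max r 0}" for r
    unfolding last_visit_def by (rule closed_contains_Sup[OF _ bdd cl]) (use ne in auto)
  show "last_visit E r \<in> E" using mem by blast
  show "0 \<le> r \<Longrightarrow> last_visit E r \<le> r" using mem[of r] by simp
  show upper: "s \<le> last_visit E r" if "s \<in> E" "s \<le> r" for s r
    unfolding last_visit_def by (rule cSup_upper[OF _ bdd]) (use that in auto)
  show "mono (last_visit E)"
  proof (rule monoI)
    fix r s :: real assume "r \<le> s"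
    then have "last_visit E r \<in> {s' \<in> E. s' \<le> max s 0}" using mem[of r] by auto
    then show "last_visit E r \<le> last_visit E s" unfolding last_visit_def[of E s] by (rule cSup_upper[OF _ bdd])
  qed
qed

lemma missed_nonneg: "0 \<le> missed E r"
  by (simp add: missed_def)

lemma missed_increment:
  assumes E: "closed E" and "0 \<le> r" "r \<le> s" "I \<in> sets borel" "I \<subseteq> {r<..s} - E"
  shows "missed E r + measure lborel I \<le> missed E s"
proof -
  have [measurable]: "E \<in> sets borel" using E by (rule borel_closed)
  have fin: "emeasure lborel ({0..s} - E) < \<infinity>"
    by (rule le_less_trans[OF emeasure_mono[of _ "{0..s}"]]) (auto simp: emeasure_lborel_Icc_eq)
  have disj: "({0..r} - E) \<inter> I = {}" using assms by auto
  have fm: "{0..s} - E \<in> fmeasurable lborel" using fin by (intro fmeasurableI) auto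
  have fm1: "{0..r} - E \<in> fmeasurable lborel" by (rule fmeasurableI2[OF fm]) (use assms in auto)
  have fm2: "I \<in> fmeasurable lborel" by (rule fmeasurableI2[OF fm]) (use assms in auto)
  have "missed E r + measure lborel I = measure lborel (({0..r} - E) \<union> I)"
    unfolding missed_def
    by (rule measure_Union[symmetric]) (use fm1 fm2 disj in \<open>auto simp: fmeasurable_def less_top\<close>)
  also have "\<dots> \<le> missed E s" unfolding missed_def
    by (rule measure_mono_fmeasurable[OF _ _ fm]) (use assms in auto)
  finally show ?thesis .
qed

lemma mono_missed: "closed E \<Longrightarrow> 0 \<le> r \<Longrightarrow> r \<le> s \<Longrightarrow> missed E r \<le> missed E s"
  using missed_increment[of E r s "{}"] by simp

text \<open>If \<open>last_visit E\<close> advances by less than \<open>h\<close>, then the deficit is at most the length of the gap of \<open>E\<close> at the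
  end of the interval from \<open>r\<close> to \<open>r + h\<close>, and this gap counts as missed.\<close>
lemma last_visit_increment:
  assumes E: "closed E" "E \<subseteq> {0..}" "0 \<in> E" and r: "0 \<le> r" "0 \<le> h"
  shows "h - (last_visit E (r + h) - last_visit E r) \<le> missed E (r + h) - missed E r"
proof -
  let ?\<pi> = "last_visit E"
  have le: "?\<pi> r \<le> r" "?\<pi> r \<le> ?\<pi> (r + h)" "?\<pi> (r + h) \<le> r + h"
    using last_visit_le[OF E] monoD[OF mono_last_visit[OF E], of r "r + h"] r by auto
  define l where "l = max r (?\<pi> (r + h))"
  have "x \<notin> E" if "l < x" "x \<le> r + h" for x
    using last_visit_upper[OF E, of x "r + h"] that by (auto simp: l_def)
  then have "missed E r + measure lborel {l<..r + h} \<le> missed E (r + h)"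
    using r by (intro missed_increment[OF E(1)]) (auto simp: l_def)
  moreover have "measure lborel {l<..r + h} = r + h - l" using le r by (simp add: l_def)
  moreover have "h - (?\<pi> (r + h) - ?\<pi> r) \<le> r + h - l \<or> ?\<pi> (r + h) \<le> r" using le by (auto simp: l_def)
  moreover have "?\<pi> (r + h) = ?\<pi> r" if "?\<pi> (r + h) \<le> r"
    using last_visit_upper[OF E last_visit_mem[OF E] that] le by simp
  moreover have "l = r" if "?\<pi> (r + h) \<le> r" using that by (simp add: l_def)
  ultimately show ?thesis by force
qed

lemma last_visit_lag:
  assumes E: "closed E" "E \<subseteq> {0..}" "0 \<in> E" and r: "0 \<le> r"
  shows "r - last_visit E r \<le> missed E r"
proof -
  have "last_visit E 0 = 0" using last_visit_le[OF E, of 0] last_visit_mem[OF E, of 0] E(2) by auto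
  then show ?thesis using last_visit_increment[OF E, of 0 r] r missed_nonneg[of E 0] by simp
qed

text \<open>An increment of \<open>last_visit E\<close> may be much larger than \<open>h\<close>, namely at the end of a gap, but its
  distance from \<open>h\<close> is at most the increment of \<open>q r = last_visit E r - r + 2 * missed E r\<close>. The integral
  of the latter telescopes to boundary terms of length \<open>h\<close>.\<close>
lemma last_visit_increment_average:
  assumes E: "closed E" "E \<subseteq> {0..}" "0 \<in> E" and b: "0 \<le> b" "0 \<le> h"
  shows "(\<integral>r. \<bar>h - (last_visit E (r + h) - last_visit E r)\<bar> * indicator {0..b} r \<partial>lborel) \<le> 3 * h * missed E (b + h)"
    and "integrable lborel (\<lambda>r. \<bar>h - (last_visit E (r + h) - last_visit E r)\<bar> * indicator {0..b} r)"
proof -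
  let ?\<pi> = "last_visit E" and ?m = "missed E (b + h)"
  have [measurable]: "?\<pi> \<in> borel_measurable borel" by (rule borel_measurable_mono[OF mono_last_visit[OF E]])
  define m where "m = (\<lambda>r. missed E (max r 0))"
  have "mono m" unfolding m_def by (intro monoI mono_missed E) auto
  then have m_meas[measurable]: "m \<in> borel_measurable borel" by (rule borel_measurable_mono)
  define q where "q = (\<lambda>r. ?\<pi> r - r + 2 * m r)"
  have q_meas[measurable]: "q \<in> borel_measurable borel" unfolding q_def by measurable
  have q_bounds: "- ?m \<le> q r" "q r \<le> 2 * ?m" if "0 \<le> r" "r \<le> b + h" for r
    using last_visit_lag[OF E that(1)] last_visit_le[OF E that(1)] mono_missed[OF E(1) that] missed_nonneg[of E r] that
    by (auto simp: q_def m_def)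
  have pw: "\<bar>h - (?\<pi> (r + h) - ?\<pi> r)\<bar> \<le> q (r + h) - q r" if "0 \<le> r" for r
    using last_visit_increment[OF E that b(2)] mono_missed[OF E(1) that, of "r + h"] that b by (auto simp: q_def m_def)
  have int: "integrable lborel (\<lambda>r. F r * indicator {c..d} r)"
    if [measurable]: "F \<in> borel_measurable borel" and "\<And>r. r \<in> {c..d} \<Longrightarrow> \<bar>F r\<bar> \<le> B" for F :: "real \<Rightarrow> real" and c d B
    by (rule integrableI_bounded_set[of "{c..d}" _ _ B]) (use that(2) in \<open>auto simp: emeasure_lborel_Icc_eq\<close>)
  have i1: "integrable lborel (\<lambda>r. q (r + h) * indicator {0..b} r)"
  proof (rule int[of _ _ _ "2 * ?m"])
    fix r assume "r \<in> {0..b}"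
    then show "\<bar>q (r + h)\<bar> \<le> 2 * ?m"
      using q_bounds[of "r + h"] b missed_nonneg[of E "b + h"] by (simp add: abs_le_iff)
  qed measurable
  have i2: "integrable lborel (\<lambda>r. q r * indicator {c..d} r)" if "0 \<le> c" "d \<le> b + h" for c d
  proof (rule int[of _ _ _ "2 * ?m"])
    fix r assume "r \<in> {c..d}"
    then show "\<bar>q r\<bar> \<le> 2 * ?m"
      using q_bounds[of r] that missed_nonneg[of E "b + h"] by (simp add: abs_le_iff)
  qed measurable
  show i3: "integrable lborel (\<lambda>r. \<bar>h - (?\<pi> (r + h) - ?\<pi> r)\<bar> * indicator {0..b} r)"
  proof (rule int[of _ _ _ "3 * ?m"])
    fix r assume r: "r \<in> {0..b}"
    show "\<bar>\<bar>h - (?\<pi> (r + h) - ?\<pi> r)\<bar>\<bar> \<le> 3 * ?m" using pw[of r] q_bounds[of r] q_bounds[of "r + h"] r b by simp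
  qed measurable
  have "(\<integral>r. \<bar>h - (?\<pi> (r + h) - ?\<pi> r)\<bar> * indicator {0..b} r \<partial>lborel) \<le>
      (\<integral>r. q (r + h) * indicator {0..b} r - q r * indicator {0..b} r \<partial>lborel)"
    using pw by (intro integral_mono i3 Bochner_Integration.integrable_diff i1 i2) (use b in \<open>auto simp: indicator_def\<close>)
  also have "\<dots> = (\<integral>r. q (r + h) * indicator {0..b} r \<partial>lborel) - (\<integral>r. q r * indicator {0..b} r \<partial>lborel)"
    by (intro Bochner_Integration.integral_diff i1 i2) (use b in auto)
  also have "(\<integral>r. q (r + h) * indicator {0..b} r \<partial>lborel) = (\<integral>r. q r * indicator {h..b + h} r \<partial>lborel)"
    using lborel_integral_real_affine[of 1 "\<lambda>r. q r * indicator {h..b + h} r" h]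
    by (simp add: add.commute indicator_def cong: if_cong)
  also have "\<dots> - (\<integral>r. q r * indicator {0..b} r \<partial>lborel) =
      (\<integral>r. q r * indicator {h..b + h} r - q r * indicator {0..b} r \<partial>lborel)"
    by (intro Bochner_Integration.integral_diff[symmetric] i2) (use b in auto)
  also have "\<dots> \<le> (\<integral>r. (2 * ?m) * indicator {b..b + h} r + ?m * indicator {0..h} r \<partial>lborel)"
  proof (rule integral_mono)
    show "q r * indicator {h..b + h} r - q r * indicator {0..b} r \<le> (2 * ?m) * indicator {b..b + h} r + ?m * indicator {0..h} r" for r
      using q_bounds[of r] missed_nonneg[of E "b + h"] b by (auto simp: indicator_def)
  qed (auto intro!: Bochner_Integration.integrable_diff i2 Bochner_Integration.integrable_add integrable_mult_right integrable_real_indicator simp: b)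
  also have "\<dots> = 3 * h * ?m" using b by simp
  finally show "(\<integral>r. \<bar>h - (?\<pi> (r + h) - ?\<pi> r)\<bar> * indicator {0..b} r \<partial>lborel) \<le> 3 * h * ?m" .
qed


section \<open>Smoothing the orbits of a semigroup\<close>

text \<open>By \<open>ratio\<close>, translations of length at most one are bounded operators on the weighted space; by
  \<open>bound\<close>, the space contains the bounded continuous functions.\<close>
locale translation_semigroup = convex_semigroup \<kappa> T
  for \<kappa> :: "real^'n::finite \<Rightarrow> real" and T +
  fixes c B :: real
  assumes ratio: "\<And>x y. norm y \<le> 1 \<Longrightarrow> \<kappa> x \<le> c * \<kappa> (x - y)"
    and bound: "\<And>x. \<kappa> x \<le> B"
begin

lemma c_ge_1: "1 \<le> c"
  using ratio[of 0 undefined] pos[of undefined] by simp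

lemma B_pos: "0 < B"
  using bound[of undefined] pos[of undefined] by linarith

lemma inverse_translate: assumes "norm y \<le> 1" "0 \<le> M" shows "M / \<kappa> (x - y) \<le> c * M / \<kappa> x"
proof -
  have "M * \<kappa> x \<le> M * (c * \<kappa> (x - y))" by (intro mult_left_mono ratio assms)
  then show ?thesis using pos[of x] pos[of "x - y"] by (simp add: field_simps)
qed

lemma wbound_translate: assumes "wbound M f" "norm y \<le> 1" shows "wbound (c * M) (\<lambda>x. f (x - y))"
  unfolding wbound_def using wboundD[OF assms(1)] inverse_translate[OF assms(2) wbound_nonneg[OF assms(1)]]
  by (meson order_trans)

lemma C_translate: assumes "f \<in> C_weighted \<kappa>" "norm y \<le> 1" shows "(\<lambda>x. f (x - y)) \<in> C_weighted \<kappa>"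
proof -
  obtain M where "wbound M f" using C_obtain[OF assms(1)] by blast
  then have "wbound (c * M) (\<lambda>x. f (x - y))" using assms(2) by (rule wbound_translate)
  moreover have "continuous_on UNIV (\<lambda>x. f (x - y))"
    by (rule continuous_on_compose2[OF C_cont[OF assms(1)]]) (auto intro!: continuous_intros)
  ultimately show ?thesis unfolding C_weighted_iff by blast
qed

lemma bounded_wbound: "(\<And>x. \<bar>f x\<bar> \<le> M) \<Longrightarrow> wbound (M * B) f"
  unfolding wbound_def
proof
  fix x assume f: "\<And>x. \<bar>f x\<bar> \<le> M"
  have "M * \<kappa> x \<le> M * B" using f[of x] by (intro mult_left_mono bound) linarith
  then have "M \<le> M * B / \<kappa> x" using pos[of x] by (simp add: field_simps)
  then show "\<bar>f x\<bar> \<le> M * B / \<kappa> x" using f[of x] by linarith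
qed

lemma bounded_continuous_C: "continuous_on UNIV f \<Longrightarrow> (\<And>x. \<bar>f x\<bar> \<le> M) \<Longrightarrow> f \<in> C_weighted \<kappa>"
  unfolding C_weighted_iff using bounded_wbound by blast

end

lemma prob_density:
  fixes \<psi> :: "'b::euclidean_space \<Rightarrow> real"
  assumes "\<psi> \<in> borel_measurable borel" "integrable lborel \<psi>" "\<And>r. 0 \<le> \<psi> r" "(\<integral>r. \<psi> r \<partial>lborel) = 1"
  shows "finite_measure (density lborel \<psi>)" "measure (density lborel \<psi>) (space (density lborel \<psi>)) = 1"
proof -
  have "emeasure (density lborel \<psi>) (space (density lborel \<psi>)) = (\<integral>\<^sup>+r. ennreal (\<psi> r) \<partial>lborel)"
    using assms by (subst emeasure_density) (auto intro!: nn_integral_cong)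
  also have "\<dots> = ennreal (\<integral>r. \<psi> r \<partial>lborel)" using assms by (intro nn_integral_eq_integral) auto
  finally have "emeasure (density lborel \<psi>) (space (density lborel \<psi>)) = 1" using assms by simp
  then show "finite_measure (density lborel \<psi>)" "measure (density lborel \<psi>) (space (density lborel \<psi>)) = 1"
    by (auto intro!: finite_measureI simp: measure_def)
qed

lemma average_le:
  fixes \<psi> f :: "'b::euclidean_space \<Rightarrow> real"
  assumes "integrable lborel (\<lambda>r. f r * \<psi> r)" "integrable lborel \<psi>" "\<And>r. 0 \<le> \<psi> r" "(\<integral>r. \<psi> r \<partial>lborel) = 1"
    and "\<And>r. \<psi> r \<noteq> 0 \<Longrightarrow> f r \<le> M"
  shows "(\<integral>r. f r * \<psi> r \<partial>lborel) \<le> M"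
proof -
  have "f r * \<psi> r \<le> M * \<psi> r" for r
    using assms(3)[of r] assms(5)[of r] by (cases "\<psi> r = 0") (auto intro!: mult_right_mono)
  then have "(\<integral>r. f r * \<psi> r \<partial>lborel) \<le> (\<integral>r. M * \<psi> r \<partial>lborel)"
    using assms by (intro integral_mono) auto
  then show ?thesis using assms by simp
qed

lemma average_abs_le:
  fixes \<psi> f :: "'b::euclidean_space \<Rightarrow> real"
  assumes "integrable lborel (\<lambda>r. f r * \<psi> r)" "integrable lborel \<psi>" "\<And>r. 0 \<le> \<psi> r" "(\<integral>r. \<psi> r \<partial>lborel) = 1"
    and "\<And>r. \<psi> r \<noteq> 0 \<Longrightarrow> \<bar>f r\<bar> \<le> M"
  shows "\<bar>\<integral>r. f r * \<psi> r \<partial>lborel\<bar> \<le> M"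
proof -
  have "(\<integral>r. f r * \<psi> r \<partial>lborel) \<le> M" by (rule average_le[OF assms(1-4)]) (use assms(5) in force)
  moreover have "(\<integral>r. (- f r) * \<psi> r \<partial>lborel) \<le> M"
    by (rule average_le[OF _ assms(2-4)]) (use assms(1,5) in force)+
  ultimately show ?thesis by simp
qed

locale mollified = translation_semigroup \<kappa> T c B
  for \<kappa> :: "real^'n::finite \<Rightarrow> real" and T c B +
  fixes \<eta> :: real and \<rho> :: "real^'n \<Rightarrow> real"
  assumes \<eta>: "0 < \<eta>" "\<eta> \<le> 1"
    and \<rho>: "\<rho> \<in> C_c_inf" "\<And>x. 0 \<le> \<rho> x" "\<And>x. \<eta> < norm x \<Longrightarrow> \<rho> x = 0"
      "integrable lborel \<rho>" "(\<integral>x. \<rho> x \<partial>lborel) = 1"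
begin

lemma convolution_average:
  assumes F: "continuous_on UNIV F" "\<And>z. \<bar>F z\<bar> \<le> M"
  shows "integrable lborel (\<lambda>y. F (x - y) * \<rho> y)" "convolution F \<rho> x = (\<integral>y. F (x - y) * \<rho> y \<partial>lborel)"
proof -
  have [measurable]: "F \<in> borel_measurable borel" using F(1) by (rule borel_measurable_continuous_onI)
  obtain Q where Q: "\<And>x. \<bar>\<rho> x\<bar> \<le> Q" using C_c_inf_bounded[OF \<rho>(1)] by blast
  note [measurable] = C_c_inf_measurable[OF \<rho>(1)]
  show "integrable lborel (\<lambda>y. F (x - y) * \<rho> y)"
    by (rule integrable_compact_support[where c = 0 and r = \<eta> and B = M and C = Q]) (use F Q \<rho>(3) in auto)
  show "convolution F \<rho> x = (\<integral>y. F (x - y) * \<rho> y \<partial>lborel)" by (rule convolution_translates) (use \<rho> in auto)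
qed

lemma rho_supp: "\<rho> y \<noteq> 0 \<Longrightarrow> norm y \<le> \<eta>"
  using \<rho>(3)[of y] by (cases "\<eta> < norm y") auto

lemma convolution_wbound:
  assumes F: "continuous_on UNIV F" "\<And>z. \<bar>F z\<bar> \<le> M" and "wbound Q F"
  shows "\<bar>convolution F \<rho> x\<bar> \<le> c * Q / \<kappa> x"
  unfolding convolution_average(2)[OF F]
proof (rule average_abs_le[OF convolution_average(1)[OF F] \<rho>(4,2,5)])
  fix y assume "\<rho> y \<noteq> 0"
  then have "norm y \<le> 1" using rho_supp[of y] \<eta> by simp
  from wboundD[OF wbound_translate[OF assms(3) this]] show "\<bar>F (x - y)\<bar> \<le> c * Q / \<kappa> x" .
qed

end

text \<open>The orbit \<open>u\<close> is sampled only at the times of the closed set \<open>E\<close>, on which its bounds, its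
  Lipschitz constants and its approximate commutation with translations are uniform. The
  density \<open>\<psi>\<close> averages in time, the density \<open>\<rho>\<close> in space.\<close>
locale averaged_orbit = mollified \<kappa> T c B \<eta> \<rho>
  for \<kappa> :: "real^'n::finite \<Rightarrow> real" and T c B \<eta> \<rho> +
  fixes u :: "real \<Rightarrow> real^'n \<Rightarrow> real" and H A C N \<epsilon> \<zeta> P :: real and E :: "real set"
    and \<psi> \<psi>' :: "real \<Rightarrow> real"
  assumes orbit_C: "\<And>s. 0 \<le> s \<Longrightarrow> s \<le> H + 1 \<Longrightarrow> u s \<in> C_weighted \<kappa>"
    and orbit_wbound: "\<And>s. 0 \<le> s \<Longrightarrow> s \<le> H + 1 \<Longrightarrow> wbound A (u s)"
    and orbit_lip: "\<And>r s x. \<lbrakk>0 \<le> r; r \<le> H + 1; 0 \<le> s; s \<le> H + 1\<rbrakk> \<Longrightarrow> \<bar>u r x - u s x\<bar> \<le> C * \<bar>r - s\<bar> / \<kappa> x"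
    and C: "0 \<le> C" and H: "0 \<le> H"
    and E: "closed E" "E \<subseteq> {0..H}" "0 \<in> E"
    and E_nonneg: "\<And>s x. s \<in> E \<Longrightarrow> 0 \<le> u s x"
    and E_bound: "\<And>s x. s \<in> E \<Longrightarrow> \<bar>u s x\<bar> \<le> N"
    and E_lip: "\<And>s x y. s \<in> E \<Longrightarrow> \<bar>u s x - u s y\<bar> \<le> N * norm (x - y)"
    and E_shift: "\<And>s h x y. \<lbrakk>s \<in> E; 0 \<le> h; h * N \<le> 1; norm y \<le> \<eta>\<rbrakk> \<Longrightarrow>
      T h (\<lambda>x. u s (x - y)) x \<le> u (s + h) (x - y) + \<epsilon> * h / \<kappa> x"
    and N: "1 \<le> N" and \<epsilon>: "0 < \<epsilon>"
    and \<zeta>: "0 < \<zeta>" "\<zeta> \<le> 1"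
    and \<psi>: "0 < P" "\<And>r. 0 \<le> \<psi> r" "\<And>r. \<psi> r \<le> P" "\<And>r. \<bar>\<psi>' r\<bar> \<le> P"
      "\<And>r. r \<notin> {0..\<zeta>} \<Longrightarrow> \<psi> r = 0" "\<And>r. r \<notin> {0..\<zeta>} \<Longrightarrow> \<psi>' r = 0"
      "continuous_on UNIV \<psi>" "continuous_on UNIV \<psi>'" "integrable lborel \<psi>" "(\<integral>r. \<psi> r \<partial>lborel) = 1"
      "\<And>r k. \<bar>\<psi> (r + k) - \<psi> r - k * \<psi>' r\<bar> \<le> P * k\<^sup>2"
begin

abbreviation "\<pi> \<equiv> last_visit E"

definition W :: "real \<Rightarrow> real^'n \<Rightarrow> real" where
  "W s z = (\<integral>r. u (\<pi> r) z * \<psi> (r - s) \<partial>lborel)"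

text \<open>The time derivative of \<open>W\<close>, the derivative being moved to the kernel.\<close>
definition W' :: "real \<Rightarrow> real^'n \<Rightarrow> real" where
  "W' s z = - (\<integral>r. u (\<pi> r) z * \<psi>' (r - s) \<partial>lborel)"

definition V :: "real \<Rightarrow> real^'n \<Rightarrow> real" where "V s = convolution (W s) \<rho>"

definition V' :: "real \<Rightarrow> real^'n \<Rightarrow> real" where "V' s = convolution (W' s) \<rho>"

lemma E0: "E \<subseteq> {0..}"
  using E(2) by auto

lemma pi_mem: "\<pi> r \<in> E"
  by (rule last_visit_mem[OF E(1) E0 E(3)])

lemma pi_range: "0 \<le> \<pi> r" "\<pi> r \<le> H"
  using pi_mem[of r] E(2) by auto

lemma A_nonneg: "0 \<le> A"
  using wbound_nonneg[OF orbit_wbound[of 0]] H by simp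

lemma pi_measurable [measurable]: "\<pi> \<in> borel_measurable borel"
  by (rule borel_measurable_mono[OF mono_last_visit[OF E(1) E0 E(3)]])

lemma psi_measurable [measurable]: "\<psi> \<in> borel_measurable borel" "\<psi>' \<in> borel_measurable borel"
  using \<psi> by (auto intro: borel_measurable_continuous_onI)

lemma sampled_measurable [measurable]: "(\<lambda>r. u (\<pi> r) z) \<in> borel_measurable borel"
proof -
  define cl where "cl = (\<lambda>r. max 0 (min H r))"
  have cl: "0 \<le> cl r" "cl r \<le> H + 1" for r using H by (auto simp: cl_def)
  have "(C / \<kappa> z)-lipschitz_on UNIV (\<lambda>r. u (cl r) z)"
  proof (rule lipschitz_onI)
    fix r s :: real
    have "\<bar>u (cl r) z - u (cl s) z\<bar> \<le> C * \<bar>cl r - cl s\<bar> / \<kappa> z" by (intro orbit_lip cl)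
    also have "\<dots> \<le> C * \<bar>r - s\<bar> / \<kappa> z"
      using C pos[of z] by (intro divide_right_mono mult_left_mono) (auto simp: cl_def)
    finally show "dist (u (cl r) z) (u (cl s) z) \<le> C / \<kappa> z * dist r s" by (simp add: dist_real_def)
  qed (use C pos[of z] in simp)
  then have "(\<lambda>r. u (cl r) z) \<in> borel_measurable borel"
    by (intro borel_measurable_continuous_onI lipschitz_on_continuous_on)
  then have "(\<lambda>r. u (cl (\<pi> r)) z) \<in> borel_measurable borel" by (rule measurable_compose[OF pi_measurable])
  moreover have "cl (\<pi> r) = \<pi> r" for r using pi_range[of r] by (simp add: cl_def)
  ultimately show ?thesis by simp
qed

lemma time_integral:
  assumes [measurable]: "f \<in> borel_measurable borel" "k \<in> borel_measurable borel"
    and "\<And>r. \<bar>f r\<bar> \<le> M" "\<And>r. \<bar>k r\<bar> \<le> Q" "\<And>r. r \<notin> {0..H} \<Longrightarrow> k r = 0"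
  shows "integrable lborel (\<lambda>r. f r * k r)" "\<bar>\<integral>r. f r * k r \<partial>lborel\<bar> \<le> M * Q * (2 * H)"
proof -
  have supp: "k r = 0" if "r \<notin> cball 0 H" for r using that by (intro assms(5)) auto
  have "measure lborel (cball (0::real) H) = 2 * H" using H by (simp add: cball_eq_atLeastAtMost)
  then show "integrable lborel (\<lambda>r. f r * k r)" "\<bar>\<integral>r. f r * k r \<partial>lborel\<bar> \<le> M * Q * (2 * H)"
    using integrable_compact_support[where c = 0 and r = H, OF assms(1-4) supp]
      integral_compact_support_bound[where c = 0 and r = H, OF assms(1-4) supp] by simp_all
qed

lemma sampled_bound: "\<bar>u (\<pi> r) z\<bar> \<le> N" "\<bar>u (\<pi> r) z\<bar> \<le> A / \<kappa> z"
  using E_bound[OF pi_mem] wboundD[OF orbit_wbound[of "\<pi> r"]] pi_range[of r] by auto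

lemma psi_shift_int: "integrable lborel (\<lambda>r. \<psi> (r - s))" "(\<integral>r. \<psi> (r - s) \<partial>lborel) = 1"
  using lborel_integrable_real_affine_iff[of 1 \<psi> "- s"] lborel_integral_real_affine[of 1 \<psi> "- s"] \<psi>(9,10) by simp_all

lemma psi_abs: "\<bar>\<psi> r\<bar> \<le> P"
  using \<psi>(2,3)[of r] by simp

lemma sampled_int:
  assumes "0 \<le> s" "s + 1 \<le> H"
  shows "integrable lborel (\<lambda>r. u (\<pi> r) z * \<psi> (r - s))" "integrable lborel (\<lambda>r. u (\<pi> r) z * \<psi>' (r - s))"
proof -
  have "r - s \<notin> {0..\<zeta>}" if "r \<notin> {0..H}" for r using that assms \<zeta> by auto
  then show "integrable lborel (\<lambda>r. u (\<pi> r) z * \<psi> (r - s))" "integrable lborel (\<lambda>r. u (\<pi> r) z * \<psi>' (r - s))"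
    by (intro time_integral(1)[OF _ _ sampled_bound(1), where Q = P]; use \<psi> psi_abs in \<open>auto\<close>)+
qed

lemma W_bounds:
  assumes "0 \<le> s" "s + 1 \<le> H"
  shows "\<bar>W s z\<bar> \<le> N" "\<bar>W s z\<bar> \<le> A / \<kappa> z" "\<bar>W s x - W s y\<bar> \<le> N * norm (x - y)" "0 \<le> W s z"
proof -
  show "\<bar>W s z\<bar> \<le> N" "\<bar>W s z\<bar> \<le> A / \<kappa> z" unfolding W_def
    by (rule average_abs_le[OF sampled_int(1)[OF assms] psi_shift_int(1) \<psi>(2) psi_shift_int(2)]; rule sampled_bound)+
  have "W s x - W s y = (\<integral>r. (u (\<pi> r) x - u (\<pi> r) y) * \<psi> (r - s) \<partial>lborel)"
    unfolding W_def left_diff_distrib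
    by (rule Bochner_Integration.integral_diff[symmetric]) (intro sampled_int assms)+
  moreover have "integrable lborel (\<lambda>r. (u (\<pi> r) x - u (\<pi> r) y) * \<psi> (r - s))"
    unfolding left_diff_distrib by (intro Bochner_Integration.integrable_diff sampled_int assms)
  then have "\<bar>\<integral>r. (u (\<pi> r) x - u (\<pi> r) y) * \<psi> (r - s) \<partial>lborel\<bar> \<le> N * norm (x - y)"
    by (rule average_abs_le[OF _ psi_shift_int(1) \<psi>(2) psi_shift_int(2)]) (intro E_lip pi_mem)
  ultimately show "\<bar>W s x - W s y\<bar> \<le> N * norm (x - y)" by simp
  show "0 \<le> W s z" unfolding W_def
    by (intro integral_nonneg_AE AE_I2 mult_nonneg_nonneg E_nonneg pi_mem \<psi>(2))
qed

lemma W'_bounds: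
  assumes "0 \<le> s" "s + 1 \<le> H"
  shows "\<bar>W' s z\<bar> \<le> N * P * (2 * H)" "\<bar>W' s z\<bar> \<le> (A * P * (2 * H)) / \<kappa> z"
    "\<bar>W' s x - W' s y\<bar> \<le> (N * norm (x - y)) * P * (2 * H)"
proof -
  have out: "\<psi>' (r - s) = 0" if "r \<notin> {0..H}" for r using that assms \<zeta> by (intro \<psi>(6)) auto
  show "\<bar>W' s z\<bar> \<le> N * P * (2 * H)"
    unfolding W'_def abs_minus_cancel
    by (rule time_integral(2)[OF _ _ sampled_bound(1)]) (use \<psi> out in auto)
  have "\<bar>W' s z\<bar> \<le> (A / \<kappa> z) * P * (2 * H)"
    unfolding W'_def abs_minus_cancel
    by (rule time_integral(2)[OF _ _ sampled_bound(2)]) (use \<psi> out in auto)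
  then show "\<bar>W' s z\<bar> \<le> (A * P * (2 * H)) / \<kappa> z" by simp
  have "W' s y - W' s x = (\<integral>r. (u (\<pi> r) x - u (\<pi> r) y) * \<psi>' (r - s) \<partial>lborel)"
    unfolding W'_def left_diff_distrib
    by (subst Bochner_Integration.integral_diff) (auto intro!: sampled_int assms)
  moreover have "\<bar>\<integral>r. (u (\<pi> r) x - u (\<pi> r) y) * \<psi>' (r - s) \<partial>lborel\<bar> \<le> (N * norm (x - y)) * P * (2 * H)"
    by (rule time_integral(2)) (use \<psi> out E_lip[OF pi_mem] in auto)
  ultimately show "\<bar>W' s x - W' s y\<bar> \<le> (N * norm (x - y)) * P * (2 * H)" by simp
qed

lemma W_taylor:
  assumes "0 \<le> s" "s + 1 \<le> H" "0 \<le> s + h" "s + h + 1 \<le> H"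
  shows "\<bar>W (s + h) z - W s z - h * W' s z\<bar> \<le> (A * P * (2 * H)) * h\<^sup>2 / \<kappa> z"
proof -
  have out: "\<psi> (r - s') = 0" if "r \<notin> {0..H}" "0 \<le> s'" "s' + 1 \<le> H" for r s' using that \<zeta> by (intro \<psi>(5)) auto
  have out': "\<psi>' (r - s) = 0" if "r \<notin> {0..H}" for r using that assms \<zeta> by (intro \<psi>(6)) auto
  have "W (s + h) z - W s z - h * W' s z =
      (\<integral>r. u (\<pi> r) z * \<psi> (r - (s + h)) - u (\<pi> r) z * \<psi> (r - s) + h * (u (\<pi> r) z * \<psi>' (r - s)) \<partial>lborel)"
    unfolding W_def W'_def
    by (subst Bochner_Integration.integral_add Bochner_Integration.integral_diff;
        auto intro!: Bochner_Integration.integrable_diff sampled_int assms integrable_mult_right)+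
  also have "\<dots> = (\<integral>r. u (\<pi> r) z * (\<psi> ((r - s) + - h) - \<psi> (r - s) - (- h) * \<psi>' (r - s)) \<partial>lborel)"
    by (rule Bochner_Integration.integral_cong) (auto simp: algebra_simps)
  finally have eq: "W (s + h) z - W s z - h * W' s z = \<dots>" .
  have "\<bar>\<integral>r. u (\<pi> r) z * (\<psi> ((r - s) + - h) - \<psi> (r - s) - (- h) * \<psi>' (r - s)) \<partial>lborel\<bar> \<le> (A / \<kappa> z) * (P * h\<^sup>2) * (2 * H)"
  proof (rule time_integral(2)[OF _ _ sampled_bound(2)])
    show "\<bar>\<psi> ((r - s) + - h) - \<psi> (r - s) - (- h) * \<psi>' (r - s)\<bar> \<le> P * h\<^sup>2" for r using \<psi>(11)[of "r - s" "- h"] by simp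
    show "\<psi> ((r - s) + - h) - \<psi> (r - s) - (- h) * \<psi>' (r - s) = 0" if "r \<notin> {0..H}" for r
      using out[OF that, of s] out[OF that, of "s + h"] out'[OF that] assms by (simp add: algebra_simps)
  qed measurable
  then show ?thesis unfolding eq by (simp add: algebra_simps)
qed

lemma W_cont: assumes "0 \<le> s" "s + 1 \<le> H" shows "continuous_on UNIV (W s)"
proof -
  have "N-lipschitz_on UNIV (W s)"
    using W_bounds(3)[OF assms] N by (auto intro!: lipschitz_onI simp: dist_norm)
  then show ?thesis by (rule lipschitz_on_continuous_on)
qed

lemma W'_cont: assumes "0 \<le> s" "s + 1 \<le> H" shows "continuous_on UNIV (W' s)"
proof -
  have "(N * P * (2 * H))-lipschitz_on UNIV (W' s)"
    using W'_bounds(3)[OF assms] N \<psi>(1) H by (auto intro!: lipschitz_onI simp: dist_norm mult_ac)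
  then show ?thesis by (rule lipschitz_on_continuous_on)
qed

lemma V_C_b_inf: assumes "0 \<le> s" "s + 1 \<le> H" shows "V s \<in> C_b_inf"
  unfolding V_def
  by (rule convolution_C_b_inf[OF borel_measurable_continuous_onI[OF W_cont[OF assms]] W_bounds(1)[OF assms] \<rho>(1)])

lemma V'_C: assumes "0 \<le> s" "s + 1 \<le> H" shows "V' s \<in> C_weighted \<kappa>"
proof -
  have "V' s \<in> C_b_inf" unfolding V'_def
    by (rule convolution_C_b_inf[OF borel_measurable_continuous_onI[OF W'_cont[OF assms]] W'_bounds(1)[OF assms] \<rho>(1)])
  then have "continuous_on UNIV (V' s)" by (auto simp: C_b_inf_def intro: C_inf_continuous)
  moreover have "wbound (c * (A * P * (2 * H))) (V' s)"
    unfolding wbound_def V'_def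
    by (intro allI convolution_wbound[OF W'_cont[OF assms] W'_bounds(1)[OF assms]])
      (use W'_bounds(2)[OF assms] in \<open>auto simp: wbound_def\<close>)
  ultimately show ?thesis unfolding C_weighted_iff by blast
qed

lemma V_wbound: assumes "0 \<le> s" "s + 1 \<le> H" shows "wbound (c * A) (V s)"
  unfolding wbound_def V_def
  by (intro allI convolution_wbound[OF W_cont[OF assms] W_bounds(1)[OF assms]])
    (use W_bounds(2)[OF assms] in \<open>auto simp: wbound_def\<close>)

lemma V_C: assumes "0 \<le> s" "s + 1 \<le> H" shows "V s \<in> C_weighted \<kappa>"
  unfolding C_weighted_iff using V_C_b_inf[OF assms] V_wbound[OF assms]
  by (auto simp: C_b_inf_def intro: C_inf_continuous)

lemma V_nonneg: assumes "0 \<le> s" "s + 1 \<le> H" shows "0 \<le> V s x"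
  unfolding V_def convolution_average(2)[OF W_cont[OF assms] W_bounds(1)[OF assms]]
  by (intro integral_nonneg_AE AE_I2 mult_nonneg_nonneg W_bounds assms \<rho>)

lemma V_taylor:
  assumes s: "0 \<le> s" "s + 1 \<le> H" and sh: "0 \<le> s + h" "s + h + 1 \<le> H"
  shows "\<bar>V (s + h) x - V s x - h * V' s x\<bar> \<le> c * (A * P * (2 * H)) * h\<^sup>2 / \<kappa> x"
proof -
  define F where "F = (\<lambda>z. W (s + h) z - W s z - h * W' s z)"
  have F: "continuous_on UNIV F" unfolding F_def
    by (intro continuous_intros W_cont W'_cont s sh)
  have F_b: "\<bar>F z\<bar> \<le> N + N + \<bar>h\<bar> * (N * P * (2 * H))" for z
  proof -
    have "\<bar>h * W' s z\<bar> \<le> \<bar>h\<bar> * (N * P * (2 * H))" unfolding abs_mult by (intro mult_left_mono W'_bounds s) auto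
    then show ?thesis using W_bounds(1)[OF s, of z] W_bounds(1)[OF sh, of z] unfolding F_def by linarith
  qed
  note WW = convolution_average[OF W_cont[OF s] W_bounds(1)[OF s]]
    convolution_average[OF W_cont[OF sh] W_bounds(1)[OF sh]] convolution_average[OF W'_cont[OF s] W'_bounds(1)[OF s]]
  have "V (s + h) x - V s x - h * V' s x = convolution F \<rho> x"
  proof -
    have "convolution F \<rho> x = (\<integral>y. W (s + h) (x - y) * \<rho> y - W s (x - y) * \<rho> y - h * (W' s (x - y) * \<rho> y) \<partial>lborel)"
      unfolding convolution_average(2)[OF F F_b] by (simp add: F_def algebra_simps)
    also have "\<dots> = V (s + h) x - V s x - h * V' s x"
      unfolding V_def V'_def WW(2) WW(4) WW(6)
      by (subst Bochner_Integration.integral_diff Bochner_Integration.integral_diff;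
        auto intro!: Bochner_Integration.integrable_diff WW(1,3,5) integrable_mult_right)+
    finally show ?thesis ..
  qed
  moreover have "\<bar>convolution F \<rho> x\<bar> \<le> c * ((A * P * (2 * H)) * h\<^sup>2) / \<kappa> x"
    by (rule convolution_wbound[OF F F_b]) (use W_taylor[OF s sh] in \<open>simp add: wbound_def F_def\<close>)
  ultimately show ?thesis by (simp add: mult.assoc)
qed

text \<open>Jensen's inequality moves \<open>T h\<close> inside the average over time, where \<open>T h (u (\<pi> r))\<close> is comparable to
  \<open>u (\<pi> r + h)\<close>. Replacing \<open>\<pi> r + h\<close> by \<open>\<pi> (r + h)\<close> costs, on average, a multiple of \<open>h\<close> times the missed
  measure, because the orbit is Lipschitz continuous in time.\<close>
lemma W_supersolution:
  assumes s: "0 \<le> s" and h: "0 \<le> h" "h * N \<le> 1" and sh: "s + h + 1 \<le> H" and y: "norm y \<le> \<eta>"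
  shows "T h (\<lambda>x. W s (x - y)) x \<le> W (s + h) (x - y) + (\<epsilon> + 3 * c * C * P * missed E H) * h / \<kappa> x"
proof -
  let ?M = "density lborel (\<lambda>r. \<psi> (r - s))"
  have s1: "s + 1 \<le> H" using sh h by simp
  have "h * 1 \<le> h * N" using h N by (intro mult_left_mono) auto
  then have h1: "h \<le> 1" using h by simp
  have y1: "norm y \<le> 1" using y \<eta> by simp
  define e where "e = (\<lambda>r. \<bar>h - (\<pi> (r + h) - \<pi> r)\<bar>)"
  have e_meas[measurable]: "e \<in> borel_measurable borel" unfolding e_def by measurable
  have e_le: "\<bar>e r\<bar> \<le> 1 + H" for r using pi_range[of r] pi_range[of "r + h"] h h1 by (auto simp: e_def)
  have out: "\<psi> (r - s) = 0" if "r \<notin> {0..H}" for r using that s s1 \<zeta> by (intro \<psi>(5)) auto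
  define b where "b = (\<lambda>r. u (\<pi> (r + h)) (x - y) + (c * C / \<kappa> x * e r + \<epsilon> * h / \<kappa> x))"
  have [measurable]: "(\<lambda>r. u (\<pi> (r + h)) (x - y)) \<in> borel_measurable borel"
    by (rule measurable_compose[OF _ sampled_measurable]) measurable
  have b_meas[measurable]: "b \<in> borel_measurable borel" unfolding b_def by measurable
  have i1: "integrable lborel (\<lambda>r. u (\<pi> (r + h)) (x - y) * \<psi> (r - s))"
    by (rule time_integral(1)[where M = N and Q = P]) (use sampled_bound psi_abs out in auto)
  have i2: "integrable lborel (\<lambda>r. e r * \<psi> (r - s))"
    by (rule time_integral(1)[where M = "1 + H" and Q = P]) (use e_le psi_abs out in auto)
  have b_eq: "b r * \<psi> (r - s) = u (\<pi> (r + h)) (x - y) * \<psi> (r - s) + (c * C / \<kappa> x * (e r * \<psi> (r - s)) + \<epsilon> * h / \<kappa> x * \<psi> (r - s))" for r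
    by (simp add: b_def algebra_simps)
  have i3: "integrable lborel (\<lambda>r. b r * \<psi> (r - s))"
    unfolding b_eq by (intro Bochner_Integration.integrable_add integrable_mult_right i1 i2 psi_shift_int)
  have I1: "(\<integral>r. u (\<pi> (r + h)) (x - y) * \<psi> (r - s) \<partial>lborel) = W (s + h) (x - y)"
    unfolding W_def
    using lborel_integral_real_affine[of 1 "\<lambda>r. u (\<pi> r) (x - y) * \<psi> (r - (s + h))" h] by (simp add: add.commute)
  have I2: "(\<integral>r. e r * \<psi> (r - s) \<partial>lborel) \<le> P * (3 * h * missed E H)"
  proof -
    note avg = last_visit_increment_average[OF E(1) E0 E(3), of "s + 1" h, folded e_def]
    have "(\<integral>r. e r * \<psi> (r - s) \<partial>lborel) \<le> (\<integral>r. P * (e r * indicator {0..s + 1} r) \<partial>lborel)"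
    proof (rule integral_mono[OF i2])
      show "integrable lborel (\<lambda>r. P * (e r * indicator {0..s + 1} r))"
        using avg(2) s h unfolding e_def by (intro integrable_mult_right) auto
      show "e r * \<psi> (r - s) \<le> P * (e r * indicator {0..s + 1} r)" for r
      proof (cases "r \<in> {0..s + 1}")
        case True
        have "e r * \<psi> (r - s) \<le> e r * P" by (rule mult_left_mono[OF \<psi>(3)]) (simp add: e_def)
        then show ?thesis using True by (simp add: mult.commute)
      next
        case False
        then have "\<psi> (r - s) = 0" using s \<zeta> by (intro \<psi>(5)) auto
        then show ?thesis using False by simp
      qed
    qed
    also have "\<dots> \<le> P * (3 * h * missed E (s + 1 + h))"
      using avg(1) s h \<psi>(1) unfolding e_def by (simp add: mult_left_mono)
    also have "\<dots> \<le> P * (3 * h * missed E H)"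
      using \<psi>(1) h s sh by (intro mult_left_mono mono_missed E) auto
    finally show ?thesis .
  qed
  have "T h (\<lambda>x. \<integral>r. u (\<pi> r) (x - y) \<partial>?M) x \<le> (\<integral>r. b r \<partial>?M)"
  proof (rule jensen_integral[where K = E and L = "c * C" and A = "c * A" and g = "\<lambda>p x. u p (x - y)"])
    show "finite_measure ?M" "measure ?M (space ?M) = 1"
      by (rule prob_density; use psi_shift_int \<psi>(2) in auto)+
    show "compact E" using E by (intro compact_Int_closed[of "{0..H}" E, simplified inf_absorb2[OF E(2)]]) auto
    show "(\<lambda>x. u p (x - y)) \<in> C_weighted \<kappa>" "wbound (c * A) (\<lambda>x. u p (x - y))" if "p \<in> E" for p
      using that E(2) by (auto intro!: C_translate wbound_translate orbit_C orbit_wbound y1)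
    show "u p (z - y) \<le> u q (z - y) + c * C * dist p q / \<kappa> z" if "p \<in> E" "q \<in> E" for p q z
    proof -
      have "\<bar>u p (z - y) - u q (z - y)\<bar> \<le> C * \<bar>p - q\<bar> / \<kappa> (z - y)"
        using that E(2) by (intro orbit_lip) auto
      also have "\<dots> \<le> c * (C * \<bar>p - q\<bar>) / \<kappa> z" using C by (intro inverse_translate y1) auto
      finally show ?thesis by (simp add: dist_real_def mult.assoc)
    qed
    have W_eq: "(\<integral>r. u (\<pi> r) (z - y) \<partial>?M) = W s (z - y)" for z
      unfolding W_def by (subst integral_density) (auto simp: \<psi>(2) mult.commute)
    show "(\<lambda>x. \<integral>r. u (\<pi> r) (x - y) \<partial>?M) \<in> C_weighted \<kappa>"
      unfolding W_eq by (rule C_translate[OF bounded_continuous_C[OF W_cont[OF s s1] W_bounds(1)[OF s s1]] y1])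
    show "wbound (c * A) (\<lambda>x. \<integral>r. u (\<pi> r) (x - y) \<partial>?M)"
      unfolding W_eq by (rule wbound_translate[OF _ y1]) (simp add: wbound_def W_bounds(2)[OF s s1])
    show "integrable ?M (\<lambda>r. u (\<pi> r) (z - y))" for z
      using sampled_int(1)[OF s s1, of "z - y"] by (subst integrable_density) (auto simp: \<psi>(2) mult.commute)
    show "integrable ?M b" using i3 by (subst integrable_density) (auto simp: \<psi>(2) mult.commute)
    show "AE r in ?M. T h (\<lambda>x. u (\<pi> r) (x - y)) x \<le> b r"
    proof (rule AE_I2)
      fix r
      have "T h (\<lambda>x. u (\<pi> r) (x - y)) x \<le> u (\<pi> r + h) (x - y) + \<epsilon> * h / \<kappa> x" by (rule E_shift[OF pi_mem h y])
      moreover have "\<bar>u (\<pi> r + h) (x - y) - u (\<pi> (r + h)) (x - y)\<bar> \<le> C * \<bar>\<pi> r + h - \<pi> (r + h)\<bar> / \<kappa> (x - y)"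
        using pi_range[of r] pi_range[of "r + h"] h h1 by (intro orbit_lip) auto
      moreover have "\<dots> \<le> c * (C * \<bar>\<pi> r + h - \<pi> (r + h)\<bar>) / \<kappa> x" using C by (intro inverse_translate y1) auto
      moreover have "\<bar>\<pi> r + h - \<pi> (r + h)\<bar> = e r" by (simp add: e_def)
      ultimately show "T h (\<lambda>x. u (\<pi> r) (x - y)) x \<le> b r" by (simp add: b_def)
    qed
  qed (use h C c_ge_1 pi_mem in auto)
  also have "(\<lambda>x. \<integral>r. u (\<pi> r) (x - y) \<partial>?M) = (\<lambda>x. W s (x - y))"
    unfolding W_def by (subst integral_density) (auto simp: \<psi>(2) mult.commute)
  also have "(\<integral>r. b r \<partial>?M) = (\<integral>r. b r * \<psi> (r - s) \<partial>lborel)"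
    by (subst integral_density) (auto simp: \<psi>(2) mult.commute)
  also have "\<dots> = W (s + h) (x - y) + (c * C / \<kappa> x * (\<integral>r. e r * \<psi> (r - s) \<partial>lborel) + \<epsilon> * h / \<kappa> x * 1)"
    unfolding b_eq I1[symmetric] psi_shift_int(2)[of s, symmetric]
    by (subst Bochner_Integration.integral_add Bochner_Integration.integral_add;
        auto intro!: Bochner_Integration.integrable_add i1 i2 psi_shift_int integrable_mult_right)+
  also have "\<dots> \<le> W (s + h) (x - y) + (c * C / \<kappa> x * (P * (3 * h * missed E H)) + \<epsilon> * h / \<kappa> x * 1)"
    using C c_ge_1 pos[of x] I2 by (intro add_left_mono add_right_mono mult_left_mono) auto
  also have "\<dots> = W (s + h) (x - y) + (\<epsilon> + 3 * c * C * P * missed E H) * h / \<kappa> x"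
    by (simp add: add_divide_distrib algebra_simps)
  finally show ?thesis .
qed


text \<open>Jensen's inequality again, now for the average over translations; \<open>W_supersolution\<close> holds for
  all translates with the same error.\<close>
lemma V_supersolution:
  assumes s: "0 \<le> s" and h: "0 \<le> h" "h * N \<le> 1" and sh: "s + h + 1 \<le> H"
  shows "T h (V s) x \<le> V (s + h) x + (\<epsilon> + 3 * c * C * P * missed E H) * h / \<kappa> x"
proof -
  let ?M = "density lborel \<rho>"
  define e where "e = (\<epsilon> + 3 * c * C * P * missed E H) * h / \<kappa> x"
  have s1: "s + 1 \<le> H" and sh0: "0 \<le> s + h" using sh h s by simp_all
  note W_s = convolution_average[OF W_cont[OF s s1] W_bounds(1)[OF s s1]]
  note W_sh = convolution_average[OF W_cont[OF sh0 sh] W_bounds(1)[OF sh0 sh]]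
  note [measurable] = C_c_inf_measurable[OF \<rho>(1)] borel_measurable_continuous_onI[OF W_cont[OF s s1]]
    borel_measurable_continuous_onI[OF W_cont[OF sh0 sh]]
  have V_eq: "(\<integral>y. W s (z - y) \<partial>?M) = V s z" for z
    unfolding V_def W_s(2) by (subst integral_density) (auto simp: \<rho>(2) mult.commute)
  have "T h (\<lambda>x. \<integral>y. W s (x - y) \<partial>?M) x \<le> (\<integral>y. W (s + h) (x - y) + e \<partial>?M)"
  proof (rule jensen_integral[where K = "cball 0 \<eta>" and L = "N * B" and A = "c * A" and g = "\<lambda>y x. W s (x - y)" and \<theta> = "\<lambda>y. y"])
    show fin: "finite_measure ?M" and mass: "measure ?M (space ?M) = 1"
      by (rule prob_density; use \<rho> in auto)+
    show "AE y in ?M. y \<in> cball 0 \<eta>"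
      using rho_supp by (subst AE_density) (auto simp: dist_norm)
    show "(\<lambda>x. W s (x - y)) \<in> C_weighted \<kappa>" "wbound (c * A) (\<lambda>x. W s (x - y))" if "y \<in> cball 0 \<eta>" for y
    proof -
      have y: "norm y \<le> 1" using that \<eta> by simp
      show "(\<lambda>x. W s (x - y)) \<in> C_weighted \<kappa>"
        by (rule C_translate[OF bounded_continuous_C[OF W_cont[OF s s1] W_bounds(1)[OF s s1]] y])
      show "wbound (c * A) (\<lambda>x. W s (x - y))"
        by (rule wbound_translate[OF _ y]) (simp add: wbound_def W_bounds(2)[OF s s1])
    qed
    show "W s (z - p) \<le> W s (z - q) + N * B * dist p q / \<kappa> z" for p q z
    proof -
      have "W s (z - p) \<le> W s (z - q) + N * norm ((z - p) - (z - q))" using W_bounds(3)[OF s s1, of "z - p" "z - q"] by linarith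
      also have "norm ((z - p) - (z - q)) = dist p q" by (simp add: dist_norm norm_minus_commute)
      also have "N * dist p q \<le> N * dist p q * (B / \<kappa> z)"
        using mult_left_mono[of 1 "B / \<kappa> z" "N * dist p q"] bound[of z] pos[of z] N by simp
      finally show ?thesis by (simp add: mult_ac)
    qed
    show "(\<lambda>x. \<integral>y. W s (x - y) \<partial>?M) \<in> C_weighted \<kappa>" "wbound (c * A) (\<lambda>x. \<integral>y. W s (x - y) \<partial>?M)"
      unfolding V_eq by (rule V_C[OF s s1], rule V_wbound[OF s s1])
    show "integrable ?M (\<lambda>y. W s (z - y))" for z
      using W_s(1)[of z] by (subst integrable_density) (auto simp: \<rho>(2) mult.commute)
    interpret finite_measure ?M by (rule fin)
    show "integrable ?M (\<lambda>y. W (s + h) (x - y) + e)"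
    proof (rule Bochner_Integration.integrable_add)
      show "integrable ?M (\<lambda>y. W (s + h) (x - y))"
        using W_sh(1)[of x] by (subst integrable_density) (auto simp: \<rho>(2) mult.commute)
    qed simp
    show "AE y in ?M. T h (\<lambda>x. W s (x - y)) x \<le> W (s + h) (x - y) + e"
      using W_supersolution[OF s h sh] rho_supp unfolding e_def by (subst AE_density) auto
  qed (use h N B_pos in auto)
  also have "(\<lambda>x. \<integral>y. W s (x - y) \<partial>?M) = V s" using V_eq by (rule ext)
  also have "(\<integral>y. W (s + h) (x - y) + e \<partial>?M) = (\<integral>y. \<rho> y *\<^sub>R (W (s + h) (x - y) + e) \<partial>lborel)"
    by (rule integral_density) (auto simp: \<rho>(2))
  also have "\<dots> = (\<integral>y. W (s + h) (x - y) * \<rho> y + e * \<rho> y \<partial>lborel)"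
    by (rule Bochner_Integration.integral_cong) (auto simp: algebra_simps)
  also have "\<dots> = V (s + h) x + e"
    unfolding V_def W_sh(2) by (subst Bochner_Integration.integral_add) (auto intro!: W_sh(1) simp: \<rho>)
  finally show ?thesis unfolding e_def .
qed

lemma V_lipschitz:
  assumes "0 \<le> s" "s + 1 \<le> H" "0 \<le> r" "r + 1 \<le> H"
  shows "\<bar>V r x - V s x\<bar> \<le> (c * (A * P * (2 * H)) * (1 + H)) * \<bar>r - s\<bar> / \<kappa> x"
proof -
  define Q where "Q = c * (A * P * (2 * H))"
  have Q: "0 \<le> Q" using c_ge_1 A_nonneg \<psi>(1) H by (simp add: Q_def)
  define h where "h = r - s"
  have h: "\<bar>h\<bar> \<le> H" using assms by (auto simp: h_def)
  have "\<bar>V (s + h) x - V s x - h * V' s x\<bar> \<le> Q * h\<^sup>2 / \<kappa> x"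
    unfolding Q_def by (rule V_taylor) (use assms in \<open>auto simp: h_def\<close>)
  moreover have "\<bar>V' s x\<bar> \<le> Q / \<kappa> x"
    unfolding V'_def Q_def
    by (rule convolution_wbound[OF W'_cont[OF assms(1,2)] W'_bounds(1)[OF assms(1,2)]])
      (use W'_bounds(2)[OF assms(1,2)] in \<open>auto simp: wbound_def\<close>)
  then have "\<bar>h * V' s x\<bar> \<le> \<bar>h\<bar> * (Q / \<kappa> x)" unfolding abs_mult by (intro mult_left_mono) auto
  moreover have "Q * h\<^sup>2 / \<kappa> x \<le> \<bar>h\<bar> * (Q / \<kappa> x) * H"
  proof -
    have "Q * h\<^sup>2 / \<kappa> x = \<bar>h\<bar> * (Q / \<kappa> x) * \<bar>h\<bar>" by (simp add: power2_eq_square flip: abs_mult)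
    also have "\<dots> \<le> \<bar>h\<bar> * (Q / \<kappa> x) * H" using Q pos[of x] h by (intro mult_left_mono) auto
    finally show ?thesis .
  qed
  ultimately have "\<bar>V (s + h) x - V s x\<bar> \<le> \<bar>h\<bar> * (Q / \<kappa> x) + \<bar>h\<bar> * (Q / \<kappa> x) * H" by linarith
  then show ?thesis unfolding Q_def[symmetric] by (simp add: h_def algebra_simps add_divide_distrib)
qed

lemma W_close:
  assumes s: "0 \<le> s" "s + 1 \<le> H"
  shows "\<bar>W s z - u s z\<bar> \<le> C * (\<zeta> + missed E H) / \<kappa> z"
proof -
  have int: "integrable lborel (\<lambda>r. (u (\<pi> r) z - u s z) * \<psi> (r - s))"
    unfolding left_diff_distrib
    by (intro Bochner_Integration.integrable_diff sampled_int s integrable_mult_right psi_shift_int)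
  have "W s z - u s z = (\<integral>r. (u (\<pi> r) z - u s z) * \<psi> (r - s) \<partial>lborel)"
    unfolding left_diff_distrib W_def
    by (subst Bochner_Integration.integral_diff) (auto intro!: sampled_int s integrable_mult_right psi_shift_int simp: psi_shift_int)
  also have "\<bar>\<dots>\<bar> \<le> C * (\<zeta> + missed E H) / \<kappa> z"
  proof (rule average_abs_le[OF int psi_shift_int(1) \<psi>(2) psi_shift_int(2)])
    fix r assume "\<psi> (r - s) \<noteq> 0"
    then have r: "s \<le> r" "r \<le> s + \<zeta>" using \<psi>(5)[of "r - s"] by (cases "r - s \<in> {0..\<zeta>}"; auto)+
    have "r - \<pi> r \<le> missed E r" "\<pi> r \<le> r" using last_visit_lag[OF E(1) E0 E(3)] last_visit_le[OF E(1) E0 E(3)] r s by auto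
    moreover have "missed E r \<le> missed E H" using r s \<zeta> by (intro mono_missed E) auto
    ultimately have "\<bar>\<pi> r - s\<bar> \<le> \<zeta> + missed E H" using r missed_nonneg[of E H] \<zeta> by (auto simp: abs_le_iff)
    then have "C * \<bar>\<pi> r - s\<bar> / \<kappa> z \<le> C * (\<zeta> + missed E H) / \<kappa> z"
      using C pos[of z] by (intro divide_right_mono mult_left_mono) auto
    moreover have "\<bar>u (\<pi> r) z - u s z\<bar> \<le> C * \<bar>\<pi> r - s\<bar> / \<kappa> z"
      using pi_range[of r] s by (intro orbit_lip) auto
    ultimately show "\<bar>u (\<pi> r) z - u s z\<bar> \<le> C * (\<zeta> + missed E H) / \<kappa> z" by linarith
  qed
  finally show ?thesis .
qed

lemma V_close:
  assumes s: "0 \<le> s" "s + 1 \<le> H" and \<Lambda>: "0 \<le> \<Lambda>" "\<And>x y. \<bar>u s x - u s y\<bar> \<le> \<Lambda> * norm (x - y)"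
  shows "\<bar>V s x - u s x\<bar> \<le> (c * (C * (\<zeta> + missed E H)) + \<Lambda> * \<eta> * B) / \<kappa> x"
proof -
  note W_s = convolution_average[OF W_cont[OF s] W_bounds(1)[OF s]]
  have int: "integrable lborel (\<lambda>y. (W s (x - y) - u s x) * \<rho> y)"
    unfolding left_diff_distrib by (intro Bochner_Integration.integrable_diff W_s integrable_mult_right \<rho>)
  have "V s x - u s x = (\<integral>y. (W s (x - y) - u s x) * \<rho> y \<partial>lborel)"
    unfolding left_diff_distrib V_def W_s(2)
    by (subst Bochner_Integration.integral_diff) (auto intro!: W_s integrable_mult_right \<rho> simp: \<rho>)
  also have "\<bar>\<dots>\<bar> \<le> (c * (C * (\<zeta> + missed E H)) + \<Lambda> * \<eta> * B) / \<kappa> x"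
  proof (rule average_abs_le[OF int \<rho>(4,2,5)])
    fix y assume "\<rho> y \<noteq> 0"
    then have y: "norm y \<le> \<eta>" by (rule rho_supp)
    have "\<bar>W s (x - y) - u s (x - y)\<bar> \<le> C * (\<zeta> + missed E H) / \<kappa> (x - y)" by (rule W_close[OF s])
    also have "\<dots> \<le> c * (C * (\<zeta> + missed E H)) / \<kappa> x"
      using C \<zeta> missed_nonneg[of E H] y \<eta> by (intro inverse_translate) auto
    finally have 1: "\<bar>W s (x - y) - u s (x - y)\<bar> \<le> c * (C * (\<zeta> + missed E H)) / \<kappa> x" .
    have "\<bar>u s (x - y) - u s x\<bar> \<le> \<Lambda> * norm y" using \<Lambda>(2)[of "x - y" x] by simp
    also have "\<dots> \<le> \<Lambda> * \<eta>" using y \<Lambda>(1) by (intro mult_left_mono) auto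
    also have "\<dots> \<le> \<Lambda> * \<eta> * (B / \<kappa> x)"
      using mult_left_mono[of 1 "B / \<kappa> x" "\<Lambda> * \<eta>"] bound[of x] pos[of x] \<Lambda> \<eta> by simp
    finally show "\<bar>W s (x - y) - u s x\<bar> \<le> (c * (C * (\<zeta> + missed E H)) + \<Lambda> * \<eta> * B) / \<kappa> x"
      using 1 by (simp add: add_divide_distrib)
  qed
  finally show ?thesis .
qed

end

section \<open>Times of uniform regularity\<close>

context convex_semigroup
begin

text \<open>Short increments of an orbit are images of increments at time \<open>0\<close> under locally Lipschitz
  operators; long ones are controlled by the bound on the orbit.\<close>
lemma domain_orbit:
  assumes f: "f \<in> C_weighted \<kappa>" and gen: "has_generator_value \<kappa> S f a" and H: "0 \<le> H"
  shows "\<exists>A C. 0 \<le> C \<and> (\<forall>s. 0 \<le> s \<and> s \<le> H \<longrightarrow> wbound A (S s f)) \<and>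
    (\<forall>r s x. 0 \<le> r \<and> r \<le> H \<and> 0 \<le> s \<and> s \<le> H \<longrightarrow> \<bar>S r f x - S s f x\<bar> \<le> C * \<bar>r - s\<bar> / \<kappa> x)"
proof -
  obtain M where M: "0 < M" "wbound M f" using f by (rule C_obtain)
  obtain A where A: "0 < A" "\<And>t f. \<lbrakk>0 \<le> t; t \<le> H; f \<in> C_weighted \<kappa>; wbound M f\<rbrakk> \<Longrightarrow> wbound A (S t f)"
    using local_bound[of M H] M H by auto
  have SA: "wbound A (S s f)" if "0 \<le> s" "s \<le> H" for s using that f M by (intro A)
  obtain L where L: "lipschitz_bound (M + A) H L" using local_lipschitz[of "M + A" H] M A H by auto
  obtain L0 h0 where L0: "0 < L0" "0 < h0" "\<And>h x. 0 \<le> h \<Longrightarrow> h \<le> h0 \<Longrightarrow> \<bar>S h f x - f x\<bar> \<le> L0 * h / \<kappa> x"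
    by (rule domain_lipschitz[OF gen f]) (rule that)
  define C where "C = L * L0 + 2 * A / h0"
  have parts: "0 < L * L0" "0 < 2 * A / h0" using lipschitz_bound_pos[OF L] L0 A(1) by simp_all
  have main: "\<bar>S r f x - S s f x\<bar> \<le> C * (s - r) / \<kappa> x" if "0 \<le> r" "r \<le> s" "s \<le> H" for r s x
  proof (cases "s - r \<le> h0")
    case True
    define g where "g = S (s - r) f"
    have s_eq: "S s f = S r g" using add_time[of r "s - r" f] that f by (simp add: g_def)
    have g: "g \<in> C_weighted \<kappa>" "wbound (M + A) g" "wbound (M + A) f"
      using SA[of "s - r"] M A(1) that f by (auto simp: g_def intro: mem wbound_mono)
    have d: "\<bar>g y - f y\<bar> \<le> (L0 * (s - r)) / \<kappa> y" for y unfolding g_def using that True by (intro L0) auto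
    have "S r g x \<le> S r f x + L * (L0 * (s - r)) / \<kappa> x"
    proof (rule lipschitz_boundD[OF L])
      show "g y \<le> f y + (L0 * (s - r)) / \<kappa> y" for y using d[of y] by linarith
    qed (use that g f L0 in auto)
    moreover have "S r f x \<le> S r g x + L * (L0 * (s - r)) / \<kappa> x"
    proof (rule lipschitz_boundD[OF L])
      show "f y \<le> g y + (L0 * (s - r)) / \<kappa> y" for y using d[of y] by linarith
    qed (use that g f L0 in auto)
    ultimately have "\<bar>S r f x - S s f x\<bar> \<le> L * L0 * (s - r) / \<kappa> x" unfolding s_eq by (simp add: mult.assoc)
    also have "\<dots> \<le> C * (s - r) / \<kappa> x"
      using parts pos[of x] that by (intro divide_right_mono mult_right_mono) (auto simp: C_def)
    finally show ?thesis .
  next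
    case False
    have "\<bar>S r f x - S s f x\<bar> \<le> 2 * A / \<kappa> x"
      using wboundD[OF SA[of r], of x] wboundD[OF SA[of s], of x] that by simp
    also have "2 * A \<le> 2 * A / h0 * (s - r)"
      using mult_left_mono[of 1 "(s - r) / h0" "2 * A"] False A(1) L0(2) by simp
    also have "\<dots> \<le> C * (s - r)" using parts that by (intro mult_right_mono) (auto simp: C_def)
    finally show ?thesis using pos[of x] by (simp add: divide_right_mono)
  qed
  have "\<bar>S r f x - S s f x\<bar> \<le> C * \<bar>r - s\<bar> / \<kappa> x" if "0 \<le> r" "r \<le> H" "0 \<le> s" "s \<le> H" for r s x
    using main[of r s x] main[of s r x] that by (cases "r \<le> s") (auto simp: abs_minus_commute)
  moreover have "0 \<le> C" using parts by (simp add: C_def)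
  ultimately show ?thesis using SA by blast
qed

end

context translation_semigroup
begin

text \<open>The bound \<open>N\<close> controls at once the size and the Lipschitz constant of \<open>u s\<close> and, through its
  reciprocal, the range of the translations and of the time increments.\<close>
definition regular_times :: "(real \<Rightarrow> real^'n \<Rightarrow> real) \<Rightarrow> real \<Rightarrow> real \<Rightarrow> real \<Rightarrow> real set" where
  "regular_times u H \<epsilon> N = {s \<in> {0..H}. (\<forall>x. \<bar>u s x\<bar> \<le> N) \<and> (\<forall>x y. \<bar>u s x - u s y\<bar> \<le> N * norm (x - y)) \<and>
     (\<forall>h y x. 0 \<le> h \<and> h * N \<le> 1 \<and> norm y * N \<le> 1 \<longrightarrow>
        T h (\<lambda>x. u s (x - y)) x \<le> u (s + h) (x - y) + \<epsilon> * h / \<kappa> x)}"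

lemma regular_times_mono:
  assumes "0 \<le> M" "M \<le> N" shows "regular_times u H \<epsilon> M \<subseteq> regular_times u H \<epsilon> N"
proof
  fix s assume s: "s \<in> regular_times u H \<epsilon> M"
  have "\<bar>u s x\<bar> \<le> N" for x using s assms by (auto simp: regular_times_def intro: order_trans)
  moreover have "\<bar>u s x - u s y\<bar> \<le> N * norm (x - y)" for x y
  proof -
    have "\<bar>u s x - u s y\<bar> \<le> M * norm (x - y)" using s by (simp add: regular_times_def)
    also have "\<dots> \<le> N * norm (x - y)" using assms by (intro mult_right_mono) auto
    finally show ?thesis .
  qed
  moreover have "T h (\<lambda>x. u s (x - y)) x \<le> u (s + h) (x - y) + \<epsilon> * h / \<kappa> x"
    if "0 \<le> h" "h * N \<le> 1" "norm y * N \<le> 1" for h y x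
  proof -
    have "h * M \<le> 1" using mult_left_mono[OF assms(2) that(1)] that(2) by linarith
    moreover have "norm y * M \<le> 1" using mult_left_mono[OF assms(2), of "norm y"] that(3) by simp
    ultimately show ?thesis using s that(1) by (simp add: regular_times_def)
  qed
  ultimately show "s \<in> regular_times u H \<epsilon> N" using s by (simp add: regular_times_def)
qed

text \<open>Each of the defining inequalities survives limits, since the orbit is Lipschitz continuous in time
  and \<open>T h\<close> is locally Lipschitz continuous.\<close>
lemma regular_times_closed:
  assumes orbit_C: "\<And>s. 0 \<le> s \<Longrightarrow> s \<le> H + 1 \<Longrightarrow> u s \<in> C_weighted \<kappa>"
    and orbit_wbound: "\<And>s. 0 \<le> s \<Longrightarrow> s \<le> H + 1 \<Longrightarrow> wbound A (u s)"
    and orbit_lip: "\<And>r s x. \<lbrakk>0 \<le> r; r \<le> H + 1; 0 \<le> s; s \<le> H + 1\<rbrakk> \<Longrightarrow> \<bar>u r x - u s x\<bar> \<le> C * \<bar>r - s\<bar> / \<kappa> x"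
    and C: "0 \<le> C" and N: "1 \<le> N"
  shows "closed (regular_times u H \<epsilon> N)"
  unfolding closed_sequential_limits
proof (intro allI impI)
  fix \<sigma> l assume "(\<forall>n. \<sigma> n \<in> regular_times u H \<epsilon> N) \<and> \<sigma> \<longlonglongrightarrow> l"
  then have \<sigma>: "\<And>n. \<sigma> n \<in> regular_times u H \<epsilon> N" and lim: "\<sigma> \<longlonglongrightarrow> l" by auto
  have \<sigma>H: "\<sigma> n \<in> {0..H}" for n using \<sigma>[of n] by (simp add: regular_times_def)
  have lH: "l \<in> {0..H}" by (rule closed_sequentially[OF closed_atLeastAtMost \<sigma>H lim])
  have A: "0 \<le> A" using wbound_nonneg[OF orbit_wbound[of 0]] lH by simp
  have conv: "(\<lambda>n. u (\<sigma> n + h) x) \<longlonglongrightarrow> u (l + h) x" if h: "0 \<le> h" "h \<le> 1" for h x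
  proof (rule LIM_zero_cancel, rule Lim_null_comparison)
    show "\<forall>\<^sub>F n in sequentially. norm (u (\<sigma> n + h) x - u (l + h) x) \<le> C * \<bar>\<sigma> n - l\<bar> / \<kappa> x"
      using orbit_lip[of "\<sigma> n + h" "l + h" x for n] \<sigma>H lH h by (intro always_eventually) (auto simp: add_mono)
    have "(\<lambda>n. C * \<bar>\<sigma> n - l\<bar> / \<kappa> x) \<longlonglongrightarrow> C * \<bar>l - l\<bar> / \<kappa> x"
      by (intro tendsto_intros lim) (use pos[of x] in simp)
    then show "(\<lambda>n. C * \<bar>\<sigma> n - l\<bar> / \<kappa> x) \<longlonglongrightarrow> 0" by simp
  qed
  have conv0: "(\<lambda>n. u (\<sigma> n) x) \<longlonglongrightarrow> u l x" for x using conv[of 0] by simp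
  have "\<bar>u l x\<bar> \<le> N" for x
    by (rule LIMSEQ_le_const2[OF tendsto_rabs[OF conv0]]) (use \<sigma> in \<open>auto simp: regular_times_def\<close>)
  moreover have "\<bar>u l x - u l y\<bar> \<le> N * norm (x - y)" for x y
    by (rule LIMSEQ_le_const2[OF tendsto_rabs[OF tendsto_diff[OF conv0 conv0]]]) (use \<sigma> in \<open>auto simp: regular_times_def\<close>)
  moreover have "T h (\<lambda>x. u l (x - y)) x \<le> u (l + h) (x - y) + \<epsilon> * h / \<kappa> x"
    if h: "0 \<le> h" "h * N \<le> 1" and y: "norm y * N \<le> 1" for h y x
  proof -
    have h1: "h \<le> 1" using mult_left_mono[OF N h(1)] h(2) by simp
    have y1: "norm y \<le> 1" using mult_left_mono[OF N, of "norm y"] y by simp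
    obtain K where K: "lipschitz_bound (c * A) 1 K" using local_lipschitz[of "c * A" 1] A c_ge_1 by auto
    have "T h (\<lambda>x. u l (x - y)) x \<le> (u (\<sigma> n + h) (x - y) + \<epsilon> * h / \<kappa> x) + K * (c * (C * \<bar>\<sigma> n - l\<bar>)) / \<kappa> x" for n
    proof -
      have "T h (\<lambda>x. u l (x - y)) x \<le> T h (\<lambda>x. u (\<sigma> n) (x - y)) x + K * (c * (C * \<bar>\<sigma> n - l\<bar>)) / \<kappa> x"
      proof (rule lipschitz_boundD[OF K h(1) h1])
        show "(\<lambda>x. u l (x - y)) \<in> C_weighted \<kappa>" "(\<lambda>x. u (\<sigma> n) (x - y)) \<in> C_weighted \<kappa>"
          using \<sigma>H[of n] lH by (auto intro!: C_translate orbit_C y1)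
        show "wbound (c * A) (\<lambda>x. u l (x - y))" "wbound (c * A) (\<lambda>x. u (\<sigma> n) (x - y))"
          using \<sigma>H[of n] lH by (auto intro!: wbound_translate orbit_wbound y1)
        show "0 \<le> c * (C * \<bar>\<sigma> n - l\<bar>)" using C c_ge_1 by simp
        fix z
        have "\<bar>u l (z - y) - u (\<sigma> n) (z - y)\<bar> \<le> C * \<bar>l - \<sigma> n\<bar> / \<kappa> (z - y)"
          using \<sigma>H[of n] lH by (intro orbit_lip) auto
        also have "\<dots> \<le> c * (C * \<bar>l - \<sigma> n\<bar>) / \<kappa> z" using C by (intro inverse_translate y1) auto
        finally show "u l (z - y) \<le> u (\<sigma> n) (z - y) + c * (C * \<bar>\<sigma> n - l\<bar>) / \<kappa> z"
          by (simp add: abs_minus_commute abs_le_iff)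
      qed
      moreover have "T h (\<lambda>x. u (\<sigma> n) (x - y)) x \<le> u (\<sigma> n + h) (x - y) + \<epsilon> * h / \<kappa> x"
        using \<sigma>[of n] h y by (simp add: regular_times_def)
      ultimately show ?thesis by linarith
    qed
    moreover have "(\<lambda>n. (u (\<sigma> n + h) (x - y) + \<epsilon> * h / \<kappa> x) + K * (c * (C * \<bar>\<sigma> n - l\<bar>)) / \<kappa> x) \<longlonglongrightarrow>
        (u (l + h) (x - y) + \<epsilon> * h / \<kappa> x) + K * (c * (C * \<bar>l - l\<bar>)) / \<kappa> x"
      by (intro tendsto_intros conv lim h h1) (use pos[of x] in simp)
    ultimately have "T h (\<lambda>x. u l (x - y)) x \<le> (u (l + h) (x - y) + \<epsilon> * h / \<kappa> x) + K * (c * (C * \<bar>l - l\<bar>)) / \<kappa> x"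
      by (intro LIMSEQ_le_const) auto
    then show ?thesis by simp
  qed
  ultimately show "l \<in> regular_times u H \<epsilon> N" using lH by (simp add: regular_times_def)
qed

end

text \<open>Continuity of Lebesgue measure along the decreasing sets of missed times.\<close>
lemma missed_tendsto_0:
  assumes E: "\<And>n. closed (E n)" "\<And>m n. m \<le> n \<Longrightarrow> E m \<subseteq> E n" and cover: "{0..H} \<subseteq> (\<Union>n::nat. E n)"
  shows "(\<lambda>n. missed (E n) H) \<longlonglongrightarrow> 0"
proof -
  have [measurable]: "E n \<in> sets borel" for n using E(1) by (rule borel_closed)
  have "(\<lambda>n. measure lborel ({0..H} - E n)) \<longlonglongrightarrow> measure lborel (\<Inter>n. {0..H} - E n)"
  proof (rule Lim_measure_decseq)
    show "decseq (\<lambda>n. {0..H} - E n)" using E(2) by (auto simp: decseq_def)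
    show "emeasure lborel ({0..H} - E n) \<noteq> \<infinity>" for n
    proof -
      have "emeasure lborel ({0..H} - E n) \<le> emeasure lborel {0..H}" by (rule emeasure_mono) auto
      then show ?thesis by (auto simp: emeasure_lborel_Icc_eq top_unique)
    qed
  qed auto
  moreover have "(\<Inter>n. {0..H} - E n) = {}" using cover by auto
  ultimately show ?thesis unfolding missed_def by (simp only: measure_empty)
qed


section \<open>The comparison theorem\<close>

lemma gen_domain_generator: "f \<in> gen_domain \<kappa> S \<Longrightarrow> has_generator_value \<kappa> S f (generator \<kappa> S f)"
  unfolding gen_domain_def using generator_eqI by auto

locale generator_comparison = translation_semigroup \<kappa> T c B + S: convex_semigroup \<kappa> S
  for \<kappa> :: "real^'n::finite \<Rightarrow> real" and T c B S +
  fixes \<phi> :: "nat \<Rightarrow> real^'n \<Rightarrow> real"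
  assumes phi_smooth: "\<And>n. \<phi> n \<in> C_c_inf"
    and phi_range: "\<And>n x. 0 \<le> \<phi> n x \<and> \<phi> n x \<le> 1"
    and phi_one: "\<And>n x. norm x \<le> real n \<Longrightarrow> \<phi> n x = 1"
    and T_shift: "\<And>f \<epsilon>. \<lbrakk>f \<in> Lip_set \<kappa> T \<inter> Lip_b; \<forall>x. 0 \<le> f x; 0 < \<epsilon>\<rbrakk> \<Longrightarrow>
      \<exists>\<delta> t0. 0 < \<delta> \<and> 0 < t0 \<and> (\<forall>t\<in>{0..t0}. \<forall>x. norm x \<le> \<delta> \<longrightarrow>
        T t (shift x f) \<le> (\<lambda>y. shift x (T t f) y + \<epsilon> * t / \<kappa> y))"
    and T_Lip: "\<And>t f. \<lbrakk>0 \<le> t; f \<in> Lip_b\<rbrakk> \<Longrightarrow> T t f \<in> Lip_b"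
    and domains: "C_c_inf \<subseteq> gen_domain \<kappa> S \<inter> gen_domain \<kappa> T"
    and B_bounded: "\<And>f. \<lbrakk>f \<in> C_b_inf \<inter> Lip_set_pos \<kappa> T; \<forall>x. 0 \<le> f x\<rbrakk> \<Longrightarrow>
      (SUP n. wnorm \<kappa> (pos_part (generator \<kappa> T (\<lambda>x. f x * \<phi> n x)))) < \<infinity>"
    and A_le_B: "\<And>f. f \<in> C_c_inf \<Longrightarrow> generator \<kappa> S f \<le> generator \<kappa> T f"
begin

lemma C_c_inf_generators:
  assumes "f \<in> C_c_inf"
  shows "f \<in> C_weighted \<kappa>" "has_generator_value \<kappa> S f (generator \<kappa> S f)" "has_generator_value \<kappa> T f (generator \<kappa> T f)"
proof -
  have S: "f \<in> gen_domain \<kappa> S" and T: "f \<in> gen_domain \<kappa> T" using assms domains by auto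
  show "f \<in> C_weighted \<kappa>" using S by (simp add: gen_domain_def)
  show "has_generator_value \<kappa> S f (generator \<kappa> S f)" by (rule gen_domain_generator[OF S])
  show "has_generator_value \<kappa> T f (generator \<kappa> T f)" by (rule gen_domain_generator[OF T])
qed

lemma Lip_set_from_bound:
  assumes f: "f \<in> C_weighted \<kappa>" and le: "\<And>h x. 0 < h \<Longrightarrow> h \<le> h0 \<Longrightarrow> \<bar>T h f x - f x\<bar> \<le> M * h / \<kappa> x" and h0: "0 < h0"
  shows "f \<in> Lip_set \<kappa> T"
proof -
  have "limsup (\<lambda>n. wnorm \<kappa> (diff_quot T (h n) f)) < \<infinity>" if h: "pos_null_seq h" for h
  proof -
    have "\<forall>\<^sub>F n in sequentially. h n < h0" using h h0 unfolding pos_null_seq_def by (auto intro: order_tendstoD)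
    then have "\<forall>\<^sub>F n in sequentially. wnorm \<kappa> (diff_quot T (h n) f) \<le> ereal M"
    proof eventually_elim
      case (elim n)
      have hn: "0 < h n" using h by (simp add: pos_null_seq_def)
      have "\<bar>T (h n) f x - f x\<bar> / h n \<le> M / \<kappa> x" for x
        using le[OF hn less_imp_le[OF elim], of x] hn by (simp add: divide_simps mult_ac split: if_splits)
      then show ?case unfolding wnorm_le_iff wbound_def diff_quot_def using hn by simp
    qed
    then have "limsup (\<lambda>n. wnorm \<kappa> (diff_quot T (h n) f)) \<le> ereal M" by (rule Limsup_bounded)
    then show ?thesis by (rule le_less_trans) simp
  qed
  with f show ?thesis by (simp add: Lip_set_def)
qed

lemma Lip_set_pos_from_bound:
  assumes f: "f \<in> C_weighted \<kappa>" and le: "\<And>h x. 0 < h \<Longrightarrow> h \<le> h0 \<Longrightarrow> T h f x \<le> f x + M * h / \<kappa> x"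
    and h0: "0 < h0" and M: "0 \<le> M"
  shows "f \<in> Lip_set_pos \<kappa> T"
proof -
  have "limsup (\<lambda>n. wnorm \<kappa> (pos_part (diff_quot T (h n) f))) < \<infinity>" if h: "pos_null_seq h" for h
  proof -
    have "\<forall>\<^sub>F n in sequentially. h n < h0" using h h0 unfolding pos_null_seq_def by (auto intro: order_tendstoD)
    then have "\<forall>\<^sub>F n in sequentially. wnorm \<kappa> (pos_part (diff_quot T (h n) f)) \<le> ereal M"
    proof eventually_elim
      case (elim n)
      have hn: "0 < h n" using h by (simp add: pos_null_seq_def)
      have "(T (h n) f x - f x) / h n \<le> M / \<kappa> x" for x
      proof -
        have "T (h n) f x - f x \<le> (M / \<kappa> x) * h n" using le[OF hn less_imp_le[OF elim], of x] by simp
        then show ?thesis using hn by (simp add: divide_le_eq)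
      qed
      moreover have "0 \<le> M / \<kappa> x" for x using M pos[of x] by simp
      ultimately show ?case unfolding wnorm_le_iff wbound_def diff_quot_def pos_part_def by simp
    qed
    then have "limsup (\<lambda>n. wnorm \<kappa> (pos_part (diff_quot T (h n) f))) \<le> ereal M" by (rule Limsup_bounded)
    then show ?thesis by (rule le_less_trans) simp
  qed
  with f show ?thesis by (simp add: Lip_set_pos_def)
qed

text \<open>Nonnegativity enters here: as \<open>0 \<le> V * \<phi> n \<le> V\<close> with equality near \<open>x\<close>, the generator of the
  truncation at \<open>x\<close> is at most the growth rate of \<open>V\<close> itself.\<close>
lemma truncated_generator_le:
  assumes V: "V \<in> C_weighted \<kappa>" "\<And>x. 0 \<le> V x" and v: "(\<lambda>x. V x * \<phi> n x) \<in> C_c_inf" and x: "norm x \<le> real n"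
    and le: "\<And>h. 0 < h \<Longrightarrow> h \<le> \<tau> \<Longrightarrow> T h V x \<le> V x + h * (D + M * h)" and \<tau>: "0 < \<tau>"
  shows "generator \<kappa> T (\<lambda>x. V x * \<phi> n x) x \<le> D"
proof -
  define v where "v = (\<lambda>x. V x * \<phi> n x)"
  define h where "h = (\<lambda>k. \<tau> * inverse (real (Suc k)))"
  have h_lim: "h \<longlonglongrightarrow> 0" unfolding h_def using tendsto_mult_right_zero[OF LIMSEQ_inverse_real_of_nat] .
  have h_pos: "0 < h k" "h k \<le> \<tau>" for k
    using \<tau> by (auto simp: h_def field_simps)
  have null: "pos_null_seq h" using h_pos h_lim by (simp add: pos_null_seq_def)
  have v_C: "v \<in> C_weighted \<kappa>" and gen: "has_generator_value \<kappa> T v (generator \<kappa> T v)"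
    using C_c_inf_generators[OF v] by (simp_all add: v_def)
  have "mixed_tendsto \<kappa> (\<lambda>k. diff_quot T (h k) v) (generator \<kappa> T v)"
    using gen null by (simp add: has_generator_value_def)
  then have "\<forall>K. compact K \<longrightarrow> uniform_limit K (\<lambda>k. diff_quot T (h k) v) (generator \<kappa> T v) sequentially"
    unfolding mixed_tendsto_def by (rule conjunct2)
  then have "uniform_limit {x} (\<lambda>k. diff_quot T (h k) v) (generator \<kappa> T v) sequentially"
    by (rule allE[of _ "{x}"]) simp
  then have "(\<lambda>k. diff_quot T (h k) v x) \<longlonglongrightarrow> generator \<kappa> T v x" by simp
  moreover have "(\<lambda>k. D + M * h k) \<longlonglongrightarrow> D + M * 0" by (intro tendsto_intros h_lim)
  moreover have "diff_quot T (h k) v x \<le> D + M * h k" for k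
  proof -
    have "T (h k) v x \<le> T (h k) V x"
      by (rule mono) (use h_pos[of k] v_C V phi_range in \<open>auto simp: v_def mult_left_le\<close>)
    also have "\<dots> \<le> V x + h k * (D + M * h k)" by (intro le h_pos)
    also have "V x = v x" using phi_one[OF x] by (simp add: v_def)
    finally have "T (h k) v x - v x \<le> (D + M * h k) * h k" by (simp add: mult.commute)
    then show ?thesis using h_pos(1)[of k] by (simp add: diff_quot_def divide_le_eq)
  qed
  ultimately have "generator \<kappa> T v x \<le> D + M * 0" by (intro LIMSEQ_le) auto
  then show ?thesis by (simp add: v_def)
qed

text \<open>The averaged orbit starting in \<open>f\<close> is a first order supersolution for \<open>S\<close>. The order of choices
  matters: the width \<open>\<epsilon>\<close> of the kernel in time determines its bound \<open>P\<close>, then \<open>N\<close> is taken so large that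
  \<open>P\<close> times the missed measure is at most of order \<open>\<epsilon>\<close>, and the width \<open>\<eta>\<close> of the mollifier in space is
  adapted to \<open>N\<close>.\<close>
lemma comparison_C_c_inf:
  assumes f: "f \<in> C_c_inf" "\<And>x. 0 \<le> f x" and t: "0 \<le> t"
  shows "S t f x \<le> T t f x"
proof -
  define u where "u = (\<lambda>s. T s f)"
  \<comment> \<open>the average at time \<open>s + h\<close> looks ahead by at most \<open>1\<close>, for \<open>s \<le> t\<close> and \<open>h \<le> 1\<close>\<close>
  define H where "H = t + 2"
  have H: "0 \<le> H" using t by (simp add: H_def)
  note f_C = C_c_inf_generators(1)[OF f(1)]
  have "0 \<le> H + 1" using H by simp
  from domain_orbit[OF f_C C_c_inf_generators(3)[OF f(1)] this]
  obtain A C where C: "0 \<le> C" and A: "\<And>s. 0 \<le> s \<Longrightarrow> s \<le> H + 1 \<Longrightarrow> wbound A (u s)"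
    and lip: "\<And>r s x. \<lbrakk>0 \<le> r; r \<le> H + 1; 0 \<le> s; s \<le> H + 1\<rbrakk> \<Longrightarrow> \<bar>u r x - u s x\<bar> \<le> C * \<bar>r - s\<bar> / \<kappa> x"
    unfolding u_def by blast
  have u_C: "u s \<in> C_weighted \<kappa>" if "0 \<le> s" for s unfolding u_def by (intro mem that f_C)
  have u_nonneg: "0 \<le> u s x" if "0 \<le> s" for s x unfolding u_def by (intro nonneg that f_C f)
  have u_Lip: "u s \<in> Lip_b" if "0 \<le> s" for s unfolding u_def by (intro T_Lip that C_c_inf_Lip_b f)
  have u_add: "T h (u s) = u (s + h)" if "0 \<le> s" "0 \<le> h" for s h
    using add_time[OF that(2,1) f_C] by (simp add: u_def add.commute)
  have u0: "u 0 = f" using zero_time[OF f_C] by (simp add: u_def)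
  have A0: "0 \<le> A" using wbound_nonneg[OF A[of 0]] H by simp
  have u_Lip_set: "u s \<in> Lip_set \<kappa> T" if s: "0 \<le> s" "s \<le> H" for s
  proof (rule Lip_set_from_bound[OF u_C[OF s(1)], of 1 C])
    fix h x assume "0 < (h::real)" "h \<le> 1"
    then show "\<bar>T h (u s) x - u s x\<bar> \<le> C * h / \<kappa> x"
      using lip[of "s + h" s x] s by (simp add: u_add)
  qed simp
  have Lip_D: "\<exists>L\<ge>0. (\<forall>x. \<bar>u s x\<bar> \<le> L) \<and> (\<forall>x y. \<bar>u s x - u s y\<bar> \<le> L * norm (x - y))" if s: "0 \<le> s" for s
  proof -
    obtain L1 where L1: "\<And>x. \<bar>u s x\<bar> \<le> L1" using u_Lip[OF s] by (auto simp: Lip_b_def bounded_iff)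
    obtain L2 where L2: "L2-lipschitz_on UNIV (u s)" using u_Lip[OF s] by (auto simp: Lip_b_def)
    have L2': "\<bar>u s x - u s y\<bar> \<le> L2 * norm (x - y)" for x y
      using lipschitz_onD[OF L2, of x y] by (simp add: dist_norm)
    have "\<bar>u s x - u s y\<bar> \<le> max (max L1 L2) 0 * norm (x - y)" for x y
      by (rule order_trans[OF L2']) (intro mult_right_mono, auto)
    moreover have "\<bar>u s x\<bar> \<le> max (max L1 L2) 0" for x using L1[of x] by simp
    ultimately show ?thesis by (intro exI[of _ "max (max L1 L2) 0"]) auto
  qed
  have cover: "\<exists>N. \<forall>n\<ge>N. s \<in> regular_times u H \<epsilon> (real (Suc n))" if s: "0 \<le> s" "s \<le> H" and \<epsilon>: "0 < \<epsilon>" for s \<epsilon>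
  proof -
    obtain L where L: "0 \<le> L" "\<And>x. \<bar>u s x\<bar> \<le> L" "\<And>x y. \<bar>u s x - u s y\<bar> \<le> L * norm (x - y)" using Lip_D[OF s(1)] by blast
    obtain \<delta> t0 where \<delta>: "0 < \<delta>" "0 < t0"
      and sh: "\<And>h x. \<lbrakk>h \<in> {0..t0}; norm x \<le> \<delta>\<rbrakk> \<Longrightarrow> T h (shift x (u s)) \<le> (\<lambda>y. shift x (T h (u s)) y + \<epsilon> * h / \<kappa> y)"
      using T_shift[of "u s" \<epsilon>] u_Lip_set[OF s] u_Lip[OF s(1)] u_nonneg[OF s(1)] \<epsilon> by blast
    obtain N :: nat where N: "L + 1 / \<delta> + 1 / t0 \<le> real N" using real_arch_simple by blast
    have inv: "0 < 1 / \<delta>" "0 < 1 / t0" using \<delta> by simp_all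
    have NL: "L \<le> real (Suc N)" and N\<delta>: "1 / \<delta> \<le> real (Suc N)" and Nt: "1 / t0 \<le> real (Suc N)"
      using N inv L(1) by linarith+
    have "s \<in> regular_times u H \<epsilon> (real (Suc N))"
      unfolding regular_times_def
    proof (intro CollectI conjI allI impI)
      show "s \<in> {0..H}" using s by simp
      show "\<bar>u s x\<bar> \<le> real (Suc N)" for x using L(2)[of x] NL by linarith
      show "\<bar>u s x - u s y\<bar> \<le> real (Suc N) * norm (x - y)" for x y
        by (rule order_trans[OF L(3)]) (intro mult_right_mono NL norm_ge_zero)
      fix h :: real and y x :: "real^'n" assume hy: "0 \<le> h \<and> h * real (Suc N) \<le> 1 \<and> norm y * real (Suc N) \<le> 1"
      have "norm y * (1 / \<delta>) \<le> norm y * real (Suc N)" by (intro mult_left_mono N\<delta> norm_ge_zero)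
      then have "norm y * (1 / \<delta>) \<le> 1" using hy by linarith
      then have y: "norm (- y) \<le> \<delta>" using \<delta> by (simp add: field_simps)
      have "h * (1 / t0) \<le> h * real (Suc N)" using hy by (intro mult_left_mono Nt) simp
      then have "h * (1 / t0) \<le> 1" using hy by linarith
      then have h: "h \<in> {0..t0}" using \<delta> hy by (simp add: field_simps)
      have "shift (- y) (u s) = (\<lambda>x. u s (x - y))" by (simp add: shift_def fun_eq_iff)
      moreover have "shift (- y) (T h (u s)) x = u (s + h) (x - y)" using u_add[of s h] s hy by (simp add: shift_def)
      ultimately show "T h (\<lambda>x. u s (x - y)) x \<le> u (s + h) (x - y) + \<epsilon> * h / \<kappa> x"
        using le_funD[OF sh[OF h y], of x] by simp
    qed
    then have "s \<in> regular_times u H \<epsilon> (real (Suc n))" if "N \<le> n" for n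
      using regular_times_mono[of "real (Suc N)" "real (Suc n)"] that by auto
    then show ?thesis by blast
  qed
  \<comment> \<open>constants that do not depend on \<open>\<epsilon>\<close>\<close>
  have cA: "0 \<le> c * A" using A0 c_ge_1 by simp
  obtain K where K: "\<And>C \<epsilon> x. \<lbrakk>0 \<le> C; 0 < \<epsilon>; \<epsilon> \<le> 1\<rbrakk> \<Longrightarrow> \<exists>R. S.absorbs (c * A) t K C \<epsilon> R x"
    by (rule S.absorb[OF cA t]) (rule that)
  obtain Q where Q: "S.lipschitz_bound (c * A) t Q" by (rule S.local_lipschitz[OF cA t])
  obtain L0 where L0: "0 \<le> L0" "\<And>x y. \<bar>u 0 x - u 0 y\<bar> \<le> L0 * norm (x - y)" using Lip_D[of 0] by auto
  obtain Lt where Lt: "0 \<le> Lt" "\<And>x y. \<bar>u t x - u t y\<bar> \<le> Lt * norm (x - y)" using Lip_D[of t] t by auto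
  define \<Lambda> where "\<Lambda> = max L0 Lt"
  have \<Lambda>: "0 \<le> \<Lambda>" "\<bar>u 0 x - u 0 y\<bar> \<le> \<Lambda> * norm (x - y)" "\<bar>u t x - u t y\<bar> \<le> \<Lambda> * norm (x - y)" for x y
    using L0 Lt order_trans[OF L0(2) mult_right_mono[of L0 \<Lambda> "norm (x - y)"]]
      order_trans[OF Lt(2) mult_right_mono[of Lt \<Lambda> "norm (x - y)"]] by (auto simp: \<Lambda>_def)
  define \<beta> where "\<beta> = c * (C * 2) + B"
  have main: "S t f x \<le> T t f x + \<epsilon> * (5 * t * K * (1 + 1 / \<kappa> x) + (1 + Q) * \<beta> / \<kappa> x)" if \<epsilon>: "0 < \<epsilon>" "5 * \<epsilon> \<le> 1" for \<epsilon>
  proof -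
    note eps = \<epsilon>
    obtain \<psi> \<psi>' :: "real \<Rightarrow> real" and P where \<psi>: "0 < P" "\<And>r. 0 \<le> \<psi> r" "\<And>r. \<psi> r \<le> P" "\<And>r. \<bar>\<psi>' r\<bar> \<le> P"
      "\<And>r. r \<notin> {0..\<epsilon>} \<Longrightarrow> \<psi> r = 0" "\<And>r. r \<notin> {0..\<epsilon>} \<Longrightarrow> \<psi>' r = 0"
      "continuous_on UNIV \<psi>" "continuous_on UNIV \<psi>'" "integrable lborel \<psi>" "(\<integral>r. \<psi> r \<partial>lborel) = 1"
      "\<And>r k. \<bar>\<psi> (r + k) - \<psi> r - k * \<psi>' r\<bar> \<le> P * k\<^sup>2"
      by (rule time_kernel_exists[OF \<epsilon>(1)]) (rule that)
    let ?E = "\<lambda>n. regular_times u H \<epsilon> (real (Suc n))"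
    have E_closed: "closed (?E n)" for n
      by (rule regular_times_closed[of H u A C]) (use u_C A lip C in auto)
    have "(\<lambda>n. missed (?E n) H) \<longlonglongrightarrow> 0"
    proof (rule missed_tendsto_0[OF E_closed])
      show "?E m \<subseteq> ?E n" if "m \<le> n" for m n using that by (intro regular_times_mono) auto
      show "{0..H} \<subseteq> (\<Union>n. ?E n)" using cover[OF _ _ \<epsilon>(1)] by fastforce
    qed
    moreover define \<mu> where "\<mu> = min \<epsilon> (\<epsilon> / (3 * c * C * P + 1))"
    have cCP: "0 < 3 * c * C * P + 1" using c_ge_1 C \<psi>(1) by (simp add: add_nonneg_pos)
    have "0 < \<mu>" using \<epsilon> cCP by (simp add: \<mu>_def)
    ultimately have "\<forall>\<^sub>F n in sequentially. missed (?E n) H < \<mu>" by (rule order_tendstoD)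
    moreover obtain N0 where "\<forall>n\<ge>N0. 0 \<in> ?E n" using cover[of 0, OF _ H \<epsilon>(1)] by auto
    then have "\<forall>\<^sub>F n in sequentially. 0 \<in> ?E n" by (auto simp: eventually_sequentially)
    ultimately have "\<forall>\<^sub>F n in sequentially. missed (?E n) H < \<mu> \<and> 0 \<in> ?E n" by eventually_elim auto
    then obtain n where n: "missed (?E n) H < \<mu>" "0 \<in> ?E n" by (auto simp: eventually_sequentially)
    define N where "N = real (Suc n)"
    define E where "E = regular_times u H \<epsilon> N"
    have m: "missed E H \<le> \<epsilon>" "3 * c * C * P * missed E H \<le> \<epsilon>" and E0: "0 \<in> E"
    proof -
      have mm: "missed E H \<le> \<mu>" using n by (simp add: E_def N_def)
      then show "missed E H \<le> \<epsilon>" by (simp add: \<mu>_def)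
      have "3 * c * C * P * missed E H \<le> (3 * c * C * P + 1) * missed E H"
        using missed_nonneg[of E H] by (intro mult_right_mono) auto
      also have "\<dots> \<le> (3 * c * C * P + 1) * (\<epsilon> / (3 * c * C * P + 1))"
        using mm cCP by (intro mult_left_mono) (auto simp: \<mu>_def)
      finally show "3 * c * C * P * missed E H \<le> \<epsilon>" using cCP by simp
      show "0 \<in> E" using n by (simp add: E_def N_def)
    qed
    define \<eta> where "\<eta> = min (1 / N) (\<epsilon> / (1 + \<Lambda>))"
    have N1: "1 \<le> N" by (simp add: N_def)
    have eta: "0 < \<eta>" "\<eta> \<le> 1 / N" "\<eta> \<le> \<epsilon> / (1 + \<Lambda>)" using N1 \<epsilon> \<Lambda>(1) by (auto simp: \<eta>_def)
    have "1 / N \<le> 1" using N1 by simp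
    then have \<eta>1: "\<eta> \<le> 1" using eta(2) by linarith
    obtain \<rho> :: "real^'n \<Rightarrow> real" where \<rho>: "\<rho> \<in> C_c_inf" "\<And>x. 0 \<le> \<rho> x" "\<And>x. \<eta> < norm x \<Longrightarrow> \<rho> x = 0"
      "integrable lborel \<rho>" "(\<integral>x. \<rho> x \<partial>lborel) = 1"
    proof (rule mollifier_exists[OF phi_smooth[of 0] _ _ eta(1)])
      show "0 \<le> \<phi> 0 x" for x using phi_range by simp
      show "0 < \<phi> 0 0" using phi_one[of 0 0] by simp
    qed (rule that)
    interpret averaged_orbit \<kappa> T c B \<eta> \<rho> u H A C N \<epsilon> \<epsilon> P E \<psi> \<psi>'
    proof unfold_locales
      show "closed E" using E_closed by (simp add: E_def N_def)
      show "E \<subseteq> {0..H}" by (auto simp: E_def regular_times_def)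
      show "0 \<le> u s x" if "s \<in> E" for s x using that by (intro u_nonneg) (auto simp: E_def regular_times_def)
      show "\<bar>u s x\<bar> \<le> N" "\<bar>u s x - u s y\<bar> \<le> N * norm (x - y)" if "s \<in> E" for s x y
        using that by (auto simp: E_def regular_times_def)
      show "T h (\<lambda>x. u s (x - y)) x \<le> u (s + h) (x - y) + \<epsilon> * h / \<kappa> x"
        if "s \<in> E" "0 \<le> h" "h * N \<le> 1" "norm y \<le> \<eta>" for s h x y
      proof -
        have "norm y * N \<le> 1 / N * N" using that(4) eta(2) N1 by (intro mult_right_mono) auto
        then have "norm y * N \<le> 1" using N1 by simp
        then show ?thesis using that by (auto simp: E_def regular_times_def)
      qed
    qed (use u_C A lip C H E0 N1 \<epsilon> \<psi> eta(1) \<eta>1 \<rho> in auto)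
    have sH: "s + 1 \<le> H" if "s \<le> t" for s using that by (simp add: H_def)
    define Z where "Z = c * (A * P * (2 * H))"
    have Z: "0 \<le> Z" using c_ge_1 A0 \<psi>(1) H by (simp add: Z_def)
    have super: "T h (V s) x \<le> V (s + h) x + 2 * \<epsilon> * h / \<kappa> x" if "0 \<le> s" "s \<le> t" "0 \<le> h" "h \<le> 1 / N" for s h x
    proof -
      have hN: "h * N \<le> 1" using that(4) N1 by (simp add: field_simps)
      have h1: "h \<le> 1" using that(4) \<open>1 / N \<le> 1\<close> by linarith
      have "T h (V s) x \<le> V (s + h) x + (\<epsilon> + 3 * c * C * P * missed E H) * h / \<kappa> x"
        by (rule V_supersolution) (use that hN h1 in \<open>auto simp: H_def\<close>)
      also have "\<dots> \<le> V (s + h) x + 2 * \<epsilon> * h / \<kappa> x"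
        using m(2) that(3) pos[of x] by (intro add_left_mono divide_right_mono mult_right_mono) auto
      finally show ?thesis .
    qed
    have taylor: "\<bar>V (s + h) x - V s x - h * V' s x\<bar> \<le> Z * h\<^sup>2 / \<kappa> x" if "0 \<le> s" "s \<le> t" "0 \<le> h" "h \<le> 1" for s h x
      unfolding Z_def by (rule V_taylor) (use that in \<open>auto simp: H_def\<close>)
    define L where "L = Z * (1 + H)"
    have L: "0 \<le> L" using Z H by (simp add: L_def)
    have V_lip: "\<bar>V r x - V s x\<bar> \<le> L * \<bar>r - s\<bar> / \<kappa> x" if "0 \<le> s" "s \<le> t + 1" "0 \<le> r" "r \<le> t + 1" for r s x
      unfolding L_def Z_def by (rule V_lipschitz) (use that in \<open>auto simp: H_def\<close>)
    have step: "\<exists>C\<ge>0. \<forall>R. \<exists>h0>0. \<forall>h x. 0 < h \<and> h \<le> h0 \<and> s + h \<le> t \<longrightarrow>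
         S h (V s) x \<le> V (s + h) x + h * ((5 * \<epsilon>) / \<kappa> x + C * far R x / \<kappa> x)" if s: "0 \<le> s" "s < t" for s
    proof -
      have sH1: "s + 1 \<le> H" using s by (intro sH) simp
      note V_s = V_C_b_inf[OF s(1) sH1] V_C[OF s(1) sH1] V_nonneg[OF s(1) sH1]
      have v_smooth: "(\<lambda>x. V s x * \<phi> n x) \<in> C_c_inf" for n by (rule C_b_inf_mult_C_c_inf[OF V_s(1) phi_smooth])
      have "V s \<in> Lip_set_pos \<kappa> T"
      proof (rule Lip_set_pos_from_bound[OF V_s(2), of "1 / N" "L + 2 * \<epsilon>"])
        fix h x assume h: "0 < h" "h \<le> 1 / N"
        then have "h \<le> 1" using \<open>1 / N \<le> 1\<close> by linarith
        then have "\<bar>V (s + h) x - V s x\<bar> \<le> L * h / \<kappa> x" using V_lip[of s "s + h" x] s h by simp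
        moreover have "T h (V s) x \<le> V (s + h) x + 2 * \<epsilon> * h / \<kappa> x" using s h by (intro super) auto
        ultimately show "T h (V s) x \<le> V s x + (L + 2 * \<epsilon>) * h / \<kappa> x"
          by (simp add: add_divide_distrib distrib_right)
      qed (use L \<epsilon> N1 in auto)
      then have "(SUP n. wnorm \<kappa> (pos_part (generator \<kappa> T (\<lambda>x. V s x * \<phi> n x)))) < \<infinity>"
        using B_bounded[of "V s"] V_s by blast
      from SUP_wnorm_finite[OF this]
      obtain b where b: "\<And>n. wbound b (pos_part (generator \<kappa> T (\<lambda>x. V s x * \<phi> n x)))" by blast
      have "\<exists>C\<ge>0. \<forall>R. \<exists>h0>0. \<forall>h x. 0 < h \<and> h \<le> h0 \<longrightarrow>
          S h (V s) x \<le> V s x + h * (V' s x + 2 * (2 * \<epsilon>) / \<kappa> x + C * far R x / \<kappa> x)"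
      proof (rule S.truncated_generator_growth[where \<phi> = \<phi> and a = "\<lambda>n. generator \<kappa> S (\<lambda>x. V s x * \<phi> n x)" and A = b])
        show "\<exists>m::nat. \<forall>x. real m < norm x \<longrightarrow> \<phi> n x = 0" for n
        proof -
          obtain r where r: "\<And>x. r < norm x \<Longrightarrow> \<phi> n x = 0" using phi_smooth[of n] by (auto simp: C_c_inf_iff)
          obtain m :: nat where "r \<le> real m" using real_arch_simple by blast
          then show ?thesis using r by (intro exI[of _ m]) auto
        qed
        have AB: "generator \<kappa> S (\<lambda>x. V s x * \<phi> n x) x \<le> generator \<kappa> T (\<lambda>x. V s x * \<phi> n x) x" for n x
          using A_le_B[OF v_smooth, of n] by (rule le_funD)
        show "generator \<kappa> S (\<lambda>x. V s x * \<phi> n x) x \<le> V' s x + 2 * \<epsilon> / \<kappa> x" if "norm x \<le> real n" for n x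
        proof (rule order_trans[OF AB], rule truncated_generator_le[OF V_s(2,3) v_smooth that, where \<tau> = "1 / N" and M = "Z / \<kappa> x"])
          fix h assume h: "0 < h" "h \<le> 1 / N"
          then have h1: "h \<le> 1" using \<open>1 / N \<le> 1\<close> by linarith
          have "T h (V s) x \<le> V (s + h) x + 2 * \<epsilon> * h / \<kappa> x" using s h by (intro super) auto
          moreover have "V (s + h) x \<le> V s x + h * V' s x + Z * h\<^sup>2 / \<kappa> x" using taylor[of s h x] s h h1 by simp
          ultimately show "T h (V s) x \<le> V s x + h * (V' s x + 2 * \<epsilon> / \<kappa> x + Z / \<kappa> x * h)"
            by (simp add: algebra_simps power2_eq_square)
        qed (use N1 in simp)
        show "generator \<kappa> S (\<lambda>x. V s x * \<phi> n x) x \<le> b / \<kappa> x" for n x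
          using AB[of n x] wboundD[OF b[of n], of x] by (simp add: pos_part_def)
      qed (use V_s phi_range phi_one C_c_inf_generators[OF v_smooth] V'_C[OF s(1) sH1] \<epsilon> in auto)
      then obtain C3 where C3: "0 \<le> C3" and C3': "\<And>R. \<exists>h0>0. \<forall>h x. 0 < h \<and> h \<le> h0 \<longrightarrow>
          S h (V s) x \<le> V s x + h * (V' s x + 2 * (2 * \<epsilon>) / \<kappa> x + C3 * far R x / \<kappa> x)" by blast
      have "\<exists>h0>0. \<forall>h x. 0 < h \<and> h \<le> h0 \<and> s + h \<le> t \<longrightarrow>
         S h (V s) x \<le> V (s + h) x + h * ((5 * \<epsilon>) / \<kappa> x + C3 * far R x / \<kappa> x)" for R
      proof -
        obtain h0 where h0: "0 < h0" "\<And>h x. 0 < h \<Longrightarrow> h \<le> h0 \<Longrightarrow>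
          S h (V s) x \<le> V s x + h * (V' s x + 2 * (2 * \<epsilon>) / \<kappa> x + C3 * far R x / \<kappa> x)" using C3'[of R] by blast
        \<comment> \<open>for such \<open>h\<close> the quadratic remainder in time is at most \<open>h * \<epsilon>/\<kappa>\<close>\<close>
        define h1 where "h1 = min (min h0 1) (\<epsilon> / (Z + 1))"
        have h1: "0 < h1" "h1 \<le> h0" "h1 \<le> 1" "h1 \<le> \<epsilon> / (Z + 1)" using h0(1) Z \<epsilon> by (auto simp: h1_def)
        have "S h (V s) x \<le> V (s + h) x + h * ((5 * \<epsilon>) / \<kappa> x + C3 * far R x / \<kappa> x)" if h: "0 < h" "h \<le> h1" for h x
        proof -
          have "Z * h \<le> (Z + 1) * (\<epsilon> / (Z + 1))" using Z h h1 by (intro mult_mono) auto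
          then have "Z * h \<le> \<epsilon>" using Z by simp
          then have "h * (Z * h / \<kappa> x) \<le> h * (\<epsilon> / \<kappa> x)" using h pos[of x] by (intro mult_left_mono divide_right_mono) auto
          moreover have "V s x + h * V' s x \<le> V (s + h) x + Z * h\<^sup>2 / \<kappa> x" using taylor[of s h x] s h h1 by simp
          moreover have "h * (Z * h / \<kappa> x) = Z * h\<^sup>2 / \<kappa> x" by (simp add: power2_eq_square)
          moreover have "S h (V s) x \<le> V s x + h * (V' s x + 2 * (2 * \<epsilon>) / \<kappa> x + C3 * far R x / \<kappa> x)"
            using h h1 by (intro h0) auto
          then have "S h (V s) x \<le> V s x + h * V' s x + (h * (2 * (2 * \<epsilon>) / \<kappa> x) + h * (C3 * far R x / \<kappa> x))"
            by (simp only: distrib_left add.assoc)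
          moreover have "(5 * \<epsilon>) / \<kappa> x = 2 * (2 * \<epsilon>) / \<kappa> x + \<epsilon> / \<kappa> x"
            by (simp flip: add_divide_distrib)
          then have "h * ((5 * \<epsilon>) / \<kappa> x + C3 * far R x / \<kappa> x) =
              h * (2 * (2 * \<epsilon>) / \<kappa> x) + h * (\<epsilon> / \<kappa> x) + h * (C3 * far R x / \<kappa> x)"
            by (simp only: distrib_left)
          ultimately show ?thesis by linarith
        qed
        then show ?thesis using h1(1) by blast
      qed
      then show ?thesis using C3 by blast
    qed
    have "S t (V 0) x \<le> V t x + t * (5 * \<epsilon>) * K * (1 + 1 / \<kappa> x)"
    proof (rule S.comparison_along_curve[OF cA t K])
      show "V s \<in> C_weighted \<kappa>" "wbound (c * A) (V s)" if "0 \<le> s" "s \<le> t" for s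
        using that by (auto intro!: V_C V_wbound sH)
      show "V r x \<le> V s x + L * \<bar>r - s\<bar> / \<kappa> x" if "0 \<le> r" "r \<le> t" "0 \<le> s" "s \<le> t" for r s x
        using V_lip[of s r x] that by (simp add: abs_le_iff)
      show "S.first_order_supersolution t (5 * \<epsilon>) V"
        unfolding S.first_order_supersolution_def by (intro ballI step) auto
    qed (use L eps in auto)
    have close: "\<bar>V s x - u s x\<bar> \<le> \<epsilon> * \<beta> / \<kappa> x" if "s = 0 \<or> s = t" for s x
    proof -
      have "\<bar>V s x - u s x\<bar> \<le> (c * (C * (\<epsilon> + missed E H)) + \<Lambda> * \<eta> * B) / \<kappa> x"
        by (rule V_close) (use that \<Lambda> t in \<open>auto simp: H_def\<close>)
      also have "\<dots> \<le> (\<epsilon> * \<beta>) / \<kappa> x"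
      proof (rule divide_right_mono)
        have "c * (C * (\<epsilon> + missed E H)) \<le> c * (C * (2 * \<epsilon>))" using m(1) C c_ge_1 by (intro mult_left_mono) auto
        moreover have "\<Lambda> * \<eta> \<le> (1 + \<Lambda>) * (\<epsilon> / (1 + \<Lambda>))" using eta \<Lambda>(1) by (intro mult_mono) auto
        then have "\<Lambda> * \<eta> * B \<le> \<epsilon> * B" using \<Lambda>(1) B_pos by (intro mult_right_mono) auto
        ultimately show "c * (C * (\<epsilon> + missed E H)) + \<Lambda> * \<eta> * B \<le> \<epsilon> * \<beta>" by (simp add: \<beta>_def algebra_simps)
      qed (use pos[of x] in simp)
      finally show ?thesis .
    qed
    have \<beta>0: "0 \<le> \<beta>" using C c_ge_1 B_pos by (simp add: \<beta>_def)
    have "S t f x \<le> S t (V 0) x + Q * (\<epsilon> * \<beta>) / \<kappa> x"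
    proof (rule S.lipschitz_boundD[OF Q])
      show "wbound (c * A) f"
        using wbound_mono[OF A[of 0], of "c * A"] mult_right_mono[OF c_ge_1 A0] H by (simp add: u0)
      show "f y \<le> V 0 y + \<epsilon> * \<beta> / \<kappa> y" for y using close[of 0 y] by (simp add: u0 abs_le_iff)
    qed (use t f_C V_C[of 0] V_wbound[of 0] sH[of 0] \<epsilon> \<beta>0 in auto)
    moreover have "V t x \<le> T t f x + \<epsilon> * \<beta> / \<kappa> x" using close[of t x] by (simp add: u_def abs_le_iff)
    ultimately have "S t f x \<le> T t f x + \<epsilon> * \<beta> / \<kappa> x + Q * (\<epsilon> * \<beta>) / \<kappa> x + t * (5 * \<epsilon>) * K * (1 + 1 / \<kappa> x)"
      using \<open>S t (V 0) x \<le> V t x + t * (5 * \<epsilon>) * K * (1 + 1 / \<kappa> x)\<close> by linarith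
    then show ?thesis by (simp add: algebra_simps add_divide_distrib)
  qed
  show ?thesis
    by (rule le_by_small_errors[of "1 / 5"], simp, rule main, auto)
qed

text \<open>Truncating and mollifying \<open>f\<close> gives a nonnegative smooth function of compact support that differs
  from \<open>f\<close> by \<open>\<epsilon>/\<kappa>\<close> and a part far away, which both semigroups absorb.\<close>
lemma comparison:
  assumes f: "f \<in> C_weighted \<kappa>" "\<And>x. 0 \<le> f x" and t: "0 \<le> t"
  shows "S t f x \<le> T t f x"
proof -
  obtain M where M: "0 < M" "wbound M f" using f(1) by (rule C_obtain)
  define M' where "M' = M + c * M + B"
  have M': "M \<le> M'" "0 \<le> M'" using M c_ge_1 B_pos by (simp_all add: M'_def)
  obtain K1 where K1: "\<And>C \<epsilon> x. \<lbrakk>0 \<le> C; 0 < \<epsilon>; \<epsilon> \<le> 1\<rbrakk> \<Longrightarrow> \<exists>R. S.absorbs M' t K1 C \<epsilon> R x"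
    by (rule S.absorb[OF M'(2) t]) (rule that)
  obtain K2 where K2: "\<And>C \<epsilon> x. \<lbrakk>0 \<le> C; 0 < \<epsilon>; \<epsilon> \<le> 1\<rbrakk> \<Longrightarrow> \<exists>R. absorbs M' t K2 C \<epsilon> R x"
    by (rule absorb[OF M'(2) t]) (rule that)
  have main: "S t f x \<le> T t f x + \<epsilon> * ((K1 + K2) * (1 + 1 / \<kappa> x))" if eps: "0 < \<epsilon>" "\<epsilon> \<le> 1" for \<epsilon>
  proof -
    obtain R1 where R1: "S.absorbs M' t K1 M' \<epsilon> R1 x" using K1[OF M'(2) eps] by blast
    obtain R2 where R2: "absorbs M' t K2 M' \<epsilon> R2 x" using K2[OF M'(2) eps] by blast
    define k where "k = max R1 R2 + 1"
    define g where "g = (\<lambda>x. f x * \<phi> k x)"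
    obtain r where r: "\<And>x. r < norm x \<Longrightarrow> \<phi> k x = 0" using phi_smooth[of k] by (auto simp: C_c_inf_iff)
    have g_cont: "continuous_on UNIV g" unfolding g_def
      by (intro continuous_on_mult C_cont f C_inf_continuous) (use phi_smooth in \<open>auto simp: C_c_inf_iff\<close>)
    have g_supp: "g x = 0" if "\<bar>r\<bar> < norm x" for x using r[of x] that by (simp add: g_def)
    have g_range: "0 \<le> g x" "g x \<le> f x" for x using f(2)[of x] phi_range[of k x] by (simp_all add: g_def mult_left_le)
    have g_M: "wbound M g" unfolding wbound_def using wboundD[OF M(2)] g_range by (metis abs_of_nonneg order_trans)
    have g_unif: "uniformly_continuous_on (cball 0 (\<bar>r\<bar> + 2)) g"
      by (intro compact_uniformly_continuous continuous_on_subset[OF g_cont]) auto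
    obtain D where D: "\<And>x. \<bar>g x\<bar> \<le> D"
    proof -
      have "bounded (g ` cball 0 \<bar>r\<bar>)"
        by (intro compact_imp_bounded compact_continuous_image continuous_on_subset[OF g_cont]) auto
      then obtain D where D: "\<And>x. norm x \<le> \<bar>r\<bar> \<Longrightarrow> \<bar>g x\<bar> \<le> D" unfolding bounded_iff by fastforce
      have "\<bar>g x\<bar> \<le> max D 0" for x using D[of x] g_supp[of x] by (cases "\<bar>r\<bar> < norm x") auto
      then show ?thesis by (rule that)
    qed
    have "0 < \<epsilon> / B" using eps B_pos by simp
    then obtain \<delta> where \<delta>: "0 < \<delta>" "\<And>x y. \<lbrakk>x \<in> cball 0 (\<bar>r\<bar> + 2); y \<in> cball 0 (\<bar>r\<bar> + 2); dist y x < \<delta>\<rbrakk> \<Longrightarrow> dist (g y) (g x) < \<epsilon> / B"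
      using g_unif unfolding uniformly_continuous_on_def by metis
    define \<eta> where "\<eta> = min 1 (\<delta> / 2)"
    have \<eta>: "0 < \<eta>" "\<eta> \<le> 1" "\<eta> < \<delta>" using \<delta>(1) by (auto simp: \<eta>_def)
    have g_shift: "\<bar>g (x - y) - g x\<bar> \<le> \<epsilon> / B" if "norm y \<le> \<eta>" for x y
    proof (cases "norm x \<le> \<bar>r\<bar> + 1")
      case True
      have "norm (x - y) \<le> \<bar>r\<bar> + 2" using norm_triangle_ineq4[of x y] True that \<eta> by linarith
      then have "x - y \<in> cball 0 (\<bar>r\<bar> + 2)" by simp
      moreover have "x \<in> cball 0 (\<bar>r\<bar> + 2)" using True by simp
      moreover have "dist (x - y) x < \<delta>" using that \<eta> by (simp add: dist_norm)
      ultimately have "dist (g (x - y)) (g x) < \<epsilon> / B" by (intro \<delta>(2))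
      then show ?thesis by (simp add: dist_real_def)
    next
      case False
      have "norm x \<le> norm (x - y) + norm y" using norm_triangle_ineq[of "x - y" y] by simp
      then have "g (x - y) = 0" using False that \<eta> by (intro g_supp) linarith
      moreover have "g x = 0" using False by (intro g_supp) linarith
      ultimately show ?thesis using \<open>0 < \<epsilon> / B\<close> by simp
    qed
    obtain \<rho> :: "real^'n \<Rightarrow> real" where \<rho>: "\<rho> \<in> C_c_inf" "\<And>x. 0 \<le> \<rho> x" "\<And>x. \<eta> < norm x \<Longrightarrow> \<rho> x = 0"
      "integrable lborel \<rho>" "(\<integral>x. \<rho> x \<partial>lborel) = 1"
    proof (rule mollifier_exists[OF phi_smooth[of 0] _ _ \<eta>(1)])
      show "0 \<le> \<phi> 0 x" for x using phi_range by simp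
      show "0 < \<phi> 0 0" using phi_one[of 0 0] by simp
    qed (rule that)
    interpret mollified \<kappa> T c B \<eta> \<rho> by unfold_locales (use \<eta> \<rho> in auto)
    define p where "p = convolution g \<rho>"
    note avg = convolution_average[OF g_cont D]
    have p: "p \<in> C_c_inf"
      unfolding p_def by (rule convolution_C_c_inf[OF borel_measurable_continuous_onI[OF g_cont] D g_supp \<rho>(1)])
    have p_nonneg: "0 \<le> p x" for x
      unfolding p_def avg(2) by (intro integral_nonneg_AE AE_I2 mult_nonneg_nonneg g_range \<rho>)
    have pg: "\<bar>p x - g x\<bar> \<le> \<epsilon> / \<kappa> x" for x
    proof -
      have i: "integrable lborel (\<lambda>y. (g (x - y) - g x) * \<rho> y)"
        unfolding left_diff_distrib by (intro Bochner_Integration.integrable_diff avg integrable_mult_right \<rho>)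
      have "p x - g x = (\<integral>y. (g (x - y) - g x) * \<rho> y \<partial>lborel)"
        unfolding left_diff_distrib p_def avg(2)
        by (subst Bochner_Integration.integral_diff) (auto intro!: avg integrable_mult_right \<rho> simp: \<rho>)
      also have "\<bar>\<dots>\<bar> \<le> \<epsilon> / B"
        by (rule average_abs_le[OF i \<rho>(4,2,5)]) (intro g_shift rho_supp)
      also have "\<dots> \<le> \<epsilon> / \<kappa> x" using bound[of x] pos[of x] eps B_pos by (intro divide_left_mono) auto
      finally show ?thesis .
    qed
    note p_C = C_c_inf_generators(1)[OF p]
    have "wbound (c * M) p"
      unfolding wbound_def p_def by (intro allI convolution_wbound[OF g_cont D g_M])
    then have p_M: "wbound M' p" by (rule wbound_mono) (use M B_pos in \<open>simp add: M'_def\<close>)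
    have fg: "f y \<le> g y + M' * far R y / \<kappa> y" if "R + 1 \<le> k" for R y
    proof (cases "norm y \<le> real k")
      case True
      then have "g y = f y" using phi_one[OF True] by (simp add: g_def)
      moreover have "0 \<le> M' * far R y / \<kappa> y" using M' far_range(1)[of R y] pos[of y] by (simp add: less_imp_le)
      ultimately show ?thesis by simp
    next
      case False
      then have "far R y = 1" using that by (intro far_one) linarith
      moreover have "f y \<le> M / \<kappa> y" using wboundD[OF M(2), of y] by simp
      moreover have "M / \<kappa> y \<le> M' / \<kappa> y" using M' pos[of y] by (intro divide_right_mono) auto
      ultimately show ?thesis using g_range(1)[of y] by simp
    qed
    have "S t f x \<le> S t p x + 1 * \<epsilon> * K1 * (1 + 1 / \<kappa> x)"
    proof (rule S.absorbsD[OF R1])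
      show "f y \<le> p y + 1 * (\<epsilon> / \<kappa> y + M' * far R1 y / \<kappa> y)" for y
        using fg[of R1 y] pg[of y] by (simp add: k_def abs_le_iff)
    qed (use t p_C p_M f in auto)
    also have "S t p x \<le> T t p x" by (rule comparison_C_c_inf[OF p p_nonneg t])
    also have "T t p x \<le> T t f x + 1 * \<epsilon> * K2 * (1 + 1 / \<kappa> x)"
    proof (rule absorbsD[OF R2])
      show "p y \<le> f y + 1 * (\<epsilon> / \<kappa> y + M' * far R2 y / \<kappa> y)" for y
      proof -
        have "0 \<le> M' * far R2 y / \<kappa> y" using M' far_range(1)[of R2 y] pos[of y] by (simp add: less_imp_le)
        then show ?thesis using g_range(2)[of y] pg[of y] by (simp add: abs_le_iff)
      qed
    qed (use t p_C f wbound_mono[OF M(2) M'(1)] in auto)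
    finally show ?thesis by (simp add: algebra_simps add_divide_distrib)
  qed
  show ?thesis
    by (rule le_by_small_errors[OF zero_less_one]) (rule main)
qed

end

theorem theorem4p9:
  fixes \<kappa> :: "real^'n::finite \<Rightarrow> real"
    and \<phi> :: "nat \<Rightarrow> real^'n \<Rightarrow> real"
    and S T :: "real \<Rightarrow> (real^'n \<Rightarrow> real) \<Rightarrow> (real^'n \<Rightarrow> real)"
  assumes kappa_pos: "\<And>x. 0 < \<kappa> x"
    and kappa_bounded: "bounded (range \<kappa>)"
    and kappa_cont: "continuous_on UNIV \<kappa>"
    and kappa_ratio: "(SUP x. SUP y\<in>cball 0 1. ereal (\<kappa> x / \<kappa> (x - y))) < \<infinity>"
    and phi_smooth: "\<And>n. \<phi> n \<in> C_c_inf"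
    and phi_range: "\<And>n x. 0 \<le> \<phi> n x \<and> \<phi> n x \<le> 1"
    and phi_one: "\<And>n x. norm x \<le> real n \<Longrightarrow> \<phi> n x = 1"
    and S: "convex_monotone_semigroup \<kappa> S"
    and T: "convex_monotone_semigroup \<kappa> T"
    and T_shift: "\<And>f \<epsilon>. \<lbrakk>f \<in> Lip_set \<kappa> T \<inter> Lip_b; \<forall>x. 0 \<le> f x; 0 < \<epsilon>\<rbrakk> \<Longrightarrow>
      \<exists>\<delta> t0. 0 < \<delta> \<and> 0 < t0 \<and> (\<forall>t\<in>{0..t0}. \<forall>x. norm x \<le> \<delta> \<longrightarrow>
        T t (shift x f) \<le> (\<lambda>y. shift x (T t f) y + \<epsilon> * t / \<kappa> y))"
    and T_Lip: "\<And>t f. \<lbrakk>0 \<le> t; f \<in> Lip_b\<rbrakk> \<Longrightarrow> T t f \<in> Lip_b"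
    and domains: "C_c_inf \<subseteq> gen_domain \<kappa> S \<inter> gen_domain \<kappa> T"
    and B_bounded: "\<And>f. \<lbrakk>f \<in> C_b_inf \<inter> Lip_set_pos \<kappa> T; \<forall>x. 0 \<le> f x\<rbrakk> \<Longrightarrow>
      (SUP n. wnorm \<kappa> (pos_part (generator \<kappa> T (\<lambda>x. f x * \<phi> n x)))) < \<infinity>"
    and A_le_B: "\<And>f. f \<in> C_c_inf \<Longrightarrow> generator \<kappa> S f \<le> generator \<kappa> T f"
  shows "\<forall>t\<ge>0. \<forall>f\<in>C_weighted \<kappa>. (\<forall>x. 0 \<le> f x) \<longrightarrow> S t f \<le> T t f"
proof -
  obtain B where B: "\<And>x. \<kappa> x \<le> B" using kappa_bounded unfolding bounded_iff by (auto dest: abs_le_D1)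
  let ?s = "SUP x. SUP y\<in>cball 0 1. ereal (\<kappa> x / \<kappa> (x - y))"
  have le: "ereal (\<kappa> x / \<kappa> (x - y)) \<le> ?s" if "norm y \<le> 1" for x y
    by (rule order_trans[OF SUP_upper[of y] SUP_upper[of x]]) (use that in auto)
  have "ereal 0 \<le> ereal (\<kappa> 0 / \<kappa> (0 - 0))" using kappa_pos[of 0] by simp
  then have "ereal 0 \<le> ?s" using le[of 0 0] by (rule order_trans) simp
  with kappa_ratio obtain c where c: "?s = ereal c" by (cases ?s) auto
  have ratio: "\<kappa> x \<le> c * \<kappa> (x - y)" if "norm y \<le> 1" for x y
    using le[OF that, of x] kappa_pos[of "x - y"] unfolding c by (simp add: divide_le_eq)
  interpret generator_comparison \<kappa> T c B S \<phi>
    by unfold_locales (fact ratio kappa_pos kappa_cont S T B phi_smooth phi_range phi_one T_shift T_Lip domains B_bounded A_le_B)+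
  show ?thesis unfolding le_fun_def using comparison by blast
qed

end
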